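(* Let $S$ be an $M$-pure symmetric numerical semigroup and $R=K[[t^S]]$ with maximal ideal $\mathbf m$. If $G(\mathbf m)$ is Buchsbaum, then it is Cohen-Macaulay.
   Context: $K$ is an infinite field. A numerical semigroup $S\subseteq\mathbb N$ (with $0\in S$) has minimal generators $g_1<\dots<g_n$ with $\gcd(g_1,\dots,g_n)=1$. $R=K[[t^S]]=K[[t^{g_1},\dots,t^{g_n}]]$, $\mathbf m=(t^{g_1},\dots,t^{g_n})$, $G(\mathbf m)=\bigoplus_{i\ge0}\mathbf m^i/\mathbf m^{i+1}$, and $\mathcal M$ is the homogeneous maximal ideal of $G(\mathbf m)$. $G(\mathbf m)$ is called Buchsbaum if $\mathcal M\cdot H^0_{\mathcal M}=0$, where $H^0_{\mathcal M}=\bigcup_{k\ge1}(0:_{G(\mathbf m)}\mathcal M^k)$. Let $g=\max(\mathbb Z\setminus S)$ (Frobenius number). $S$ is symmetric if for every integer $x$, $g-x\notin S$ implies $x\in S$. Apery set: $\mathrm{Ap}_{g_1}(S)=\{\omega_0,\dots,\omega_{g_1-1}\}$, where $\omega_i=\min\{s\in S: s\equiv i \bmod g_1\}$. Let $M=S\setminus\{0\}$, $hM=M+\dots+M$ ($h$ summands), $0M=S$. For $s\in S$, $\mathrm{ord}(s)=h$ if $s\in hM\setminus(h+1)M$. Partial order on $S$: $u\le_M u'$ if there is $s\in S$ with $u+s=u'$ and $\mathrm{ord}(u)+\mathrm{ord}(s)=\mathrm{ord}(u')$. $\mathrm{maxAp}_M(S)$ is the set of maximal elements of $\mathrm{Ap}_{g_1}(S)$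 with respect to $\le_M$. $S$ is $M$-pure if all elements of $\mathrm{maxAp}_M(S)$ have the same order $\mathrm{ord}$. *)

theory Defs
  imports
    "HOL-Computational_Algebra.Formal_Power_Series"
    "HOL-Library.Extended_Nat"
    "HOL-Algebra.Ideal_Product"
    "HOL-Algebra.QuotRing"
    "HOL-Algebra.Ring_Divisibility"
begin

section \<open>Numerical semigroups\<close>

definition min_gens :: "nat set \<Rightarrow> nat set" where
  "min_gens S = {x \<in> S - {0}. \<not> (\<exists>a \<in> S - {0}. \<exists>b \<in> S - {0}. x = a + b)}"

definition numerical_semigroup :: "nat set \<Rightarrow> bool" where
  "numerical_semigroup S \<longleftrightarrow>
     0 \<in> S \<and> (\<forall>a\<in>S. \<forall>b\<in>S. a + b \<in> S) \<and> Gcd (min_gens S) = 1"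

text \<open>The smallest minimal generator, written $g_1$ in the literature.\<close>

definition multiplicity_sg :: "nat set \<Rightarrow> nat" where
  "multiplicity_sg S = (LEAST x. x \<in> min_gens S)"

text \<open>The maximum is taken over the integers, so that the value for $S = \<nat>$ is $-1$.\<close>

definition frobenius :: "nat set \<Rightarrow> int" where
  "frobenius S = (GREATEST x::int. x \<notin> int ` S)"

definition symmetric_sg :: "nat set \<Rightarrow> bool" where
  "symmetric_sg S \<longleftrightarrow> (\<forall>x::int. frobenius S - x \<notin> int ` S \<longrightarrow> x \<in> int ` S)"

definition apery_elem :: "nat set \<Rightarrow> nat \<Rightarrow> nat" where
  "apery_elem S i = (LEAST s. s \<in> S \<and> s mod multiplicity_sg S = i mod multiplicity_sg S)"

definition apery :: "nat set \<Rightarrow> nat set" where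
  "apery S = apery_elem S ` {..<multiplicity_sg S}"

text \<open>
  With $M = S \setminus \{0\}$, this is $hM = M + \dots + M$ ($h$ summands) and $0M = S$.
  The recursion gives $1M = S + M$, which equals $M$ for a numerical semigroup.
\<close>

primrec multM :: "nat set \<Rightarrow> nat \<Rightarrow> nat set" where
  "multM S 0 = S"
| "multM S (Suc h) = {a + b | a b. a \<in> multM S h \<and> b \<in> S - {0}}"

definition ord_sg :: "nat set \<Rightarrow> nat \<Rightarrow> nat" where
  "ord_sg S s = (THE h. s \<in> multM S h - multM S (Suc h))"

definition le_M :: "nat set \<Rightarrow> nat \<Rightarrow> nat \<Rightarrow> bool" where
  "le_M S u u' \<longleftrightarrow> (\<exists>s\<in>S. u + s = u' \<and> ord_sg S u + ord_sg S s = ord_sg S u')"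

definition maxAp_M :: "nat set \<Rightarrow> nat set" where
  "maxAp_M S = {w \<in> apery S. \<forall>w' \<in> apery S. le_M S w w' \<longrightarrow> w' = w}"

definition M_pure :: "nat set \<Rightarrow> bool" where
  "M_pure S \<longleftrightarrow> (\<forall>w \<in> maxAp_M S. \<forall>w' \<in> maxAp_M S. ord_sg S w = ord_sg S w')"


section \<open>The semigroup ring\<close>

text \<open>The ring $K[[t^S]]$ of power series with support in $S$; \<open>fps_X\<close> plays the role of $t$.\<close>

definition semigroup_ring :: "nat set \<Rightarrow> 'k::field fps ring" where
  "semigroup_ring S =
     \<lparr>carrier = {f. \<forall>n. fps_nth f n \<noteq> 0 \<longrightarrow> n \<in> S},
      mult = (*), one = 1, zero = 0, add = (+)\<rparr>"

definition semigroup_max_ideal :: "nat set \<Rightarrow> 'k::field fps set" where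
  "semigroup_max_ideal S = Idl\<^bsub>semigroup_ring S\<^esub> ((\<lambda>g. fps_X ^ g) ` min_gens S)"


section \<open>The associated graded ring\<close>

primrec ideal_pow :: "('a, 'b) ring_scheme \<Rightarrow> 'a set \<Rightarrow> nat \<Rightarrow> 'a set" where
  "ideal_pow R I 0 = carrier R"
| "ideal_pow R I (Suc n) = ideal_prod R (ideal_pow R I n) I"

text \<open>
  An element of $\bigoplus_{i \ge 0} I^i / I^{i+1}$ is a finitely supported sequence whose $i$-th
  entry is a coset of $I^{i+1}$ with a representative in $I^i$.  The product of
  $a + I^{i+1}$ and $b + I^{j+1}$ is $ab + I^{i+j+1}$; the degree $n$ component of a
  product is summed in $R / I^{n+1}$, which contains $I^n / I^{n+1}$.
\<close>

definition assoc_graded :: "('a, 'b) ring_scheme \<Rightarrow> 'a set \<Rightarrow> (nat \<Rightarrow> 'a set) ring" where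
  "assoc_graded R I =
     \<lparr>carrier = {f. (\<forall>i. f i \<in> (\<lambda>a. ideal_pow R I (Suc i) +>\<^bsub>R\<^esub> a) ` ideal_pow R I i)
                    \<and> finite {i. f i \<noteq> ideal_pow R I (Suc i)}},
      mult = (\<lambda>f g n. finsum (R Quot ideal_pow R I (Suc n))
                        (\<lambda>i. rcoset_mult R (ideal_pow R I (Suc n)) (f i) (g (n - i))) {..n}),
      one = (\<lambda>n. if n = 0 then ideal_pow R I 1 +>\<^bsub>R\<^esub> \<one>\<^bsub>R\<^esub> else ideal_pow R I (Suc n)),
      zero = (\<lambda>n. ideal_pow R I (Suc n)),
      add = (\<lambda>f g n. f n <+>\<^bsub>R\<^esub> g n)\<rparr>"

text \<open>
  The ideal $\bigoplus_{i \ge 1} I^i / I^{i+1}$.  It is the homogeneous maximal ideal of the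
  associated graded ring when $I$ is a maximal ideal.
\<close>

definition graded_irrelevant :: "('a, 'b) ring_scheme \<Rightarrow> 'a set \<Rightarrow> (nat \<Rightarrow> 'a set) set" where
  "graded_irrelevant R I =
     {f \<in> carrier (assoc_graded R I). f 0 = \<zero>\<^bsub>assoc_graded R I\<^esub> 0}"


section \<open>Buchsbaum and Cohen-Macaulay rings\<close>

definition annihilator_in :: "('a, 'b) ring_scheme \<Rightarrow> 'a set \<Rightarrow> 'a set" where
  "annihilator_in G J = {f \<in> carrier G. \<forall>h\<in>J. f \<otimes>\<^bsub>G\<^esub> h = \<zero>\<^bsub>G\<^esub>}"

definition local_cohomology_0 :: "('a, 'b) ring_scheme \<Rightarrow> 'a set \<Rightarrow> 'a set" where
  "local_cohomology_0 G J = (\<Union>k\<in>{1..}. annihilator_in G (ideal_pow G J k))"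

definition buchsbaum :: "('a, 'b) ring_scheme \<Rightarrow> 'a set \<Rightarrow> bool" where
  "buchsbaum G J \<longleftrightarrow> ideal_prod G J (local_cohomology_0 G J) = {\<zero>\<^bsub>G\<^esub>}"

definition krull_dim :: "('a, 'b) ring_scheme \<Rightarrow> enat" where
  "krull_dim A = Sup {enat n | n. \<exists>P :: nat \<Rightarrow> 'a set.
     (\<forall>i\<le>n. primeideal (P i) A) \<and> (\<forall>i<n. P i \<subset> P (Suc i))}"

text \<open>
  $x_1, \dots, x_r$ is regular if $(x_1, \dots, x_r) \ne A$ and each $x_i$ is a nonzerodivisor on
  $A / (x_1, \dots, x_{i-1})$.
\<close>

definition regular_seq :: "('a, 'b) ring_scheme \<Rightarrow> 'a list \<Rightarrow> bool" where
  "regular_seq A xs \<longleftrightarrow>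
     set xs \<subseteq> carrier A \<and> Idl\<^bsub>A\<^esub> (set xs) \<noteq> carrier A \<and>
     (\<forall>i<length xs. \<forall>a\<in>carrier A.
        xs ! i \<otimes>\<^bsub>A\<^esub> a \<in> Idl\<^bsub>A\<^esub> (set (take i xs)) \<longrightarrow> a \<in> Idl\<^bsub>A\<^esub> (set (take i xs)))"

definition depth_on :: "('a, 'b) ring_scheme \<Rightarrow> 'a set \<Rightarrow> enat" where
  "depth_on A J = Sup {enat (length xs) | xs. set xs \<subseteq> J \<and> regular_seq A xs}"

definition loc_rel ::
    "('a, 'b) ring_scheme \<Rightarrow> 'a set \<Rightarrow> (('a \<times> 'a) \<times> ('a \<times> 'a)) set" where
  "loc_rel A P =
     {((a, s), (b, t)) | a s b t.
        a \<in> carrier A \<and> b \<in> carrier A \<and> s \<in> carrier A - P \<and> t \<in> carrier A - P \<and>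
        (\<exists>u \<in> carrier A - P. u \<otimes>\<^bsub>A\<^esub> (a \<otimes>\<^bsub>A\<^esub> t) = u \<otimes>\<^bsub>A\<^esub> (b \<otimes>\<^bsub>A\<^esub> s))}"

text \<open>The localization $A_P$ at a prime ideal $P$; the class of $(a, s)$ is the fraction $a/s$.\<close>

definition localize_at :: "('a, 'b) ring_scheme \<Rightarrow> 'a set \<Rightarrow> ('a \<times> 'a) set ring" where
  "localize_at A P =
     \<lparr>carrier = (carrier A \<times> (carrier A - P)) // loc_rel A P,
      mult = (\<lambda>X Y. \<Union>(a, s)\<in>X. \<Union>(b, t)\<in>Y. loc_rel A P `` {(a \<otimes>\<^bsub>A\<^esub> b, s \<otimes>\<^bsub>A\<^esub> t)}),
      one = loc_rel A P `` {(\<one>\<^bsub>A\<^esub>, \<one>\<^bsub>A\<^esub>)},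
      zero = loc_rel A P `` {(\<zero>\<^bsub>A\<^esub>, \<one>\<^bsub>A\<^esub>)},
      add = (\<lambda>X Y. \<Union>(a, s)\<in>X. \<Union>(b, t)\<in>Y.
               loc_rel A P `` {((a \<otimes>\<^bsub>A\<^esub> t) \<oplus>\<^bsub>A\<^esub> (b \<otimes>\<^bsub>A\<^esub> s), s \<otimes>\<^bsub>A\<^esub> t)})\<rparr>"

definition cohen_macaulay_local :: "('a, 'b) ring_scheme \<Rightarrow> bool" where
  "cohen_macaulay_local A \<longleftrightarrow>
     (\<exists>J. {I. maximalideal I A} = {J} \<and> depth_on A J = krull_dim A)"

text \<open>
  A Noetherian ring is Cohen-Macaulay if its localizations at all maximal ideals are
  Cohen-Macaulay local rings.  Noetherianity passes to localizations, so it is not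
  repeated in the local definition.
\<close>

definition cohen_macaulay :: "('a, 'b) ring_scheme \<Rightarrow> bool" where
  "cohen_macaulay A \<longleftrightarrow>
     cring A \<and> noetherian_ring A \<and>
     (\<forall>P. maximalideal P A \<longrightarrow> cohen_macaulay_local (localize_at A P))"

end

theory Submission
  imports Defs "HOL-Computational_Algebra.Polynomial"
begin

text \<open>
  The initial forms of the monomials \<open>t^s\<close> are a \<open>K\<close>-basis of \<open>G\<close>; the product of those of
  \<open>t^s\<close> and \<open>t^u\<close> is that of \<open>t^(s + u)\<close> if \<open>ord (s + u) = ord s + ord u\<close>, and 0 otherwise.
  Let \<open>x\<close> be the initial form of \<open>t^g1\<close>. A basis element killed by a power of \<open>x\<close> is killed by a power
  of the irrelevant ideal, hence by the irrelevant ideal itself if \<open>G\<close> is Buchsbaum. If such an element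
  \<open>s\<close> exists, then symmetry and purity, by which \<open>ord w + ord w' = ord wmax\<close> whenever \<open>w\<close>, \<open>w'\<close> are
  Apery elements with sum \<open>wmax = frobenius + g1\<close>, show that \<open>wmax\<close> is one, so
  \<open>ord (wmax + g1) \<ge> ord wmax + 2\<close>. Splitting off a summand \<open>b\<close> of \<open>wmax + g1\<close> gives an Apery
  element \<open>b\<close> whose dual \<open>wmax - b\<close> is killed by \<open>x\<close>, hence by \<open>b\<close>; but their product is
  \<open>wmax\<close>, which is not zero. So \<open>x\<close> is a nonzerodivisor.

  Then \<open>G\<close> is a free \<open>K[x]\<close>-module on the Apery set. A basis element \<open>s\<close> that is not a power of \<open>x\<close> is
  nilpotent, because \<open>ord s < s / g1\<close>. So the primes of \<open>G\<close> are those of \<open>K[x]\<close>, all chains have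
  length at most 1, and each maximal ideal contains a nonzero polynomial in \<open>x\<close>, which is regular.
\<close>

section \<open>Orders in numerical semigroups\<close>

text \<open>Why a power of \<open>x\<close> suffices: \<open>t^g1\<close> has a reduction number, so
  from some order on every basis element is \<open>x^j\<close> times another one, and what
  \<open>x^j\<close> kills is killed by a whole power of the irrelevant ideal. Why
  \<open>wmax\<close> inherits the defect of \<open>s = w + k * g1\<close>: adding the dual
  \<open>w'\<close> of \<open>w\<close> turns \<open>s\<close> into \<open>wmax + k * g1\<close>,
  and since orders add up on dual pairs, the surplus in the order survives. Why nilpotency follows:
  \<open>s - g1 * ord s\<close> is bounded on \<open>S\<close> and additive along nonzero products.
  Localizations at all maximal ideals have to be treated, homogeneous or not, so a regular
  \<open>x\<close> in the irrelevant ideal is not enough; a maximal ideal avoiding all nonzero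
  polynomials in \<open>x\<close> would make \<open>x\<close> invertible modulo it with an inverse
  in \<open>K[x]\<close>, which evaluation at 0 refutes. The cosets that make up \<open>G\<close>
  are handled through an isomorphic ring of finitely supported coefficient families, so that the
  structure over \<open>K[x]\<close> can be verified on the monomial basis.\<close>

locale num_semigroup =
  fixes S :: "nat set"
  assumes semigroup: "numerical_semigroup S"
begin

abbreviation "g1 \<equiv> multiplicity_sg S"
abbreviation "ord \<equiv> ord_sg S"

lemma zero_in: "0 \<in> S"
  and add_in: "a \<in> S \<Longrightarrow> b \<in> S \<Longrightarrow> a + b \<in> S"
  and Gcd_gens: "Gcd (min_gens S) = 1"
  using semigroup by (auto simp: numerical_semigroup_def)

section \<open>Generators and gaps\<close>

lemma mult_in: "a \<in> S \<Longrightarrow> k * a \<in> S"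
  by (induction k) (auto intro: zero_in add_in)

lemma gens_subset: "min_gens S \<subseteq> S - {0}"
  by (auto simp: min_gens_def)

lemma min_gen_summand:
  assumes "s \<in> S" "s \<noteq> 0"
  shows "\<exists>a\<in>min_gens S. \<exists>b\<in>S. s = a + b"
  using assms
proof (induction s rule: less_induct)
  case (less s)
  show ?case
  proof (cases "s \<in> min_gens S")
    case True
    then show ?thesis using zero_in by (metis add_0_right)
  next
    case False
    then obtain a b where ab: "a \<in> S - {0}" "b \<in> S - {0}" "s = a + b"
      using less.prems unfolding min_gens_def by blast
    then obtain c d where "c \<in> min_gens S" "d \<in> S" "a = c + d"
      using less.IH[of a] by auto
    then show ?thesis using ab add_in[of d b] by (auto simp: add.assoc)
  qed
qed

lemma g1_gen: "g1 \<in> min_gens S"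
proof -
  have "min_gens S \<noteq> {}" using Gcd_gens by auto
  then show ?thesis unfolding multiplicity_sg_def by (auto intro: LeastI)
qed

lemma g1_in: "g1 \<in> S" and g1_pos: "g1 > 0"
  using g1_gen gens_subset by auto

lemma g1_le: "s \<in> S \<Longrightarrow> s \<noteq> 0 \<Longrightarrow> g1 \<le> s"
  using min_gen_summand[of s] unfolding multiplicity_sg_def
  by (metis Least_le le_add1 order_trans)

text \<open>The least positive difference \<open>d\<close> of two elements of \<open>S\<close>
  divides every element of \<open>S\<close>, since remainders modulo \<open>d\<close> are
  differences again; coprime generators then force \<open>d = 1\<close>.\<close>

lemma consecutive: "\<exists>b. b \<in> S \<and> Suc b \<in> S"
proof -
  define D where "D = {d. d > 0 \<and> (\<exists>b\<in>S. b + d \<in> S)}"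
  define d where "d = (LEAST d. d \<in> D)"
  have "g1 \<in> D" using g1_pos g1_in zero_in by (auto simp: D_def intro!: bexI[of _ 0])
  then have "d \<in> D" unfolding d_def by (rule LeastI)
  then obtain b where b: "b \<in> S" "b + d \<in> S" "d > 0" by (auto simp: D_def)
  have "d dvd s" if s: "s \<in> S" for s
  proof (rule ccontr)
    assume "\<not> d dvd s"
    then have r: "s mod d > 0" "s mod d < d" using b by (auto simp: mod_greater_zero_iff_not_dvd)
    define q where "q = s div d"
    have "s = q * d + s mod d" by (simp add: q_def)
    \<comment> \<open>The remainder is the difference of \<open>q * b + s\<close> and
      \<open>q * (b + d)\<close>, both in \<open>S\<close>.\<close>
    then have "q * (b + d) + s mod d = q * b + s" unfolding distrib_left by linarith
    moreover have "q * b + s \<in> S" "q * (b + d) \<in> S" using mult_in add_in b s by auto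
    ultimately have "\<exists>b\<in>S. b + s mod d \<in> S" by metis
    then have "s mod d \<in> D" using r unfolding D_def by auto
    then have "d \<le> s mod d" unfolding d_def by (rule Least_le)
    with r show False by simp
  qed
  then have "d dvd Gcd (min_gens S)" using gens_subset by (intro Gcd_greatest) auto
  then have "d = 1" using Gcd_gens by simp
  then show ?thesis using b by auto
qed

text \<open>For \<open>b > 0\<close> write \<open>n = q * b + r\<close> with
  \<open>r < b \<le> q\<close> and trade \<open>r\<close> copies of \<open>b\<close> for
  \<open>Suc b\<close>: \<open>n = (q - r) * b + r * Suc b\<close>. This reaches every
  \<open>n \<ge> b * b\<close>.\<close>

lemma cofinite: "finite (- S)"
proof -
  obtain b where b: "b \<in> S" "Suc b \<in> S" using consecutive by blast
  have "n \<in> S" if "n \<ge> b * b" for n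
  proof (cases "b = 0")
    case True
    then show ?thesis using mult_in[OF b(2), of n] by simp
  next
    case False
    define q r where "q = n div b" and "r = n mod b"
    have "r < b" using False by (simp add: r_def)
    moreover have "b \<le> q" using div_le_mono[OF that, of b] False unfolding q_def by simp
    ultimately have "r \<le> q" by simp
    then obtain t where t: "q = r + t" using le_Suc_ex by blast
    have "n = q * b + r" by (simp add: q_def r_def)
    also have "\<dots> = t * b + r * Suc b" by (simp add: t algebra_simps)
    finally show ?thesis using add_in[OF mult_in[OF b(1)] mult_in[OF b(2)]] by metis
  qed
  then have "- S \<subseteq> {..< b * b}" by (auto simp: not_le[symmetric])
  then show ?thesis using finite_subset by blast
qed

section \<open>Sumsets and orders\<close>

declare multM.simps(2) [simp del]

lemma multM_SucI: "a \<in> multM S h \<Longrightarrow> b \<in> S \<Longrightarrow> b \<noteq> 0 \<Longrightarrow> a + b \<in> multM S (Suc h)"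
  unfolding multM.simps by blast

lemma multM_SucE:
  assumes "s \<in> multM S (Suc h)"
  obtains a b where "a \<in> multM S h" "b \<in> S" "b \<noteq> 0" "s = a + b"
  using assms unfolding multM.simps by blast

lemma multM_add_S: "a \<in> multM S h \<Longrightarrow> b \<in> S \<Longrightarrow> a + b \<in> multM S h"
proof (induction h arbitrary: a)
  case (Suc h)
  then obtain c d where cd: "c \<in> multM S h" "d \<in> S" "d \<noteq> 0" "a = c + d" by (blast elim: multM_SucE)
  then have "c + b \<in> multM S h" using Suc by blast
  moreover have "a + b = (c + b) + d" using cd by simp
  ultimately show ?case using cd multM_SucI by metis
qed (auto intro: add_in)

lemma multM_Suc_subset: "multM S (Suc h) \<subseteq> multM S h"
  using multM_add_S by (blast elim: multM_SucE)

lemma multM_antimono: "i \<le> j \<Longrightarrow> multM S j \<subseteq> multM S i"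
  by (induction rule: dec_induct) (use multM_Suc_subset in blast)+

lemma multM_ge: "a \<in> multM S h \<Longrightarrow> h * g1 \<le> a"
proof (induction h arbitrary: a)
  case (Suc h)
  then obtain c d where "c \<in> multM S h" "d \<in> S" "d \<noteq> 0" "a = c + d" by (blast elim: multM_SucE)
  then show ?case using Suc.IH[of c] g1_le[of d] by auto
qed auto

lemma multM_subset: "multM S h \<subseteq> S"
  using multM_antimono[of 0 h] by simp

lemma multM_add: "a \<in> multM S h \<Longrightarrow> b \<in> multM S k \<Longrightarrow> a + b \<in> multM S (h + k)"
proof (induction k arbitrary: b)
  case (Suc k)
  then obtain c d where "c \<in> multM S k" "d \<in> S" "d \<noteq> 0" "b = c + d" by (blast elim: multM_SucE)
  then show ?case using Suc multM_SucI[of "a + c" "h + k" d] by (simp add: add.assoc)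
qed (auto intro: multM_add_S)

lemma ord_eqI: "s \<in> multM S h \<Longrightarrow> s \<notin> multM S (Suc h) \<Longrightarrow> ord s = h"
  unfolding ord_sg_def
  by (rule the_equality) (use multM_antimono in \<open>auto, metis multM_antimono not_less_eq_eq subsetD nle_le\<close>)

lemma ord_spec:
  assumes "s \<in> S"
  shows "s \<in> multM S (ord s)" "s \<notin> multM S (Suc (ord s))"
proof -
  have "\<exists>h. s \<in> multM S h \<and> s \<notin> multM S (Suc h)"
  proof (rule ccontr)
    assume "\<not> ?thesis"
    then have "s \<in> multM S h" for h using assms by (induction h) auto
    \<comment> \<open>Elements of \<open>hM\<close> are at least \<open>h * g1 \<ge> h\<close>, so
      \<open>s\<close> cannot lie in \<open>multM S (Suc s)\<close>.\<close>
    from multM_ge[OF this, of "Suc s"] have "Suc s * g1 \<le> s" .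
    moreover have "Suc s * 1 \<le> Suc s * g1" using g1_pos by (intro mult_le_mono2) simp
    ultimately show False by simp
  qed
  then obtain h where h: "s \<in> multM S h" "s \<notin> multM S (Suc h)" by blast
  with ord_eqI[OF h] show "s \<in> multM S (ord s)" "s \<notin> multM S (Suc (ord s))" by auto
qed

lemma mem_multM_iff: "s \<in> multM S h \<longleftrightarrow> s \<in> S \<and> h \<le> ord s"
proof
  assume a: "s \<in> multM S h"
  then have "s \<in> S" using multM_subset by blast
  moreover have "h \<le> ord s"
  proof (rule ccontr)
    assume "\<not> h \<le> ord s"
    then have "multM S h \<subseteq> multM S (Suc (ord s))" by (intro multM_antimono) simp
    with a ord_spec[OF \<open>s \<in> S\<close>] show False by blast
  qed
  ultimately show "s \<in> S \<and> h \<le> ord s" ..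
qed (use ord_spec multM_antimono in blast)

lemma ord_add: "a \<in> S \<Longrightarrow> b \<in> S \<Longrightarrow> ord a + ord b \<le> ord (a + b)"
  using multM_add[of a "ord a" b "ord b"] mem_multM_iff ord_spec(1) by blast

lemma ord_ge: "s \<in> S \<Longrightarrow> ord s * g1 \<le> s"
  using multM_ge ord_spec(1) by blast

lemma ord_0 [simp]: "ord 0 = 0"
  using ord_ge[OF zero_in] g1_pos by simp

lemma ord_pos:
  assumes "s \<in> S" "s \<noteq> 0"
  shows "ord s > 0"
proof -
  have "0 + s \<in> multM S (Suc 0)" using multM_SucI[of 0 0 s] assms zero_in by simp
  then show ?thesis unfolding mem_multM_iff by simp
qed

lemma ord_eq_0_iff: "s \<in> S \<Longrightarrow> ord s = 0 \<longleftrightarrow> s = 0"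
  using ord_pos[of s] by (cases "s = 0") auto

lemma ord_mult: "s \<in> S \<Longrightarrow> k * ord s \<le> ord (k * s)"
proof (induction k)
  case (Suc k)
  have "ord s + ord (k * s) \<le> ord (s + k * s)" using ord_add[OF Suc.prems mult_in[OF Suc.prems]] .
  then show ?case using Suc.IH[OF Suc.prems] unfolding mult_Suc by linarith
qed simp

text \<open>\<open>ord s * g1 \<le> s\<close> bounds the order from above, superadditivity from
  below. In the graded ring this says that no power of \<open>x\<close> vanishes, which makes
  \<open>scale\<close> multiplicative.\<close>

lemma ord_mult_g1: "ord (k * g1) = k"
proof -
  have "ord (k * g1) * g1 \<le> k * g1" using ord_ge mult_in g1_in by blast
  then have "ord (k * g1) \<le> k" using g1_pos by simp
  moreover have "k * 1 \<le> k * ord g1" using ord_pos[OF g1_in] g1_pos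
    by (intro mult_le_mono2) simp
  ultimately show ?thesis using ord_mult[OF g1_in, of k] by linarith
qed

lemma ord_g1: "ord g1 = 1"
  using ord_mult_g1[of 1] by simp

lemma ord_add_mult_g1: "s \<in> S \<Longrightarrow> ord s + k \<le> ord (s + k * g1)"
  using ord_add[of s "k * g1"] mult_in[OF g1_in] ord_mult_g1 by simp

text \<open>Beyond \<open>Suc h * g1\<close>, an element of order at most \<open>h\<close> must be a
  gap shifted by \<open>Suc h * g1\<close>, and there are finitely many gaps. It makes the preimages
  under \<open>psi\<close> finitely supported.\<close>

lemma finite_ord_le: "finite {s \<in> S. ord s \<le> h}"
proof -
  have "{s \<in> S. ord s \<le> h} \<subseteq> {..< Suc h * g1} \<union> (\<lambda>x. x + Suc h * g1) ` (- S)"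
  proof
    fix s assume s: "s \<in> {s \<in> S. ord s \<le> h}"
    show "s \<in> {..< Suc h * g1} \<union> (\<lambda>x. x + Suc h * g1) ` (- S)"
    proof (cases "s < Suc h * g1")
      case False
      then have eq: "s = (s - Suc h * g1) + Suc h * g1" by simp
      have "s - Suc h * g1 \<notin> S"
        using ord_add_mult_g1[of "s - Suc h * g1" "Suc h"] s eq by auto
      then show ?thesis using eq by blast
    qed auto
  qed
  then show ?thesis using cofinite by (meson finite_UnI finite_imageI finite_lessThan finite_subset)
qed

text \<open>The sets \<open>D h = hM - h g1\<close> increase with \<open>h\<close> and contain \<open>S\<close>, which is cofinite, so
  they are eventually constant; this bounds the reduction number of \<open>t^g1\<close>.\<close>

lemma reduction_number: "\<exists>h0. \<forall>h\<ge>h0. \<forall>u\<in>multM S (Suc h). \<exists>v\<in>multM S h. u = v + g1"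
proof -
  define D where "D h = {x. x + h * g1 \<in> multM S h}" for h
  have D_Suc: "D h \<subseteq> D (Suc h)" for h
  proof
    fix x assume "x \<in> D h"
    then have "(x + h * g1) + g1 \<in> multM S (Suc h)"
      using multM_SucI g1_in g1_pos by (simp add: D_def)
    then show "x \<in> D (Suc h)" by (simp add: D_def ac_simps)
  qed
  then have D_mono: "h \<le> k \<Longrightarrow> D h \<subseteq> D k" for h k by (rule lift_Suc_mono_le)
  have "D 0 = S" by (simp add: D_def)
  then have fin: "finite (- D h)" for h
    using D_mono[of 0 h] cofinite by (metis Compl_subset_Compl_iff finite_subset le0)
  obtain h0 where h0: "\<And>h. card (- D h0) \<le> card (- D h)"
    using ex_has_least_nat[of "\<lambda>_. True" 0 "\<lambda>h. card (- D h)"] by auto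
  have D_eq: "D h = D h0" if "h \<ge> h0" for h
    using card_seteq[OF fin[of h0], of "- D h"] h0[of h] D_mono[OF that] by auto
  show ?thesis
  proof (intro exI[of _ h0] allI impI ballI)
    fix h u assume h: "h \<ge> h0" and u: "u \<in> multM S (Suc h)"
    then obtain x where x: "u = x + Suc h * g1" using multM_ge[OF u] le_Suc_ex by (metis add.commute)
    then have "x \<in> D (Suc h)" using u by (simp add: D_def)
    \<comment> \<open>Since \<open>D (Suc h) = D h\<close>, the witness is
      \<open>v = x + h * g1\<close>.\<close>
    then have "x \<in> D h" using D_eq h by (metis le_SucI)
    then show "\<exists>v\<in>multM S h. u = v + g1" using x by (auto simp: D_def ac_simps)
  qed
qed

text \<open>The threshold is \<open>h0 + j\<close> for the \<open>h0\<close> of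
  \<open>reduction_number\<close>, so that each of the \<open>j\<close> removals of
  \<open>g1\<close> starts at a level where one more is possible. Each removal lowers the order by
  exactly 1, because superadditivity forbids a smaller drop.\<close>

lemma reduction_number_iterate:
  "\<exists>h0. \<forall>u\<in>S. h0 \<le> ord u \<longrightarrow> (\<exists>v\<in>S. u = v + j * g1 \<and> ord u = ord v + j)"
proof -
  obtain h0 where h0: "\<And>h u. h \<ge> h0 \<Longrightarrow> u \<in> multM S (Suc h) \<Longrightarrow> \<exists>v\<in>multM S h. u = v + g1"
    using reduction_number by blast
  have "\<exists>v\<in>S. u = v + j * g1 \<and> ord u = ord v + j" if "u \<in> S" "h0 + j \<le> ord u" for u
    using that
  proof (induction j arbitrary: u)
    case (Suc j)
    then obtain h where h: "ord u = Suc h" "h \<ge> h0 + j" by (cases "ord u") auto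
    then obtain v where v: "v \<in> multM S h" "u = v + g1"
      using h0[of h u] ord_spec(1)[OF Suc.prems(1)] by auto
    then have v': "v \<in> S" "ord v \<ge> h" using mem_multM_iff by auto
    then have "ord v = h" using ord_add[of v g1] g1_in ord_g1 v h by simp
    with Suc.IH[of v] v' h obtain w where "w \<in> S" "v = w + j * g1" "ord v = ord w + j" by auto
    then show ?case using v h \<open>ord v = h\<close> by (intro bexI[of _ w]) auto
  qed auto
  then show ?thesis by blast
qed

section \<open>The Apery set\<close>

lemma apery_elem_spec: "apery_elem S i \<in> S \<and> apery_elem S i mod g1 = i mod g1"
proof -
  have "\<exists>s. s \<in> S \<and> s mod g1 = i mod g1"
  proof (rule ccontr)
    assume "\<not> ?thesis"
    then have "range (\<lambda>k. i + k * g1) \<subseteq> - S" by auto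
    moreover have "infinite (range (\<lambda>k. i + k * g1))"
      using g1_pos by (intro range_inj_infinite) (auto simp: inj_on_def)
    ultimately show False using cofinite finite_subset by blast
  qed
  from LeastI_ex[OF this] show ?thesis unfolding apery_elem_def by simp
qed

lemma apery_elem_le: "s \<in> S \<Longrightarrow> s mod g1 = i mod g1 \<Longrightarrow> apery_elem S i \<le> s"
  unfolding apery_elem_def by (intro Least_le) auto

text \<open>Minima of residue classes are awkward for sums; symmetry and divisibility by
  \<open>t^g1\<close> speak about whether a \<open>g1\<close> can be split off.\<close>

lemma apery_eq: "apery S = {w \<in> S. \<forall>v\<in>S. w \<noteq> v + g1}"
proof -
  note spec = apery_elem_spec and least = apery_elem_le
  show ?thesis
  proof (intro equalityI subsetI)
    fix w assume "w \<in> apery S"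
    then obtain i where i: "w = apery_elem S i" by (auto simp: apery_def)
    have "w \<noteq> v + g1" if "v \<in> S" for v
      using least[OF that, of i] spec[of i] i g1_pos by auto
    then show "w \<in> {w \<in> S. \<forall>v\<in>S. w \<noteq> v + g1}" using spec i by auto
  next
    fix w assume w: "w \<in> {w \<in> S. \<forall>v\<in>S. w \<noteq> v + g1}"
    define a where "a = apery_elem S (w mod g1)"
    have a: "a \<in> S" "a mod g1 = w mod g1" "a \<le> w"
      using spec[of "w mod g1"] least[of w "w mod g1"] w by (auto simp: a_def)
    then have "g1 dvd w - a" by (metis mod_eq_dvd_iff_nat)
    then obtain k where "w - a = k * g1" by (metis dvdE mult.commute)
    then have k: "w = a + k * g1" using a by simp
    have "k = 0"
    proof (rule ccontr)
      assume "k \<noteq> 0"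
      then obtain l where "k = Suc l" by (cases k) auto
      then have "w = (a + l * g1) + g1" using k by simp
      moreover have "a + l * g1 \<in> S" using a add_in mult_in g1_in by auto
      ultimately show False using w by blast
    qed
    then show "w \<in> apery S" using k g1_pos by (auto simp: apery_def a_def)
  qed
qed

lemma apery_decomp:
  assumes "s \<in> S"
  shows "\<exists>w\<in>apery S. \<exists>k. s = w + k * g1"
  using assms
proof (induction s rule: less_induct)
  case (less s)
  show ?case
  proof (cases "s \<in> apery S")
    case True
    then show ?thesis by (intro bexI[of _ s] exI[of _ 0]) auto
  next
    case False
    then obtain v where v: "v \<in> S" "s = v + g1" using less.prems by (auto simp: apery_eq)
    then obtain w k where "w \<in> apery S" "v = w + k * g1" using less.IH[of v] g1_pos by auto
    then show ?thesis using v by (intro bexI[of _ w] exI[of _ "Suc k"]) auto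
  qed
qed

text \<open>With all gaps below \<open>N\<close>, an \<open>s \<ge> g1 * (ord s + 1) + N\<close>
  would stay in \<open>S\<close> after removing \<open>ord s + 1\<close> copies of
  \<open>g1\<close>, and so have order above \<open>ord s\<close>.\<close>

lemma ord_lower_bound: "\<exists>C. \<forall>s\<in>S. s < g1 * ord s + C"
proof -
  obtain N where N: "- S \<subseteq> {..<N}" using cofinite finite_nat_set_iff_bounded by auto
  have "s < g1 * ord s + (g1 + N)" if s: "s \<in> S" for s
  proof (rule ccontr)
    assume "\<not> s < g1 * ord s + (g1 + N)"
    then obtain r where r: "s = g1 * ord s + (g1 + N) + r" using le_Suc_ex not_less by metis
    have "N + r \<in> S" using N by auto
    moreover have "s = (N + r) + Suc (ord s) * g1" using r by (simp add: mult.commute)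
    ultimately show False using ord_add_mult_g1[of "N + r" "Suc (ord s)"] by simp
  qed
  then show ?thesis by blast
qed

lemma frobenius_notin: "frobenius S \<notin> int ` S"
proof -
  obtain N where N: "- S \<subseteq> {..N}" using cofinite finite_nat_set_iff_bounded_le by auto
  have bd: "x \<le> int N" if "x \<notin> int ` S" for x
    using that N by (cases x) (auto simp: subset_iff)
  have neg: "-1 \<notin> int ` S" by auto
  \<comment> \<open>The integers outside \<open>S\<close> are unbounded below, so the maximum is
    taken over a finite upper part; it includes -1 in order to be nonempty also when
    \<open>S\<close> has no gaps.\<close>
  define X where "X = {x. x \<notin> int ` S \<and> x \<ge> -1}"
  have "X \<subseteq> {-1..int N}" using bd by (auto simp: X_def)
  then have fin: "finite X" by (rule finite_subset) simp
  have "X \<noteq> {}" using neg by (auto simp: X_def)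
  then have mx: "Max X \<notin> int ` S" "Max X \<ge> -1" using Max_in[OF fin] by (auto simp: X_def)
  have up: "x \<le> Max X" if "x \<notin> int ` S" for x
    using that Max_ge[OF fin, of x] mx(2) by (cases "x \<ge> -1") (auto simp: X_def)
  have "frobenius S = Max X" unfolding frobenius_def by (rule Greatest_equality) (use mx up in auto)
  then show ?thesis using mx by simp
qed

end

section \<open>Duality of Apery elements\<close>

locale pure_symmetric_semigroup = num_semigroup +
  assumes pure: "M_pure S" and sym: "symmetric_sg S"
begin

text \<open>Nothing is truncated by \<open>nat\<close>: the Frobenius number is at least -1 and
  \<open>g1\<close> is positive.\<close>

definition wmax :: nat where "wmax = nat (frobenius S + int g1)"

text \<open>As \<open>w - g1\<close> is outside \<open>S\<close>, symmetry puts
  \<open>wmax - w\<close> into \<open>S\<close>. Were that equal to \<open>v + g1\<close>, the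
  Frobenius number would be \<open>w + v\<close>, an element of \<open>S\<close>.\<close>

lemma apery_dual:
  assumes "w \<in> apery S"
  shows "\<exists>w'\<in>apery S. w + w' = wmax"
proof -
  let ?x = "frobenius S + int g1 - int w"
  have w: "w \<in> S" "\<And>v. v \<in> S \<Longrightarrow> w \<noteq> v + g1" using assms by (auto simp: apery_eq)
  have "frobenius S - ?x \<notin> int ` S"
  proof
    assume "frobenius S - ?x \<in> int ` S"
    then obtain v where "v \<in> S" "int w = int v + int g1" by auto
    then show False using w(2)[of v] by linarith
  qed
  then have "?x \<in> int ` S" using sym by (auto simp: symmetric_sg_def)
  then obtain y where y: "y \<in> S" "?x = int y" by auto
  then have sum: "w + y = wmax" unfolding wmax_def by linarith
  have "y \<noteq> v + g1" if "v \<in> S" for v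
  proof
    assume "y = v + g1"
    then have "frobenius S = int (w + v)" using y by simp
    then show False using frobenius_notin add_in[OF w(1) that] by (metis imageI)
  qed
  then show ?thesis using y sum by (auto simp: apery_eq)
qed

lemma zero_apery: "0 \<in> apery S"
  using zero_in g1_pos by (auto simp: apery_eq)

lemma wmax_apery: "wmax \<in> apery S"
  using apery_dual[OF zero_apery] by auto

lemma apery_in: "w \<in> apery S \<Longrightarrow> w \<in> S"
  by (auto simp: apery_eq)

lemma apery_le_wmax: "w \<in> apery S \<Longrightarrow> w \<le> wmax"
  using apery_dual[of w] by auto

lemma exists_maximal_above:
  "w \<in> apery S \<Longrightarrow> \<exists>v\<in>maxAp_M S. le_M S w v"
proof (induction "wmax - w" arbitrary: w rule: less_induct)
  case less
  show ?case
  proof (cases "w \<in> maxAp_M S")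
    case True
    then show ?thesis using zero_in by (intro bexI[of _ w]) (auto simp: le_M_def intro!: bexI[of _ 0])
  next
    case False
    then obtain v where v: "v \<in> apery S" "le_M S w v" "v \<noteq> w"
      using less.prems by (auto simp: maxAp_M_def)
    then have "w < v" by (auto simp: le_M_def)
    then have "wmax - v < wmax - w" using apery_le_wmax[OF v(1)] by simp
    from less.hyps[OF this v(1)] obtain u where u: "u \<in> maxAp_M S" "le_M S v u" by blast
    have "le_M S w u"
    proof -
      obtain s where s: "s \<in> S" "w + s = v" "ord w + ord s = ord v"
        using v(2) by (auto simp: le_M_def)
      obtain t where t: "t \<in> S" "v + t = u" "ord v + ord t = ord u"
        using u(2) by (auto simp: le_M_def)
      \<comment> \<open>Transitivity of \<open>le_M\<close>: superadditivity for
        \<open>w + (s + t)\<close> and for \<open>s + t\<close> gives the two inequalities.\<close>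
      have "ord w + ord (s + t) \<le> ord u"
        using ord_add[OF apery_in[OF less.prems] add_in[OF s(1) t(1)]] s(2) t(2)
        by (simp add: add.assoc[symmetric])
      moreover have "ord s + ord t \<le> ord (s + t)" using ord_add s t by blast
      ultimately have "ord w + ord (s + t) = ord u" using s t by linarith
      then show ?thesis using s t add_in[OF s(1) t(1)] by (auto simp: le_M_def add.assoc)
    qed
    then show ?thesis using u by blast
  qed
qed

text \<open>Purity forces \<open>wmax\<close> to be the only maximal element: a maximal \<open>v\<close> and its dual \<open>v'\<close>
  satisfy \<open>ord v + ord v' \<le> ord wmax = ord v\<close>.\<close>

lemma apery_ord_additive:
  assumes "w \<in> apery S" "w + w' = wmax"
  shows "ord w + ord w' = ord wmax"
proof -
  obtain v where v: "v \<in> maxAp_M S" "le_M S w v" using exists_maximal_above assms by blast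
  have vA: "v \<in> apery S" using v by (simp add: maxAp_M_def)
  obtain v' where v': "v' \<in> apery S" "v + v' = wmax" using apery_dual[OF vA] by blast
  have "u = wmax" if "u \<in> apery S" "le_M S wmax u" for u
  proof -
    have "wmax \<le> u" using that(2) by (auto simp: le_M_def)
    then show ?thesis using apery_le_wmax[OF that(1)] by simp
  qed
  then have "wmax \<in> maxAp_M S" using wmax_apery by (simp add: maxAp_M_def)
  then have "ord v = ord wmax" using pure v(1) unfolding M_pure_def by blast
  moreover have "ord v + ord v' \<le> ord wmax" using ord_add[OF apery_in[OF vA] apery_in[OF v'(1)]] v' by simp
  ultimately have "ord v' = 0" by simp
  then have "v = wmax" using ord_eq_0_iff[OF apery_in[OF v'(1)]] v'(2) by simp
  then obtain s where "w + s = wmax" "ord w + ord s = ord wmax" using v(2) by (auto simp: le_M_def)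
  then show ?thesis using assms(2) by (metis add_left_cancel)
qed

text \<open>In terms of the graded ring, the hypothesis says that an element killed by a power of
  \<open>(t^g1)\<^sup>*\<close> is killed by the irrelevant ideal.\<close>

theorem ord_add_g1:
  assumes B: "\<And>s j u. s \<in> S \<Longrightarrow> ord (s + j * g1) \<noteq> ord s + j \<Longrightarrow> u \<in> S \<Longrightarrow> u \<noteq> 0
                \<Longrightarrow> ord (s + u) \<noteq> ord s + ord u"
    and s: "s \<in> S"
  shows "ord (s + g1) = ord s + 1"
proof (rule ccontr)
  assume bad: "ord (s + g1) \<noteq> ord s + 1"
  obtain w k where w: "w \<in> apery S" "s = w + k * g1" using apery_decomp[OF s] by blast
  obtain w' where w': "w' \<in> apery S" "w + w' = wmax" using apery_dual[OF w(1)] by blast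
  have add: "ord w + ord w' = ord wmax" by (rule apery_ord_additive) (use w w' in auto)
  have wS: "w \<in> S" "w' \<in> S" "wmax \<in> S" using apery_in w w' wmax_apery by auto
  have s_ord: "ord w + k \<le> ord s" using ord_add_mult_g1[OF wS(1), of k] w by simp
  \<comment> \<open>The order surplus moves from \<open>s\<close> to \<open>wmax\<close> by adding
    the dual \<open>w'\<close>. If \<open>w' = 0\<close>, then \<open>s = wmax + k * g1\<close>
    already and \<open>j = Suc k\<close> works; otherwise the hypothesis for \<open>u = w'\<close>
    makes \<open>j = k\<close> work.\<close>
  have "\<exists>j. ord (wmax + j * g1) \<noteq> ord wmax + j"
  proof (cases "w' = 0")
    case True
    then have "ord (wmax + Suc k * g1) = ord (s + g1)" using w w' by (simp add: ac_simps)
    moreover have "ord (s + g1) > ord wmax + Suc k"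
      using bad ord_add_mult_g1[OF s, of 1] s_ord add True by simp
    ultimately show ?thesis by (metis less_irrefl)
  next
    case False
    have "ord (s + w') \<noteq> ord s + ord w'" using B[of s 1 w'] bad s wS False by simp
    then have "ord (s + w') > ord s + ord w'" using ord_add[OF s wS(2)] by simp
    moreover have "s + w' = wmax + k * g1" using w w' by simp
    ultimately show ?thesis using s_ord add by (metis add.commute add_less_cancel_right
          add.assoc le_less_trans less_irrefl add_le_mono1)
  qed
  then obtain j where "ord (wmax + j * g1) \<noteq> ord wmax + j" by blast
  \<comment> \<open>Taking \<open>u = g1\<close> replaces the unknown exponent \<open>j\<close> by
    1.\<close>
  from B[OF wS(3) this g1_in] have "ord (wmax + g1) \<noteq> ord wmax + 1" using g1_pos ord_g1 by simp
  then have "ord wmax + 2 \<le> ord (wmax + g1)" using ord_add[OF wS(3) g1_in] ord_g1 by simp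
  then have "wmax + g1 \<in> multM S (Suc (ord wmax + 1))"
    using mem_multM_iff add_in[OF wS(3) g1_in] by simp
  then obtain a b where ab: "a \<in> multM S (ord wmax + 1)" "b \<in> S" "b \<noteq> 0" "wmax + g1 = a + b"
    by (rule multM_SucE)
  have a: "a \<in> S" "ord wmax + 1 \<le> ord a" using mem_multM_iff ab(1) by auto
  \<comment> \<open>Removing a \<open>g1\<close> from \<open>b\<close> would write
    \<open>wmax\<close> as \<open>a + v\<close> although \<open>a\<close> alone has larger order
    than \<open>wmax\<close>.\<close>
  have "b \<in> apery S"
  proof -
    have "b \<noteq> v + g1" if "v \<in> S" for v
    proof
      assume "b = v + g1"
      then have "wmax = a + v" using ab by simp
      then show False using ord_add[OF a(1) that] a by simp
    qed
    then show ?thesis using ab by (auto simp: apery_eq)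
  qed
  then obtain c where c: "c \<in> apery S" "b + c = wmax" using apery_dual by blast
  have cadd: "ord b + ord c = ord wmax" by (rule apery_ord_additive) (use c \<open>b \<in> apery S\<close> in auto)
  have "a = c + g1" using c ab by simp
  \<comment> \<open>\<open>ord a > ord wmax = ord b + ord c \<ge> 1 + ord c\<close>, the last step
    because \<open>b\<close> is nonzero.\<close>
  then have "ord (c + 1 * g1) \<noteq> ord c + 1" using a cadd ord_pos[OF ab(2,3)] by simp
  from B[OF apery_in[OF c(1)] this ab(2,3)] show False using c cadd by (simp add: add.commute)
qed

end

section \<open>One-dimensional local rings\<close>

text \<open>Both colon ideals used below contain a maximal \<open>T\<close>-avoiding ideal \<open>M\<close> strictly and hence
  meet \<open>T\<close>.\<close>

lemma (in cring) exists_prime_avoiding: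
  assumes I: "ideal I R" and T: "T \<subseteq> carrier R"
    and T_mult: "\<And>s t. s \<in> T \<Longrightarrow> t \<in> T \<Longrightarrow> s \<otimes> t \<in> T"
    and T_ne: "T \<noteq> {}" and disj: "I \<inter> T = {}"
  shows "\<exists>Q. primeideal Q R \<and> I \<subseteq> Q \<and> Q \<inter> T = {}"
proof -
  define A where "A = {J. ideal J R \<and> I \<subseteq> J \<and> J \<inter> T = {}}"
  have "\<exists>M\<in>A. \<forall>X\<in>A. M \<subseteq> X \<longrightarrow> X = M"
  proof (rule subset_Zorn_nonempty)
    show "A \<noteq> {}" using I disj by (auto simp: A_def)
    fix C assume C: "C \<noteq> {}" "subset.chain A C"
    then have "subset.chain {I. ideal I R} C"
      unfolding A_def pred_on.chain_def by blast
    from chain_Union_is_ideal[OF this] C(1) have "ideal (\<Union>C) R" by simp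
    moreover have "C \<subseteq> A" using C(2) by (auto simp: pred_on.chain_def)
    ultimately show "\<Union>C \<in> A" using C(1) by (fastforce simp: A_def)
  qed
  then obtain M where M: "M \<in> A" and max: "\<And>X. X \<in> A \<Longrightarrow> M \<subseteq> X \<Longrightarrow> X = M" by blast
  have MI: "ideal M R" "I \<subseteq> M" "M \<inter> T = {}" using M by (auto simp: A_def)
  interpret M: ideal M R by (rule MI)
  have meets: "\<exists>t\<in>T. a \<otimes> t \<in> M"
    if a: "a \<in> carrier R" and b: "b \<in> carrier R" "b \<notin> M" "a \<otimes> b \<in> M" for a b
  proof -
    let ?J = "{x \<in> carrier R. a \<otimes> x \<in> M}"
    have "ideal ?J R" by (rule M.helper_max_prime[OF is_cring a])
    moreover have "M \<subseteq> ?J" using M.I_l_closed[OF _ a] M.Icarr by blast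
    moreover have "?J \<noteq> M" using b by blast
    ultimately have "?J \<notin> A" using max by blast
    then show ?thesis using \<open>ideal ?J R\<close> \<open>M \<subseteq> ?J\<close> MI(2) by (auto simp: A_def)
  qed
  have "primeideal M R"
  proof (rule primeidealI[OF MI(1) is_cring])
    show "carrier R \<noteq> M" using MI(3) T T_ne by blast
    fix a b assume ab: "a \<in> carrier R" "b \<in> carrier R" "a \<otimes> b \<in> M"
    show "a \<in> M \<or> b \<in> M"
    proof (rule ccontr)
      assume n: "\<not> (a \<in> M \<or> b \<in> M)"
      then obtain t where t: "t \<in> T" "a \<otimes> t \<in> M" using meets[of a b] ab by blast
      then have "t \<otimes> a \<in> M" using T ab m_comm by (metis subsetD)
      then obtain t' where "t' \<in> T" "t \<otimes> t' \<in> M" using meets[of t a] n ab t T by blast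
      then show False using T_mult[OF t(1)] MI(3) by blast
    qed
  qed
  then show ?thesis using MI by blast
qed

lemma (in cring) prime_pow_mem:
  assumes "primeideal Q R" "a \<in> carrier R" "a [^] (n::nat) \<in> Q"
  shows "a \<in> Q"
proof -
  interpret Q: primeideal Q R by fact
  show ?thesis using assms(3)
  proof (induction n)
    case 0
    then show ?case using Q.I_notcarr Q.one_imp_carrier by auto
  next
    case (Suc n)
    then show ?case using Q.I_prime[of "a [^] n" a] assms(2) by auto
  qed
qed

lemma (in cring) pow_regular:
  assumes y: "y \<in> carrier R" "\<forall>a\<in>carrier R. y \<otimes> a = \<zero> \<longrightarrow> a = \<zero>"
    and "a \<in> carrier R" "y [^] (n::nat) \<otimes> a = \<zero>"
  shows "a = \<zero>"
  using assms(3,4)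
proof (induction n arbitrary: a)
  case (Suc n)
  then have "y [^] n \<otimes> (y \<otimes> a) = \<zero>" using y(1) by (simp add: m_assoc)
  then have "y \<otimes> a = \<zero>" using Suc.IH[OF m_closed[OF y(1) Suc.prems(1)]] by blast
  then show ?case using y(2) Suc.prems by blast
qed simp

text \<open>A prime avoiding all products \<open>y^n s\<close> with \<open>s\<close> outside
  \<open>Q\<close> lies in \<open>Q\<close> and misses \<open>y\<close>. It exists because
  regularity of \<open>y\<close> keeps zero out of this multiplicative set.\<close>

lemma (in cring) exists_smaller_prime:
  assumes Q: "primeideal Q R" and y: "y \<in> Q"
    and reg: "\<forall>a\<in>carrier R. y \<otimes> a = \<zero> \<longrightarrow> a = \<zero>"
  shows "\<exists>Q0. primeideal Q0 R \<and> Q0 \<subset> Q"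
proof -
  interpret Q: primeideal Q R by fact
  have yc: "y \<in> carrier R" using y Q.Icarr by blast
  have one: "\<one> \<in> carrier R - Q" using Q.I_notcarr Q.one_imp_carrier by auto
  define T where "T = {t. \<exists>(n::nat) s. s \<in> carrier R - Q \<and> t = y [^] n \<otimes> s}"
  have sub: "s \<in> T" if "s \<in> carrier R - Q" for s
  proof -
    have "s = y [^] (0::nat) \<otimes> s" using that by simp
    then show ?thesis unfolding T_def using that by blast
  qed
  have "y \<in> T"
  proof -
    have "y = y [^] (1::nat) \<otimes> \<one>" using yc by simp
    then show ?thesis unfolding T_def using one by blast
  qed
  have mult: "s \<otimes> t \<in> T" if st: "s \<in> T" "t \<in> T" for s t
  proof -
    obtain m a where a: "a \<in> carrier R - Q" "s = y [^] (m::nat) \<otimes> a" using st(1) unfolding T_def by blast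
    obtain n b where b: "b \<in> carrier R - Q" "t = y [^] (n::nat) \<otimes> b" using st(2) unfolding T_def by blast
    have "s \<otimes> t = y [^] (m + n) \<otimes> (a \<otimes> b)"
    proof -
      have "a \<in> carrier R" "b \<in> carrier R" "y [^] m \<in> carrier R" "y [^] n \<in> carrier R"
        using a b yc by auto
      then show ?thesis unfolding a(2) b(2) nat_pow_mult[OF yc, symmetric] by (simp add: m_ac)
    qed
    moreover have "a \<otimes> b \<in> carrier R - Q" using a b Q.I_prime by auto
    ultimately show ?thesis unfolding T_def by blast
  qed
  have "\<zero> \<notin> T"
  proof
    assume "\<zero> \<in> T"
    then obtain n s where "s \<in> carrier R - Q" "y [^] (n::nat) \<otimes> s = \<zero>" unfolding T_def by auto
    then have "s = \<zero>" using pow_regular[OF yc reg] by blast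
    then show False using \<open>s \<in> carrier R - Q\<close> by simp
  qed
  then have disj: "{\<zero>} \<inter> T = {}" by blast
  have "T \<subseteq> carrier R" "T \<noteq> {}" using yc \<open>y \<in> T\<close> by (auto simp: T_def)
  then obtain Q0 where Q0: "primeideal Q0 R" "Q0 \<inter> T = {}"
    using exists_prime_avoiding[OF zeroideal _ mult _ disj] by blast
  interpret Q0: primeideal Q0 R by fact
  have "Q0 \<subseteq> Q" using sub Q0(2) Q0.Icarr by blast
  then have "Q0 \<subset> Q" using \<open>y \<in> T\<close> y Q0(2) by blast
  then show ?thesis using Q0 by blast
qed

text \<open>Dimension and depth are both read off from two facts: chains of primes have at most two
  members, and the maximal ideal \<open>J\<close> contains a nonzerodivisor.\<close>

locale one_dim_local = cring +
  fixes J x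
  assumes J_ideal: "ideal J R" and one_notin: "\<one> \<notin> J"
    and units: "a \<in> carrier R \<Longrightarrow> a \<notin> J \<Longrightarrow> a \<in> Units R"
    and x_in: "x \<in> J" and x_regular: "\<forall>a\<in>carrier R. x \<otimes> a = \<zero> \<longrightarrow> a = \<zero>"
    and no_chain: "primeideal P0 R \<Longrightarrow> primeideal P1 R \<Longrightarrow> primeideal P2 R \<Longrightarrow> P0 \<subset> P1 \<Longrightarrow> \<not> P1 \<subset> P2"
begin

lemma proper_subset_J:
  assumes "ideal I R" "I \<noteq> carrier R"
  shows "I \<subseteq> J"
proof
  interpret I: ideal I R by fact
  fix a assume a: "a \<in> I"
  show "a \<in> J"
  proof (rule ccontr)
    assume "a \<notin> J"
    then have "a \<in> Units R" using units a I.Icarr by blast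
    then obtain b where "b \<in> carrier R" "a \<otimes> b = \<one>" using Units_r_inv_ex by blast
    then have "\<one> \<in> I" using I.I_r_closed[OF a] by metis
    then show False using I.one_imp_carrier assms(2) by blast
  qed
qed

lemma J_proper: "J \<noteq> carrier R" using one_notin by auto

lemma J_maximal: "maximalideal J R"
  using J_ideal J_proper proper_subset_J by (intro maximalidealI) auto

lemma unique_maximal: "{I. maximalideal I R} = {J}"
proof -
  have "I = J" if "maximalideal I R" for I
  proof -
    interpret maximalideal I R by fact
    have "I \<subseteq> J" using proper_subset_J is_ideal I_notcarr by blast
    then show ?thesis using I_maximal[OF J_ideal] J_proper ideal.Icarr[OF J_ideal] by blast
  qed
  then show ?thesis using J_maximal by blast
qed

lemma J_prime: "primeideal J R"
  using maximalideal_prime J_maximal by blast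

lemma prime_subset_J: "primeideal Q R \<Longrightarrow> Q \<subseteq> J"
  using proper_subset_J primeideal.I_notcarr primeideal.axioms(1) by metis

lemma x_carrier: "x \<in> carrier R"
  using ideal.Icarr[OF J_ideal x_in] .

lemma krull_dim_eq: "krull_dim R = 1"
proof (rule antisym)
  show "krull_dim R \<le> 1"
    unfolding krull_dim_def
  proof (rule Sup_least)
    fix e assume "e \<in> {enat n |n. \<exists>P. (\<forall>i\<le>n. primeideal (P i) R) \<and> (\<forall>i<n. P i \<subset> P (Suc i))}"
    then obtain n P where e: "e = enat n" and P: "\<And>i. i \<le> n \<Longrightarrow> primeideal (P i) R"
      "\<And>i. i < n \<Longrightarrow> P i \<subset> P (Suc i)" by auto
    have "n \<le> 1"
    proof (rule ccontr)
      assume "\<not> n \<le> 1"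
      then have "0 \<le> n" "1 \<le> n" "2 \<le> n" "0 < n" "1 < n" by auto
      then show False
        using no_chain[OF P(1) P(1) P(1), of 0 1 2] P(2)[of 0] P(2)[of 1]
        by (simp add: numeral_2_eq_2)
    qed
    then show "e \<le> 1" using e by (simp add: one_enat_def)
  qed
next
  \<comment> \<open>The nonzerodivisor \<open>x\<close> prevents \<open>J\<close> from being a
    minimal prime.\<close>
  obtain Q where Q: "primeideal Q R" "Q \<subset> J"
    using exists_smaller_prime[OF J_prime x_in x_regular] by blast
  have "\<exists>P. (\<forall>i\<le>1. primeideal (P i) R) \<and> (\<forall>i<1. P i \<subset> P (Suc i))"
    by (rule exI[of _ "\<lambda>i::nat. if i = 0 then Q else J"]) (use Q J_prime in auto)
  then show "1 \<le> krull_dim R"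
    unfolding krull_dim_def one_enat_def by (intro Sup_upper) blast
qed

lemma Idl_empty: "Idl {} = {\<zero>}"
proof
  show "Idl {} \<subseteq> {\<zero>}" by (rule genideal_minimal) (auto simp: zeroideal)
  show "{\<zero>} \<subseteq> Idl {}" using additive_subgroup.zero_closed[OF ideal.axioms(1)[OF genideal_ideal]] by auto
qed

text \<open>If a power of \<open>b\<close> lies in \<open>(a)\<close>, regularity of
  \<open>b\<close> modulo \<open>a\<close> strips the factors until \<open>(a)\<close> contains 1.
  Otherwise a prime over \<open>(a)\<close> avoids the powers of \<open>b\<close>, hence is strictly
  below \<open>J\<close>, and by regularity of \<open>a\<close> has a prime strictly below it: a
  chain that is too long.\<close>

lemma not_regular_pair:
  assumes a: "a \<in> J" and b: "b \<in> J"
    and a_reg: "\<forall>c\<in>carrier R. a \<otimes> c = \<zero> \<longrightarrow> c = \<zero>"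
    and b_reg: "\<forall>c\<in>carrier R. b \<otimes> c \<in> Idl {a} \<longrightarrow> c \<in> Idl {a}"
  shows False
proof -
  have ac: "a \<in> carrier R" and bc: "b \<in> carrier R" using a b ideal.Icarr[OF J_ideal] by auto
  have I: "ideal (Idl {a}) R" using genideal_ideal ac by simp
  have sub: "Idl {a} \<subseteq> J" using genideal_minimal[OF J_ideal] a by simp
  show False
  proof (cases "\<exists>n::nat. b [^] n \<in> Idl {a}")
    case True
    then obtain n where "b [^] (n::nat) \<in> Idl {a}" by blast
    then have "\<one> \<in> Idl {a}"
    proof (induction n)
      case (Suc n)
      then have "b \<otimes> b [^] n \<in> Idl {a}" using bc by (simp add: m_comm)
      then show ?case using b_reg Suc.IH bc by blast
    qed simp
    then show False using sub one_notin by blast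
  next
    case False
    have "\<exists>Q. primeideal Q R \<and> Idl {a} \<subseteq> Q \<and> Q \<inter> range (\<lambda>n::nat. b [^] n) = {}"
      by (rule exists_prime_avoiding[OF I, of "range (\<lambda>n::nat. b [^] n)"])
        (use bc False nat_pow_mult in auto)
    then obtain Q where Q: "primeideal Q R" "Idl {a} \<subseteq> Q" "Q \<inter> range (\<lambda>n::nat. b [^] n) = {}" by blast
    have "b [^] (1::nat) \<notin> Q" using Q(3) by blast
    then have "b \<notin> Q" using bc by simp
    then have "Q \<subset> J" using prime_subset_J[OF Q(1)] b by blast
    moreover have "a \<in> Q" using Q(2) genideal_self'[OF ac] by blast
    ultimately show False
      using exists_smaller_prime[OF Q(1) _ a_reg] no_chain[OF _ Q(1) J_prime] by blast
  qed
qed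

lemma depth_eq: "depth_on R J = 1"
proof (rule antisym)
  show "depth_on R J \<le> 1"
    unfolding depth_on_def
  proof (rule Sup_least)
    fix e assume "e \<in> {enat (length xs) |xs. set xs \<subseteq> J \<and> regular_seq R xs}"
    then obtain xs where xs: "e = enat (length xs)" "set xs \<subseteq> J" "regular_seq R xs" by blast
    have "length xs \<le> 1"
    proof (rule ccontr)
      assume len: "\<not> length xs \<le> 1"
      then obtain a b ys where ab: "xs = a # b # ys"
        \<comment> \<open>This rule splits lists into those of length 0, 1 and at least 2.\<close>
        by (cases xs rule: remdups_adj.cases) auto
      have reg: "\<And>i c. i < length xs \<Longrightarrow> c \<in> carrier R \<Longrightarrow> xs ! i \<otimes> c \<in> Idl (set (take i xs))
          \<Longrightarrow> c \<in> Idl (set (take i xs))"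
        using xs(3) unfolding regular_seq_def by blast
      show False
      proof (rule not_regular_pair[of a b])
        show "a \<in> J" "b \<in> J" using xs(2) ab by auto
        have "c = \<zero>" if "c \<in> carrier R" "a \<otimes> c = \<zero>" for c
        proof -
          have "c \<in> Idl (set (take 0 xs))" by (rule reg) (use that ab Idl_empty in auto)
          then show ?thesis using Idl_empty by simp
        qed
        then show "\<forall>c\<in>carrier R. a \<otimes> c = \<zero> \<longrightarrow> c = \<zero>" by blast
        have "c \<in> Idl {a}" if "c \<in> carrier R" "b \<otimes> c \<in> Idl {a}" for c
        proof -
          have "c \<in> Idl (set (take 1 xs))" by (rule reg) (use that ab in auto)
          then show ?thesis using ab by simp
        qed
        then show "\<forall>c\<in>carrier R. b \<otimes> c \<in> Idl {a} \<longrightarrow> c \<in> Idl {a}" by blast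
      qed
    qed
    then show "e \<le> 1" using xs(1) by (simp add: one_enat_def)
  qed
next
  have "Idl {x} \<subseteq> J" using genideal_minimal[OF J_ideal] x_in by simp
  then have "Idl {x} \<noteq> carrier R" using one_notin by blast
  moreover have "c \<in> Idl {}" if "c \<in> carrier R" "x \<otimes> c \<in> Idl {}" for c
    using x_regular that unfolding Idl_empty by blast
  ultimately have "regular_seq R [x]"
    using x_carrier by (simp add: regular_seq_def)
  then have "enat (length [x]) \<in> {enat (length xs) |xs. set xs \<subseteq> J \<and> regular_seq R xs}"
    using x_in by fastforce
  then have "enat (length [x]) \<le> depth_on R J" unfolding depth_on_def by (rule Sup_upper)
  then show "1 \<le> depth_on R J" by (simp add: one_enat_def)
qed

lemma cohen_macaulay_local: "cohen_macaulay_local R"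
  unfolding cohen_macaulay_local_def using unique_maximal depth_eq krull_dim_eq by auto

end

section \<open>Localization at a prime ideal\<close>

context primeideal
begin

definition qfrac :: "'a \<Rightarrow> 'a \<Rightarrow> ('a \<times> 'a) set" where "qfrac a s = loc_rel R I `` {(a, s)}"
abbreviation "L \<equiv> localize_at R I"

lemma compl_one: "\<one> \<in> carrier R - I"
  using I_notcarr one_imp_carrier by auto

lemma compl_mult: "s \<in> carrier R - I \<Longrightarrow> t \<in> carrier R - I \<Longrightarrow> s \<otimes> t \<in> carrier R - I"
  using I_prime by auto

lemma loc_rel_iff:
  "((a, s), (b, t)) \<in> loc_rel R I \<longleftrightarrow>
     a \<in> carrier R \<and> b \<in> carrier R \<and> s \<in> carrier R - I \<and> t \<in> carrier R - I \<and>
     (\<exists>u \<in> carrier R - I. u \<otimes> (a \<otimes> t) = u \<otimes> (b \<otimes> s))"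
  unfolding loc_rel_def by blast

lemma equiv_loc_rel: "equiv (carrier R \<times> (carrier R - I)) (loc_rel R I)"
proof (rule equivI)
  show "loc_rel R I \<subseteq> (carrier R \<times> (carrier R - I)) \<times> (carrier R \<times> (carrier R - I))"
    unfolding loc_rel_def by blast
  show "refl_on (carrier R \<times> (carrier R - I)) (loc_rel R I)"
    unfolding refl_on_def using compl_one by (auto simp: loc_rel_iff)
  show "sym (loc_rel R I)"
  proof (rule symI, clarify)
    fix a s b t
    assume "((a, s), (b, t)) \<in> loc_rel R I"
    then show "((b, t), (a, s)) \<in> loc_rel R I" unfolding loc_rel_iff by (metis (no_types))
  qed
  show "trans (loc_rel R I)"
  proof (rule transI, clarify)
    fix a s b t c r
    assume "((a, s), (b, t)) \<in> loc_rel R I" "((b, t), (c, r)) \<in> loc_rel R I"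
    then obtain u v where u: "u \<in> carrier R - I" "u \<otimes> (a \<otimes> t) = u \<otimes> (b \<otimes> s)"
      and v: "v \<in> carrier R - I" "v \<otimes> (b \<otimes> r) = v \<otimes> (c \<otimes> t)"
      and c: "a \<in> carrier R" "b \<in> carrier R" "c \<in> carrier R"
        "s \<in> carrier R - I" "t \<in> carrier R - I" "r \<in> carrier R - I"
      unfolding loc_rel_iff by blast
    have cc: "u \<in> carrier R" "v \<in> carrier R" "s \<in> carrier R" "t \<in> carrier R" "r \<in> carrier R"
      using u(1) v(1) c by auto
    \<comment> \<open>The middle denominator \<open>t\<close> has to be part of the witness, since
      both given equations involve it.\<close>
    have "(u \<otimes> v \<otimes> t) \<otimes> (a \<otimes> r) = (v \<otimes> r) \<otimes> (u \<otimes> (a \<otimes> t))" using cc c by (simp add: m_ac)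
    also have "\<dots> = (u \<otimes> s) \<otimes> (v \<otimes> (b \<otimes> r))" unfolding u(2) using cc c by (simp add: m_ac)
    also have "\<dots> = (u \<otimes> v \<otimes> t) \<otimes> (c \<otimes> s)" unfolding v(2) using cc c by (simp add: m_ac)
    finally have "(u \<otimes> v \<otimes> t) \<otimes> (a \<otimes> r) = (u \<otimes> v \<otimes> t) \<otimes> (c \<otimes> s)" .
    moreover have "u \<otimes> v \<otimes> t \<in> carrier R - I" using compl_mult[OF compl_mult[OF u(1) v(1)] c(5)] .
    ultimately show "((a, s), (c, r)) \<in> loc_rel R I" unfolding loc_rel_iff using c by blast
  qed
qed

lemma frac_eq_iff:
  assumes "a \<in> carrier R" "s \<in> carrier R - I" "b \<in> carrier R" "t \<in> carrier R - I"
  shows "qfrac a s = qfrac b t \<longleftrightarrow> (\<exists>u \<in> carrier R - I. u \<otimes> (a \<otimes> t) = u \<otimes> (b \<otimes> s))"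
proof -
  have "qfrac a s = qfrac b t \<longleftrightarrow> ((a, s), (b, t)) \<in> loc_rel R I"
    unfolding qfrac_def by (rule eq_equiv_class_iff[OF equiv_loc_rel]) (use assms in auto)
  then show ?thesis unfolding loc_rel_iff using assms by blast
qed

lemma frac_eqI:
  assumes "a \<in> carrier R" "s \<in> carrier R - I" "b \<in> carrier R" "t \<in> carrier R - I"
    and "a \<otimes> t = b \<otimes> s"
  shows "qfrac a s = qfrac b t"
  unfolding frac_eq_iff[OF assms(1-4)] using assms(5) compl_one by auto

lemma frac_closed: "a \<in> carrier R \<Longrightarrow> s \<in> carrier R - I \<Longrightarrow> qfrac a s \<in> carrier L"
  unfolding localize_at_def qfrac_def by (auto intro: quotientI)

lemma L_cases:
  assumes "X \<in> carrier L"
  obtains a s where "a \<in> carrier R" "s \<in> carrier R - I" "X = qfrac a s"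
  using assms unfolding localize_at_def qfrac_def by (auto elim!: quotientE)

text \<open>The operations of \<open>localize_at\<close> are unions over all representatives;
  independence of the representatives collapses such a union to a single class.\<close>

lemma UN_frac_const:
  assumes as: "a \<in> carrier R" "s \<in> carrier R - I" and bt: "b \<in> carrier R" "t \<in> carrier R - I"
    and const: "\<And>a' s' b' t'. ((a, s), (a', s')) \<in> loc_rel R I \<Longrightarrow> ((b, t), (b', t')) \<in> loc_rel R I
        \<Longrightarrow> F a' s' b' t' = F a s b t"
  shows "(\<Union>(a', s')\<in>qfrac a s. \<Union>(b', t')\<in>qfrac b t. F a' s' b' t') = F a s b t"
proof -
  have self: "(a, s) \<in> qfrac a s" "(b, t) \<in> qfrac b t"
    unfolding qfrac_def using equiv_class_self[OF equiv_loc_rel] as bt by auto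
  show ?thesis
  proof
    show "(\<Union>(a', s')\<in>qfrac a s. \<Union>(b', t')\<in>qfrac b t. F a' s' b' t') \<subseteq> F a s b t"
      using const unfolding qfrac_def by fastforce
    show "F a s b t \<subseteq> (\<Union>(a', s')\<in>qfrac a s. \<Union>(b', t')\<in>qfrac b t. F a' s' b' t')"
      using self by blast
  qed
qed

lemma frac_mult:
  assumes "a \<in> carrier R" "s \<in> carrier R - I" "b \<in> carrier R" "t \<in> carrier R - I"
  shows "qfrac a s \<otimes>\<^bsub>L\<^esub> qfrac b t = qfrac (a \<otimes> b) (s \<otimes> t)"
proof -
  have "qfrac (a' \<otimes> b') (s' \<otimes> t') = qfrac (a \<otimes> b) (s \<otimes> t)"
    if rel: "((a, s), (a', s')) \<in> loc_rel R I" "((b, t), (b', t')) \<in> loc_rel R I" for a' s' b' t'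
  proof -
    obtain u v where u: "u \<in> carrier R - I" "u \<otimes> (a \<otimes> s') = u \<otimes> (a' \<otimes> s)"
      and v: "v \<in> carrier R - I" "v \<otimes> (b \<otimes> t') = v \<otimes> (b' \<otimes> t)"
      and c: "a' \<in> carrier R" "b' \<in> carrier R" "s' \<in> carrier R - I" "t' \<in> carrier R - I"
      using rel[unfolded loc_rel_iff] by blast
    have cc: "u \<in> carrier R" "v \<in> carrier R" "s \<in> carrier R" "t \<in> carrier R" "s' \<in> carrier R" "t' \<in> carrier R"
      using u(1) v(1) c assms by auto
    have "(u \<otimes> v) \<otimes> ((a' \<otimes> b') \<otimes> (s \<otimes> t)) = (u \<otimes> (a' \<otimes> s)) \<otimes> (v \<otimes> (b' \<otimes> t))"
      using cc c assms by (simp add: m_ac)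
    also have "\<dots> = (u \<otimes> v) \<otimes> ((a \<otimes> b) \<otimes> (s' \<otimes> t'))"
      unfolding u(2)[symmetric] v(2)[symmetric] using cc c assms by (simp add: m_ac)
    finally have "(u \<otimes> v) \<otimes> ((a' \<otimes> b') \<otimes> (s \<otimes> t)) = (u \<otimes> v) \<otimes> ((a \<otimes> b) \<otimes> (s' \<otimes> t'))" .
    moreover have "u \<otimes> v \<in> carrier R - I" using compl_mult[OF u(1) v(1)] .
    ultimately show ?thesis
      using frac_eq_iff[OF m_closed[OF c(1,2)] compl_mult[OF c(3,4)]
        m_closed[OF assms(1,3)] compl_mult[OF assms(2,4)]] by blast
  qed
  then show ?thesis
    unfolding localize_at_def qfrac_def[symmetric] using UN_frac_const[OF assms, of "\<lambda>a s b t. qfrac (a \<otimes> b) (s \<otimes> t)"] by simp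
qed

lemma frac_add:
  assumes "a \<in> carrier R" "s \<in> carrier R - I" "b \<in> carrier R" "t \<in> carrier R - I"
  shows "qfrac a s \<oplus>\<^bsub>L\<^esub> qfrac b t = qfrac ((a \<otimes> t) \<oplus> (b \<otimes> s)) (s \<otimes> t)"
proof -
  have "qfrac ((a' \<otimes> t') \<oplus> (b' \<otimes> s')) (s' \<otimes> t') = qfrac ((a \<otimes> t) \<oplus> (b \<otimes> s)) (s \<otimes> t)"
    if rel: "((a, s), (a', s')) \<in> loc_rel R I" "((b, t), (b', t')) \<in> loc_rel R I" for a' s' b' t'
  proof -
    obtain u v where u: "u \<in> carrier R - I" "u \<otimes> (a \<otimes> s') = u \<otimes> (a' \<otimes> s)"
      and v: "v \<in> carrier R - I" "v \<otimes> (b \<otimes> t') = v \<otimes> (b' \<otimes> t)"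
      and c: "a' \<in> carrier R" "b' \<in> carrier R" "s' \<in> carrier R - I" "t' \<in> carrier R - I"
      using rel[unfolded loc_rel_iff] by blast
    have cc: "u \<in> carrier R" "v \<in> carrier R" "s \<in> carrier R" "t \<in> carrier R" "s' \<in> carrier R" "t' \<in> carrier R"
      using u(1) v(1) c assms by auto
    have distr: "w \<otimes> ((p \<oplus> q) \<otimes> r) = w \<otimes> (p \<otimes> r) \<oplus> w \<otimes> (q \<otimes> r)"
      if "w \<in> carrier R" "p \<in> carrier R" "q \<in> carrier R" "r \<in> carrier R" for w p q r
      using that by (simp add: l_distr r_distr)
    \<comment> \<open>The two summands of the numerator are treated apart, as each needs only one of
      the two relations.\<close>
    have "(u \<otimes> v) \<otimes> ((a' \<otimes> t') \<otimes> (s \<otimes> t)) = (u \<otimes> (a' \<otimes> s)) \<otimes> (v \<otimes> (t \<otimes> t'))"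
      using cc c(1,2) assms(1,3) by (simp add: m_ac)
    also have "\<dots> = (u \<otimes> v) \<otimes> ((a \<otimes> t) \<otimes> (s' \<otimes> t'))"
      unfolding u(2)[symmetric] using cc c(1,2) assms(1,3) by (simp add: m_ac)
    finally have 1: "(u \<otimes> v) \<otimes> ((a' \<otimes> t') \<otimes> (s \<otimes> t)) = (u \<otimes> v) \<otimes> ((a \<otimes> t) \<otimes> (s' \<otimes> t'))" .
    have "(u \<otimes> v) \<otimes> ((b' \<otimes> s') \<otimes> (s \<otimes> t)) = (v \<otimes> (b' \<otimes> t)) \<otimes> (u \<otimes> (s \<otimes> s'))"
      using cc c(1,2) assms(1,3) by (simp add: m_ac)
    also have "\<dots> = (u \<otimes> v) \<otimes> ((b \<otimes> s) \<otimes> (s' \<otimes> t'))"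
      unfolding v(2)[symmetric] using cc c(1,2) assms(1,3) by (simp add: m_ac)
    finally have 2: "(u \<otimes> v) \<otimes> ((b' \<otimes> s') \<otimes> (s \<otimes> t)) = (u \<otimes> v) \<otimes> ((b \<otimes> s) \<otimes> (s' \<otimes> t'))" .
    have "(u \<otimes> v) \<otimes> (((a' \<otimes> t') \<oplus> (b' \<otimes> s')) \<otimes> (s \<otimes> t))
        = (u \<otimes> v) \<otimes> ((a' \<otimes> t') \<otimes> (s \<otimes> t)) \<oplus> (u \<otimes> v) \<otimes> ((b' \<otimes> s') \<otimes> (s \<otimes> t))"
      by (rule distr) (use cc c(1,2) assms(1,3) in auto)
    also have "\<dots> = (u \<otimes> v) \<otimes> (((a \<otimes> t) \<oplus> (b \<otimes> s)) \<otimes> (s' \<otimes> t'))"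
      unfolding 1 2 by (rule distr[symmetric]) (use cc c(1,2) assms(1,3) in auto)
    finally have "(u \<otimes> v) \<otimes> (((a' \<otimes> t') \<oplus> (b' \<otimes> s')) \<otimes> (s \<otimes> t))
        = (u \<otimes> v) \<otimes> (((a \<otimes> t) \<oplus> (b \<otimes> s)) \<otimes> (s' \<otimes> t'))" .
    moreover have "u \<otimes> v \<in> carrier R - I" using compl_mult[OF u(1) v(1)] .
    moreover have n: "a' \<otimes> t' \<oplus> b' \<otimes> s' \<in> carrier R" "a \<otimes> t \<oplus> b \<otimes> s \<in> carrier R"
      using cc c(1,2) assms(1,3) by auto
    ultimately show ?thesis
      using frac_eq_iff[OF n(1) compl_mult[OF c(3,4)] n(2) compl_mult[OF assms(2,4)]] by blast
  qed
  then show ?thesis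
    unfolding localize_at_def qfrac_def[symmetric]
    using UN_frac_const[OF assms, of "\<lambda>a s b t. qfrac ((a \<otimes> t) \<oplus> (b \<otimes> s)) (s \<otimes> t)"] by simp
qed

lemma L_one: "\<one>\<^bsub>L\<^esub> = qfrac \<one> \<one>" and L_zero: "\<zero>\<^bsub>L\<^esub> = qfrac \<zero> \<one>"
  by (simp_all add: localize_at_def qfrac_def)

lemma cring_L: "cring L"
proof (rule cringI)
  note mem = compl_mult compl_one
  show "abelian_group L"
  proof (rule abelian_groupI)
    fix X Y assume XY: "X \<in> carrier L" "Y \<in> carrier L"
    obtain a s where as: "X = qfrac a s" "a \<in> carrier R" "s \<in> carrier R - I" by (rule L_cases[OF XY(1)])
    obtain b t where bt: "Y = qfrac b t" "b \<in> carrier R" "t \<in> carrier R - I" by (rule L_cases[OF XY(2)])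
    note X = as(1) bt(1) as(2,3) bt(2,3)
    show "X \<oplus>\<^bsub>L\<^esub> Y \<in> carrier L" unfolding X(1,2) frac_add[OF X(3-6)]
      by (rule frac_closed) (use X mem in auto)
    show "X \<oplus>\<^bsub>L\<^esub> Y = Y \<oplus>\<^bsub>L\<^esub> X"
      unfolding X(1,2) frac_add[OF X(3-6)] frac_add[OF X(5,6,3,4)]
      by (rule frac_eqI) (use X mem in \<open>auto simp: m_ac a_ac\<close>)
  next
    fix X Y Z assume XYZ: "X \<in> carrier L" "Y \<in> carrier L" "Z \<in> carrier L"
    obtain a s where as: "X = qfrac a s" "a \<in> carrier R" "s \<in> carrier R - I" by (rule L_cases[OF XYZ(1)])
    obtain b t where bt: "Y = qfrac b t" "b \<in> carrier R" "t \<in> carrier R - I" by (rule L_cases[OF XYZ(2)])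
    obtain c r where cr: "Z = qfrac c r" "c \<in> carrier R" "r \<in> carrier R - I" by (rule L_cases[OF XYZ(3)])
    note X = as(1) bt(1) cr(1) and c = as(2,3) bt(2,3) cr(2,3)
    have cc: "s \<in> carrier R" "t \<in> carrier R" "r \<in> carrier R" using c by auto
    have st: "s \<otimes> t \<in> carrier R - I" "t \<otimes> r \<in> carrier R - I"
      "s \<otimes> t \<otimes> r \<in> carrier R - I" "s \<otimes> (t \<otimes> r) \<in> carrier R - I" using mem c by auto
    have n: "a \<otimes> t \<oplus> b \<otimes> s \<in> carrier R" "b \<otimes> r \<oplus> c \<otimes> t \<in> carrier R" using c cc by auto
    show "X \<oplus>\<^bsub>L\<^esub> Y \<oplus>\<^bsub>L\<^esub> Z = X \<oplus>\<^bsub>L\<^esub> (Y \<oplus>\<^bsub>L\<^esub> Z)"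
      unfolding X frac_add[OF c(1-4)] frac_add[OF c(3-6)]
        frac_add[OF n(1) st(1) c(5,6)] frac_add[OF c(1,2) n(2) st(2)]
      by (rule frac_eqI) (use c cc st n in \<open>simp_all add: m_ac a_ac l_distr r_distr\<close>)
  next
    show "\<zero>\<^bsub>L\<^esub> \<in> carrier L" unfolding L_zero by (rule frac_closed) (use mem in auto)
  next
    fix X assume XL: "X \<in> carrier L"
    obtain a s where X: "X = qfrac a s" "a \<in> carrier R" "s \<in> carrier R - I" by (rule L_cases[OF XL])
    show "\<zero>\<^bsub>L\<^esub> \<oplus>\<^bsub>L\<^esub> X = X"
      unfolding X(1) L_zero frac_add[OF zero_closed mem(2) X(2,3)]
      by (rule frac_eqI) (use X mem in auto)
    have "qfrac (\<ominus> a) s \<oplus>\<^bsub>L\<^esub> X = \<zero>\<^bsub>L\<^esub>"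
      unfolding X(1) L_zero frac_add[OF a_inv_closed[OF X(2)] X(3) X(2,3)]
      by (rule frac_eqI) (use X mem in \<open>auto simp: l_minus l_neg\<close>)
    then show "\<exists>Y\<in>carrier L. Y \<oplus>\<^bsub>L\<^esub> X = \<zero>\<^bsub>L\<^esub>" using frac_closed[OF a_inv_closed[OF X(2)] X(3)] by blast
  qed
  show "comm_monoid L"
  proof (rule comm_monoidI)
    fix X Y assume XY: "X \<in> carrier L" "Y \<in> carrier L"
    obtain a s where as: "X = qfrac a s" "a \<in> carrier R" "s \<in> carrier R - I" by (rule L_cases[OF XY(1)])
    obtain b t where bt: "Y = qfrac b t" "b \<in> carrier R" "t \<in> carrier R - I" by (rule L_cases[OF XY(2)])
    note X = as(1) bt(1) as(2,3) bt(2,3)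
    show "X \<otimes>\<^bsub>L\<^esub> Y \<in> carrier L" unfolding X(1,2) frac_mult[OF X(3-6)]
      by (rule frac_closed) (use X mem in auto)
    show "X \<otimes>\<^bsub>L\<^esub> Y = Y \<otimes>\<^bsub>L\<^esub> X"
      unfolding X(1,2) frac_mult[OF X(3-6)] frac_mult[OF X(5,6,3,4)]
      using X by (simp add: m_comm)
  next
    fix X Y Z assume XYZ: "X \<in> carrier L" "Y \<in> carrier L" "Z \<in> carrier L"
    obtain a s where as: "X = qfrac a s" "a \<in> carrier R" "s \<in> carrier R - I" by (rule L_cases[OF XYZ(1)])
    obtain b t where bt: "Y = qfrac b t" "b \<in> carrier R" "t \<in> carrier R - I" by (rule L_cases[OF XYZ(2)])
    obtain c r where cr: "Z = qfrac c r" "c \<in> carrier R" "r \<in> carrier R - I" by (rule L_cases[OF XYZ(3)])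
    note X = as(1) bt(1) cr(1) and c = as(2,3) bt(2,3) cr(2,3)
    have st: "s \<otimes> t \<in> carrier R - I" "t \<otimes> r \<in> carrier R - I" using mem c by auto
    show "X \<otimes>\<^bsub>L\<^esub> Y \<otimes>\<^bsub>L\<^esub> Z = X \<otimes>\<^bsub>L\<^esub> (Y \<otimes>\<^bsub>L\<^esub> Z)"
      unfolding X frac_mult[OF c(1-4)] frac_mult[OF c(3-6)]
        frac_mult[OF m_closed[OF c(1,3)] st(1) c(5,6)] frac_mult[OF c(1,2) m_closed[OF c(3,5)] st(2)]
      using c by (simp add: m_assoc)
  next
    show "\<one>\<^bsub>L\<^esub> \<in> carrier L" unfolding L_one by (rule frac_closed) (use mem in auto)
  next
    fix X assume XL: "X \<in> carrier L"
    obtain a s where X: "X = qfrac a s" "a \<in> carrier R" "s \<in> carrier R - I" by (rule L_cases[OF XL])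
    show "\<one>\<^bsub>L\<^esub> \<otimes>\<^bsub>L\<^esub> X = X"
      unfolding X(1) L_one frac_mult[OF one_closed mem(2) X(2,3)] using X by simp
  qed
  fix X Y Z assume XYZ: "X \<in> carrier L" "Y \<in> carrier L" "Z \<in> carrier L"
  obtain a s where as: "X = qfrac a s" "a \<in> carrier R" "s \<in> carrier R - I" by (rule L_cases[OF XYZ(1)])
  obtain b t where bt: "Y = qfrac b t" "b \<in> carrier R" "t \<in> carrier R - I" by (rule L_cases[OF XYZ(2)])
  obtain c r where cr: "Z = qfrac c r" "c \<in> carrier R" "r \<in> carrier R - I" by (rule L_cases[OF XYZ(3)])
  note X = as(1) bt(1) cr(1) and c = as(2,3) bt(2,3) cr(2,3)
  have cc: "s \<in> carrier R" "t \<in> carrier R" "r \<in> carrier R" using c by auto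
  have st: "s \<otimes> t \<in> carrier R - I" "t \<otimes> r \<in> carrier R - I" "s \<otimes> r \<in> carrier R - I"
    "s \<otimes> t \<otimes> r \<in> carrier R - I" "s \<otimes> r \<otimes> (t \<otimes> r) \<in> carrier R - I" using mem c by auto
  have n: "a \<otimes> t \<oplus> b \<otimes> s \<in> carrier R" using c cc by auto
  show "(X \<oplus>\<^bsub>L\<^esub> Y) \<otimes>\<^bsub>L\<^esub> Z = X \<otimes>\<^bsub>L\<^esub> Z \<oplus>\<^bsub>L\<^esub> Y \<otimes>\<^bsub>L\<^esub> Z"
    unfolding X frac_add[OF c(1-4)] frac_mult[OF n st(1) c(5,6)] frac_mult[OF c(1,2,5,6)]
      frac_mult[OF c(3-6)] frac_add[OF m_closed[OF c(1,5)] st(3) m_closed[OF c(3,5)] st(2)]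
    by (rule frac_eqI) (use c cc st n in \<open>simp_all add: m_ac a_ac l_distr r_distr\<close>)
qed

lemma frac_hom: "ring_hom_ring R L (\<lambda>a. qfrac a \<one>)"
proof (rule ring_hom_ringI)
  show "ring R" by (rule ring_axioms)
  show "ring L" using cring_L by (simp add: cring.axioms(1))
qed (use compl_one frac_closed frac_mult frac_add L_one in auto)

text \<open>\<open>a/s\<close> and \<open>a/1\<close> differ by the unit \<open>s/1\<close>, so an
  ideal of \<open>L\<close> is determined by its numerators. This sends chains of primes of
  \<open>L\<close> to chains of the same length in \<open>R\<close>.\<close>

lemma contraction_strict_mono:
  assumes Q: "ideal Q L" and Q': "ideal Q' L" and sub: "Q \<subset> Q'"
  shows "{a \<in> carrier R. qfrac a \<one> \<in> Q} \<subset> {a \<in> carrier R. qfrac a \<one> \<in> Q'}"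
proof -
  interpret Q: ideal Q L by fact
  interpret Q': ideal Q' L by fact
  obtain X where X: "X \<in> Q'" "X \<notin> Q" using sub by blast
  then obtain a s where as: "X = qfrac a s" "a \<in> carrier R" "s \<in> carrier R - I"
    using L_cases[OF Q'.Icarr[OF X(1)]] by blast
  have sc: "s \<in> carrier R" using as(3) by blast
  have "qfrac s \<one> \<otimes>\<^bsub>L\<^esub> X = qfrac (s \<otimes> a) (\<one> \<otimes> s)"
    unfolding as(1) by (rule frac_mult[OF sc compl_one as(2,3)])
  also have "\<dots> = qfrac a \<one>"
    by (rule frac_eqI[OF m_closed[OF sc as(2)] compl_mult[OF compl_one as(3)] as(2) compl_one])
      (use sc as(2) in \<open>simp add: m_comm\<close>)
  finally have "qfrac a \<one> \<in> Q'" using Q'.I_l_closed[OF X(1) frac_closed[OF sc compl_one]] by simp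
  moreover have "X = qfrac \<one> s \<otimes>\<^bsub>L\<^esub> qfrac a \<one>"
    unfolding as(1) frac_mult[OF one_closed as(3) as(2) compl_one] using sc as(2) by simp
  then have "qfrac a \<one> \<notin> Q" using Q.I_l_closed[OF _ frac_closed[OF one_closed as(3)]] X(2) by metis
  ultimately show ?thesis using sub as(2) by blast
qed

lemma localize_cohen_macaulay_one_dim:
  assumes x: "x \<in> I" and x_regular: "\<forall>a\<in>carrier R. x \<otimes> a = \<zero> \<longrightarrow> a = \<zero>"
    and no_chain: "\<And>P0 P1 P2. primeideal P0 R \<Longrightarrow> primeideal P1 R \<Longrightarrow> primeideal P2 R
        \<Longrightarrow> P0 \<subset> P1 \<Longrightarrow> \<not> P1 \<subset> P2"
  shows "cohen_macaulay_local L"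
proof -
  interpret L: cring L by (rule cring_L)
  interpret h: ring_hom_ring R L "\<lambda>a. qfrac a \<one>" by (rule frac_hom)
  define J where "J = {qfrac a s | a s. a \<in> I \<and> s \<in> carrier R - I}"
  \<comment> \<open>\<open>J\<close> asks for one representation with numerator in \<open>I\<close>;
    primality shows that then every representation has one.\<close>
  have J_iff: "qfrac a s \<in> J \<longleftrightarrow> a \<in> I" if as: "a \<in> carrier R" "s \<in> carrier R - I" for a s
  proof
    assume "qfrac a s \<in> J"
    then obtain b t where b: "b \<in> I" "t \<in> carrier R - I" "qfrac a s = qfrac b t" unfolding J_def by blast
    have bc: "b \<in> carrier R" using b(1) Icarr by blast
    obtain u where u: "u \<in> carrier R - I" "u \<otimes> (a \<otimes> t) = u \<otimes> (b \<otimes> s)"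
      using b(3) frac_eq_iff[OF as bc b(2)] by blast
    have "u \<otimes> (b \<otimes> s) \<in> I" using b(1) as u(1) by (simp add: I_l_closed I_r_closed)
    then have "a \<otimes> t \<in> I" using I_prime[of u "a \<otimes> t"] u as b by auto
    then show "a \<in> I" using I_prime[of a t] as b by auto
  qed (use that in \<open>auto simp: J_def\<close>)
  have J_sub: "J \<subseteq> carrier L" unfolding J_def using frac_closed Icarr by blast
  have J_ideal: "ideal J L"
  proof (rule idealI)
    show "ring L" by (rule L.ring_axioms)
    have add: "X \<oplus>\<^bsub>L\<^esub> Y \<in> J" if XY: "X \<in> J" "Y \<in> J" for X Y
    proof -
      obtain a s b t where as: "X = qfrac a s" "Y = qfrac b t" "a \<in> I" "s \<in> carrier R - I"
        "b \<in> I" "t \<in> carrier R - I" using XY unfolding J_def by blast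
      have c: "a \<in> carrier R" "b \<in> carrier R" using as Icarr by auto
      have "a \<otimes> t \<oplus> b \<otimes> s \<in> I" using as by (auto intro: a_closed I_r_closed)
      then show ?thesis unfolding as(1,2) frac_add[OF c(1) as(4) c(2) as(6)] J_def
        using compl_mult as by blast
    qed
    have mult: "X \<otimes>\<^bsub>L\<^esub> Y \<in> J" if XY: "X \<in> J" "Y \<in> carrier L" for X Y
    proof -
      obtain a s where as: "X = qfrac a s" "a \<in> I" "s \<in> carrier R - I" using XY(1) unfolding J_def by blast
      obtain b t where bt: "Y = qfrac b t" "b \<in> carrier R" "t \<in> carrier R - I" by (rule L_cases[OF XY(2)])
      have "a \<otimes> b \<in> I" using as bt by (auto intro: I_r_closed)
      then show ?thesis unfolding as(1) bt(1) frac_mult[OF Icarr[OF as(2)] as(3) bt(2,3)] J_def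
        using compl_mult as bt by blast
    qed
    show "X \<otimes>\<^bsub>L\<^esub> Y \<in> J" if "X \<in> J" "Y \<in> carrier L" for X Y by (rule mult[OF that])
    show "Y \<otimes>\<^bsub>L\<^esub> X \<in> J" if "X \<in> J" "Y \<in> carrier L" for X Y
      using mult[OF that] L.m_comm that J_sub by auto
    show "subgroup J (add_monoid L)"
    proof (rule group.subgroupI)
      show "group (add_monoid L)" by (rule L.a_group)
      show "J \<subseteq> carrier (add_monoid L)" using J_sub by simp
      have "qfrac \<zero> \<one> \<in> J" unfolding J_iff[OF zero_closed compl_one] by simp
      then show "J \<noteq> {}" by blast
      show "inv\<^bsub>add_monoid L\<^esub> X \<in> J" if "X \<in> J" for X
      proof -
        have "inv\<^bsub>add_monoid L\<^esub> X = X \<otimes>\<^bsub>L\<^esub> (\<ominus>\<^bsub>L\<^esub> \<one>\<^bsub>L\<^esub>)"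
          unfolding a_inv_def[symmetric] using subsetD[OF J_sub that] by (simp add: L.r_minus)
        then show ?thesis using mult[OF that, of "\<ominus>\<^bsub>L\<^esub> \<one>\<^bsub>L\<^esub>"] by simp
      qed
      show "X \<otimes>\<^bsub>add_monoid L\<^esub> Y \<in> J" if "X \<in> J" "Y \<in> J" for X Y using add[OF that] by simp
    qed
  qed
  have "one_dim_local L J (qfrac x \<one>)"
  proof (intro one_dim_local.intro one_dim_local_axioms.intro)
    show "cring L" by (rule cring_L)
    show "ideal J L" by (rule J_ideal)
    show "\<one>\<^bsub>L\<^esub> \<notin> J" unfolding L_one using J_iff[OF one_closed compl_one] compl_one by blast
    show "qfrac x \<one> \<in> J" using J_iff[OF Icarr[OF x] compl_one] x by blast
    show "X \<in> Units L" if X: "X \<in> carrier L" "X \<notin> J" for X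
    proof -
      obtain a s where as: "X = qfrac a s" "a \<in> carrier R" "s \<in> carrier R - I" by (rule L_cases[OF X(1)])
      have sc: "s \<in> carrier R" using as(3) by blast
      have a: "a \<in> carrier R - I" using J_iff[OF as(2,3)] X(2) as(1,2) by blast
      have "X \<otimes>\<^bsub>L\<^esub> qfrac s a = qfrac (a \<otimes> s) (s \<otimes> a)"
        unfolding as(1) by (rule frac_mult[OF as(2,3) sc a])
      also have "\<dots> = \<one>\<^bsub>L\<^esub>"
        unfolding L_one
        by (rule frac_eqI[OF m_closed[OF as(2) sc] compl_mult[OF as(3) a] one_closed compl_one])
          (use as(2) sc in \<open>simp add: m_comm\<close>)
      finally have "X \<otimes>\<^bsub>L\<^esub> qfrac s a = \<one>\<^bsub>L\<^esub>" .
      then show ?thesis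
        using X(1) frac_closed[OF sc a] L.m_comm[OF X(1) frac_closed[OF sc a]]
        unfolding Units_def by (metis (mono_tags, lifting) mem_Collect_eq)
    qed
    show "\<forall>X\<in>carrier L. qfrac x \<one> \<otimes>\<^bsub>L\<^esub> X = \<zero>\<^bsub>L\<^esub> \<longrightarrow> X = \<zero>\<^bsub>L\<^esub>"
    proof (intro ballI impI)
      fix X assume X: "X \<in> carrier L" "qfrac x \<one> \<otimes>\<^bsub>L\<^esub> X = \<zero>\<^bsub>L\<^esub>"
      obtain b t where bt: "X = qfrac b t" "b \<in> carrier R" "t \<in> carrier R - I" by (rule L_cases[OF X(1)])
      have xc: "x \<in> carrier R" using x Icarr by blast
      have "qfrac (x \<otimes> b) (\<one> \<otimes> t) = qfrac \<zero> \<one>"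
        using X(2) unfolding bt(1) L_zero frac_mult[OF xc compl_one bt(2,3)] .
      then obtain u where u: "u \<in> carrier R - I" "u \<otimes> ((x \<otimes> b) \<otimes> \<one>) = u \<otimes> (\<zero> \<otimes> (\<one> \<otimes> t))"
        using frac_eq_iff[OF m_closed[OF xc bt(2)] compl_mult[OF compl_one bt(3)] zero_closed compl_one]
        by blast
      have uc: "u \<in> carrier R" "t \<in> carrier R" using u(1) bt(3) by auto
      \<comment> \<open>A fraction is zero if some \<open>u\<close> outside \<open>I\<close> kills
        its numerator; regularity of \<open>x\<close> lets the same \<open>u\<close> kill
        \<open>b\<close>.\<close>
      then have "x \<otimes> (u \<otimes> b) = \<zero>" using u(2) xc bt(2) by (simp add: m_lcomm)
      then have ub: "u \<otimes> b = \<zero>" using x_regular m_closed[OF uc(1) bt(2)] by blast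
      show "X = \<zero>\<^bsub>L\<^esub>" unfolding bt(1) L_zero
        unfolding frac_eq_iff[OF bt(2,3) zero_closed compl_one]
        using u(1) ub uc bt(2) by (intro bexI[OF _ u(1)]) simp
    qed
    show "\<not> P1 \<subset> P2" if P: "primeideal P0 L" "primeideal P1 L" "primeideal P2 L" "P0 \<subset> P1" for P0 P1 P2
    proof
      assume "P1 \<subset> P2"
      note id = primeideal.axioms(1)[OF P(1)] primeideal.axioms(1)[OF P(2)] primeideal.axioms(1)[OF P(3)]
      show False
        using no_chain[OF h.primeideal_vimage[OF is_cring P(1)] h.primeideal_vimage[OF is_cring P(2)]
            h.primeideal_vimage[OF is_cring P(3)] contraction_strict_mono[OF id(1,2) P(4)]]
          contraction_strict_mono[OF id(2,3) \<open>P1 \<subset> P2\<close>] by (rule notE)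
    qed
  qed
  then show ?thesis by (rule one_dim_local.cohen_macaulay_local)
qed

end

section \<open>Finite algebras over a polynomial ring\<close>

text \<open>Stated for bare sets of polynomials because it serves for pullbacks of ideals, for the
  ideal of two polynomials, and for a set of leading coefficients.\<close>

lemma poly_ideal_principal:
  fixes D :: "'k::field poly set"
  assumes zero: "0 \<in> D" and add: "\<And>p q. p \<in> D \<Longrightarrow> q \<in> D \<Longrightarrow> p + q \<in> D"
    and mult: "\<And>p q. p \<in> D \<Longrightarrow> q * p \<in> D"
  shows "\<exists>d\<in>D. \<forall>p\<in>D. d dvd p"
proof (cases "D = {0}")
  case True
  then show ?thesis by auto
next
  case False
  then obtain p where p: "p \<in> D" "p \<noteq> 0" using zero by auto
  define P where "P q \<longleftrightarrow> q \<in> D \<and> q \<noteq> 0" for q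
  obtain d where d: "P d" and least: "\<And>q. P q \<Longrightarrow> degree d \<le> degree q"
    using ex_has_least_nat[of P p degree] p unfolding P_def by blast
  have "d dvd q" if "q \<in> D" for q
  proof (rule ccontr)
    assume "\<not> d dvd q"
    then have nz: "q mod d \<noteq> 0" by (simp add: dvd_eq_mod_eq_0)
    have "q mod d = q + (- (q div d)) * d" by (simp add: minus_div_mult_eq_mod[symmetric])
    also have "\<dots> \<in> D" using add[OF that mult[of d "- (q div d)"]] d by (simp add: P_def)
    finally have "degree d \<le> degree (q mod d)" using least nz by (simp add: P_def)
    moreover have "degree (q mod d) < degree d"
      using degree_mod_less[of d q] d nz by (auto simp: P_def)
    ultimately show False by simp
  qed
  then show ?thesis using d by (auto simp: P_def)
qed

text \<open>The properties of the graded ring over \<open>K[x]\<close>, kept abstract so that they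
  can be moved along an isomorphism: \<open>nilpotent\<close> controls the primes,
  \<open>phi_regular\<close> provides nonzerodivisors, \<open>fin_gen\<close> gives
  Noetherianity.\<close>

locale polynomial_algebra = cring +
  fixes \<phi> :: "'k::field poly \<Rightarrow> 'a"
  assumes phi_closed [simp]: "\<phi> p \<in> carrier R"
    and phi_add: "\<phi> (p + q) = \<phi> p \<oplus> \<phi> q"
    and phi_mult: "\<phi> (p * q) = \<phi> p \<otimes> \<phi> q"
    and phi_one: "\<phi> 1 = \<one>"
    and nilpotent: "a \<in> carrier R \<Longrightarrow> \<exists>p (n::nat). (a \<ominus> \<phi> p) [^] n = \<zero>"
    and phi_regular: "p \<noteq> 0 \<Longrightarrow> a \<in> carrier R \<Longrightarrow> \<phi> p \<otimes> a = \<zero> \<Longrightarrow> a = \<zero>"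
    and fin_gen: "\<exists>(e :: nat \<Rightarrow> 'a) n. (\<forall>i. e i \<in> carrier R) \<and>
        (\<forall>a\<in>carrier R. \<exists>p. a = (\<Oplus>i\<in>{..<n}. \<phi> (p i) \<otimes> e i))"
begin

lemma phi_zero: "\<phi> 0 = \<zero>"
  using phi_add[of 0 0] by (simp add: add.l_cancel_one')

lemma phi_uminus: "\<phi> (- p) = \<ominus> \<phi> p"
proof -
  have "\<phi> p \<oplus> \<phi> (- p) = \<zero>" unfolding phi_add[symmetric] by (simp add: phi_zero)
  then show ?thesis using minus_equality[of "\<phi> (-p)" "\<phi> p"] by (simp add: a_comm)
qed

definition pullback :: "'a set \<Rightarrow> 'k poly set" where
  "pullback Q = {p. \<phi> p \<in> Q}"

text \<open>The nilpotent difference lies in every prime, so a prime is determined by the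
  polynomials in it.\<close>

lemma prime_mem_approx:
  assumes Q: "primeideal Q R" and a: "a \<in> carrier R"
  obtains p where "a \<in> Q \<longleftrightarrow> p \<in> pullback Q" "a \<ominus> \<phi> p \<in> Q"
proof -
  interpret Q: primeideal Q R by fact
  obtain p n where "(a \<ominus> \<phi> p) [^] (n::nat) = \<zero>" using nilpotent[OF a] by blast
  then have d: "a \<ominus> \<phi> p \<in> Q"
    using prime_pow_mem[OF Q minus_closed[OF a phi_closed]] Q.zero_closed by metis
  have "a = (a \<ominus> \<phi> p) \<oplus> \<phi> p" using a by (simp add: a_minus_def a_assoc l_neg)
  then have "\<phi> p \<in> Q \<Longrightarrow> a \<in> Q" using Q.a_closed[OF d] by metis
  moreover have "\<phi> p = a \<oplus> \<ominus> (a \<ominus> \<phi> p)"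
    using a by (simp add: a_minus_def minus_add a_assoc[symmetric] r_neg)
  then have "a \<in> Q \<Longrightarrow> \<phi> p \<in> Q" using Q.a_closed Q.a_inv_closed[OF d] by metis
  ultimately show thesis using that[of p] d by (auto simp: pullback_def)
qed

lemma pullback_zero: "ideal Q R \<Longrightarrow> 0 \<in> pullback Q"
  by (simp add: pullback_def phi_zero additive_subgroup.zero_closed[OF ideal.axioms(1)])

lemma pullback_add: "ideal Q R \<Longrightarrow> p \<in> pullback Q \<Longrightarrow> q \<in> pullback Q \<Longrightarrow> p + q \<in> pullback Q"
  by (simp add: pullback_def phi_add additive_subgroup.a_closed[OF ideal.axioms(1)])

lemma pullback_mult: "ideal Q R \<Longrightarrow> p \<in> pullback Q \<Longrightarrow> q * p \<in> pullback Q"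
  by (simp add: pullback_def phi_mult ideal.I_l_closed)

lemma pullback_prime:
  "primeideal Q R \<Longrightarrow> p * q \<in> pullback Q \<Longrightarrow> p \<in> pullback Q \<or> q \<in> pullback Q"
  using primeideal.I_prime[of Q R "\<phi> p" "\<phi> q"] by (simp add: pullback_def phi_mult)

lemma pullback_one: "primeideal Q R \<Longrightarrow> 1 \<notin> pullback Q"
  using ideal.one_imp_carrier primeideal.axioms(1) primeideal.I_notcarr
  by (fastforce simp: pullback_def phi_one)

text \<open>One approximation \<open>p\<close> of \<open>a\<close> serves both primes, because
  \<open>a \<ominus> \<phi> p\<close> lies already in the smaller one.\<close>

lemma pullback_strict_mono:
  assumes Q: "primeideal Q R" and Q': "primeideal Q' R" and sub: "Q \<subset> Q'"
  shows "\<exists>p. p \<in> pullback Q' \<and> p \<notin> pullback Q"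
proof -
  obtain a where a: "a \<in> Q'" "a \<notin> Q" using sub by blast
  have ac: "a \<in> carrier R" using ideal.Icarr[OF primeideal.axioms(1)[OF Q'] a(1)] .
  obtain p where p: "a \<in> Q \<longleftrightarrow> p \<in> pullback Q" "a \<ominus> \<phi> p \<in> Q" by (rule prime_mem_approx[OF Q ac])
  interpret Q': primeideal Q' R by fact
  have d: "a \<ominus> \<phi> p \<in> Q'" using p(2) sub by blast
  have "\<phi> p = a \<oplus> \<ominus> (a \<ominus> \<phi> p)"
    using ac by (simp add: a_minus_def minus_add a_assoc[symmetric] r_neg)
  then have "\<phi> p \<in> Q'" using Q'.a_closed[OF a(1) Q'.a_inv_closed[OF d]] by metis
  then show ?thesis using p(1) a(2) by (auto simp: pullback_def)
qed

text \<open>Pullbacks of primes are primes of a principal ideal domain.\<close>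

lemma no_prime_chain:
  assumes P: "primeideal P0 R" "primeideal P1 R" "primeideal P2 R" and sub: "P0 \<subset> P1"
  shows "\<not> P1 \<subset> P2"
proof
  assume "P1 \<subset> P2"
  note id = primeideal.axioms(1)[OF P(1)] primeideal.axioms(1)[OF P(2)] primeideal.axioms(1)[OF P(3)]
  obtain p where p: "p \<in> pullback P1" "p \<notin> pullback P0" using pullback_strict_mono[OF P(1,2) sub] by blast
  obtain q where q: "q \<in> pullback P2" "q \<notin> pullback P1"
    using pullback_strict_mono[OF P(2,3) \<open>P1 \<subset> P2\<close>] by blast
  obtain r where r: "r \<in> pullback P1" "\<forall>p\<in>pullback P1. r dvd p"
    using poly_ideal_principal[OF pullback_zero[OF id(2)] pullback_add[OF id(2)] pullback_mult[OF id(2)]]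
    by blast
  \<comment> \<open>This is where \<open>P0\<close> enters: \<open>p\<close> is nonzero because 0
    belongs to the pullback of \<open>P0\<close>.\<close>
  have "r \<noteq> 0" using r(2) p pullback_zero[OF id(1)] by force
  \<comment> \<open>The generator \<open>d\<close> of \<open>(r, q)\<close> is a gcd. As
    \<open>r\<close> generates a nonzero prime and does not divide \<open>q\<close>, the factor
    \<open>d\<close> of \<open>r\<close> is a unit; but \<open>d\<close> lies in the pullback of
    \<open>P2\<close>.\<close>
  define D where "D = {u * r + v * q | u v. True}"
  have "\<exists>d\<in>D. \<forall>p\<in>D. d dvd p"
  proof (rule poly_ideal_principal)
    have "0 = 0 * r + 0 * q" by simp
    then show "0 \<in> D" unfolding D_def by blast
  next
    fix f g assume "f \<in> D" "g \<in> D"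
    then obtain u v u' v' where "f = u * r + v * q" "g = u' * r + v' * q" unfolding D_def by blast
    then have "f + g = (u + u') * r + (v + v') * q" by (simp add: algebra_simps)
    then show "f + g \<in> D" unfolding D_def by blast
  next
    fix f g assume "f \<in> D"
    then obtain u v where "f = u * r + v * q" unfolding D_def by blast
    then have "g * f = (g * u) * r + (g * v) * q" by (simp add: algebra_simps)
    then show "g * f \<in> D" unfolding D_def by blast
  qed
  then obtain d where d: "d \<in> D" "\<forall>p\<in>D. d dvd p" by blast
  have "r = 1 * r + 0 * q" "q = 0 * r + 1 * q" by simp_all
  then have "r \<in> D" "q \<in> D" unfolding D_def by blast+
  then have dr: "d dvd r" and dq: "d dvd q" using d(2) by blast+
  obtain e where e: "r = d * e" using dr by blast
  have "d \<in> pullback P1 \<or> e \<in> pullback P1" using pullback_prime[OF P(2)] r(1) e by blast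
  moreover have "d \<notin> pullback P1"
  proof
    assume "d \<in> pullback P1"
    then have "r dvd q" using r(2) dq by (meson dvd_trans)
    then obtain w where "q = w * r" by (metis dvdE mult.commute)
    then show False using pullback_mult[OF id(2) r(1)] q(2) by blast
  qed
  ultimately have "r dvd e" using r(2) by blast
  then obtain f where "e = r * f" by blast
  then have "r * 1 = r * (d * f)" using e by (simp add: mult.assoc mult.left_commute)
  then have df: "f * d = 1" using \<open>r \<noteq> 0\<close> by (simp add: mult.commute)
  obtain u v where "d = u * r + v * q" using d(1) unfolding D_def by blast
  moreover have "r \<in> pullback P2" using r(1) \<open>P1 \<subset> P2\<close> by (auto simp: pullback_def)
  ultimately have "d \<in> pullback P2" using pullback_add[OF id(3)] pullback_mult[OF id(3)] q(1) by metis
  then have "1 \<in> pullback P2" using pullback_mult[OF id(3), of d f] df by simp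
  then show False using pullback_one[OF P(3)] by blast
qed

text \<open>If only 0 pulled back into \<open>P\<close>, the element \<open>?x\<close> would be
  invertible modulo \<open>P\<close>. Replacing its inverse by a polynomial approximation
  \<open>q\<close> puts \<open>1 - q * monom 1 1\<close> into the pullback, so it is zero, which
  fails at the point 0.\<close>

lemma maximal_contains_regular:
  assumes "maximalideal P R"
  shows "\<exists>x\<in>P. \<forall>a\<in>carrier R. x \<otimes> a = \<zero> \<longrightarrow> a = \<zero>"
proof -
  have prime: "primeideal P R" using maximalideal_prime assms by blast
  interpret P: maximalideal P R by fact
  interpret P: primeideal P R by fact
  have "\<exists>p\<in>pullback P. p \<noteq> 0"
  proof (rule ccontr)
    assume "\<not> ?thesis"
    then have only0: "\<And>p. \<phi> p \<in> P \<Longrightarrow> p = 0" by (auto simp: pullback_def)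
    let ?x = "\<phi> (monom 1 1)"
    have "?x \<notin> P" using only0[of "monom 1 1"] by auto
    let ?J = "set_add R P (PIdl ?x)"
    have J: "ideal ?J R" using add_ideals[OF P.is_ideal cgenideal_ideal[OF phi_closed]] .
    have mem: "a \<oplus> b \<in> ?J" if "a \<in> P" "b \<in> PIdl ?x" for a b
      using that unfolding set_add_def set_mult_def by auto
    have x0: "\<zero> \<in> PIdl ?x" "?x \<in> PIdl ?x"
      using additive_subgroup.zero_closed[OF ideal.axioms(1)[OF cgenideal_ideal[OF phi_closed]]]
        cgenideal_self[OF phi_closed] by auto
    have "P \<subseteq> ?J" using mem[OF _ x0(1)] P.Icarr by fastforce
    moreover have "?x \<in> ?J" using mem[OF P.zero_closed x0(2)] by simp
    ultimately have "?J = carrier R" using P.I_maximal[OF J] J \<open>?x \<notin> P\<close>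
      by (metis ideal.Icarr subsetI)
    then have "\<one> \<in> ?J" by simp
    then obtain c y where c: "c \<in> P" "y \<in> carrier R" "\<one> = c \<oplus> y \<otimes> ?x"
      unfolding set_add_def set_mult_def cgenideal_def by auto
    obtain q where q: "y \<ominus> \<phi> q \<in> P" by (rule prime_mem_approx[OF prime c(2)])
    have cc: "c \<in> carrier R" using c(1) P.Icarr by blast
    have "\<phi> (1 - q * monom 1 1) = \<one> \<ominus> \<phi> q \<otimes> ?x"
      unfolding diff_conv_add_uminus phi_add phi_uminus phi_mult phi_one a_minus_def ..
    also have "\<dots> = c \<oplus> (y \<ominus> \<phi> q) \<otimes> ?x"
      unfolding c(3) using c(2) cc by (simp add: a_minus_def l_distr l_minus a_assoc)
    also have "\<dots> \<in> P" using c(1) P.I_r_closed[OF q phi_closed] by (rule P.a_closed)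
    finally have "1 - q * monom 1 1 = 0" by (rule only0)
    then have "q * monom 1 1 = 1" by simp
    then have "poly (q * monom 1 1) 0 = 1" by simp
    then show False by (simp add: poly_monom)
  qed
  then show ?thesis using phi_regular by (auto simp: pullback_def)
qed

text \<open>Induction on the number of module generators: the coefficients of \<open>e n\<close> in
  elements of \<open>I \<inter> V (Suc n)\<close> form an ideal \<open>D\<close> of
  \<open>K[x]\<close>, and subtracting a multiple of one element \<open>g\<close> that realizes its
  generator leads into \<open>V n\<close>.\<close>

lemma noetherian: "noetherian_ring R"
proof -
  obtain e :: "nat \<Rightarrow> 'a" and N where e: "\<And>i. e i \<in> carrier R"
    and gen: "\<And>a. a \<in> carrier R \<Longrightarrow> \<exists>p. a = (\<Oplus>i\<in>{..<N}. \<phi> (p i) \<otimes> e i)"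
    using fin_gen by blast
  define V where "V n = {(\<Oplus>i\<in>{..<n}. \<phi> (p i) \<otimes> e i) | p. True}" for n :: nat
  have V_Suc: "v \<in> V (Suc n) \<longleftrightarrow> (\<exists>p. \<exists>w\<in>V n. v = \<phi> p \<otimes> e n \<oplus> w)" for v n
  proof
    assume "v \<in> V (Suc n)"
    then obtain p where "v = (\<Oplus>i\<in>{..<Suc n}. \<phi> (p i) \<otimes> e i)" unfolding V_def by blast
    then have "v = \<phi> (p n) \<otimes> e n \<oplus> (\<Oplus>i\<in>{..<n}. \<phi> (p i) \<otimes> e i)"
      unfolding lessThan_Suc using e by (subst (asm) finsum_insert) auto
    then show "\<exists>p. \<exists>w\<in>V n. v = \<phi> p \<otimes> e n \<oplus> w" unfolding V_def by blast
  next
    assume "\<exists>p. \<exists>w\<in>V n. v = \<phi> p \<otimes> e n \<oplus> w"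
    then obtain p p' where v: "v = \<phi> p \<otimes> e n \<oplus> (\<Oplus>i\<in>{..<n}. \<phi> (p' i) \<otimes> e i)" unfolding V_def by blast
    let ?q = "p'(n := p)"
    have "(\<Oplus>i\<in>{..<Suc n}. \<phi> (?q i) \<otimes> e i) = \<phi> (?q n) \<otimes> e n \<oplus> (\<Oplus>i\<in>{..<n}. \<phi> (?q i) \<otimes> e i)"
      unfolding lessThan_Suc using e by (subst finsum_insert) auto
    also have "(\<Oplus>i\<in>{..<n}. \<phi> (?q i) \<otimes> e i) = (\<Oplus>i\<in>{..<n}. \<phi> (p' i) \<otimes> e i)"
      by (rule finsum_cong') (use e in auto)
    finally have "v = (\<Oplus>i\<in>{..<Suc n}. \<phi> (?q i) \<otimes> e i)" using v by simp
    then show "v \<in> V (Suc n)" unfolding V_def by blast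
  qed
  have V0: "V 0 = {\<zero>}" unfolding V_def by auto
  have V_props: "V n \<subseteq> carrier R \<and> (\<forall>v\<in>V n. \<forall>w\<in>V n. v \<oplus> w \<in> V n) \<and> (\<forall>v\<in>V n. \<forall>q. \<phi> q \<otimes> v \<in> V n)" for n
  proof (induction n)
    case 0
    then show ?case by (auto simp: V0)
  next
    case (Suc n)
    then have carr: "\<And>v. v \<in> V n \<Longrightarrow> v \<in> carrier R" and
      add: "\<And>v w. v \<in> V n \<Longrightarrow> w \<in> V n \<Longrightarrow> v \<oplus> w \<in> V n" and
      mul: "\<And>v q. v \<in> V n \<Longrightarrow> \<phi> q \<otimes> v \<in> V n" by blast+
    have "v \<in> carrier R" if "v \<in> V (Suc n)" for v
      using that[unfolded V_Suc] carr e by auto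
    moreover have "v \<oplus> w \<in> V (Suc n)" if vw: "v \<in> V (Suc n)" "w \<in> V (Suc n)" for v w
    proof -
      obtain p v' where v: "v' \<in> V n" "v = \<phi> p \<otimes> e n \<oplus> v'" using vw(1) V_Suc by blast
      obtain q w' where w: "w' \<in> V n" "w = \<phi> q \<otimes> e n \<oplus> w'" using vw(2) V_Suc by blast
      have "v \<oplus> w = \<phi> (p + q) \<otimes> e n \<oplus> (v' \<oplus> w')"
        unfolding v(2) w(2) phi_add using carr[OF v(1)] carr[OF w(1)] e[of n] by (simp add: l_distr a_ac)
      then show ?thesis unfolding V_Suc using add[OF v(1) w(1)] by blast
    qed
    moreover have "\<phi> q \<otimes> v \<in> V (Suc n)" if vw: "v \<in> V (Suc n)" for v q
    proof -
      obtain p v' where v: "v' \<in> V n" "v = \<phi> p \<otimes> e n \<oplus> v'" using vw V_Suc by blast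
      have "\<phi> q \<otimes> v = \<phi> (q * p) \<otimes> e n \<oplus> \<phi> q \<otimes> v'"
        unfolding v(2) phi_mult using carr[OF v(1)] e[of n] by (simp add: r_distr m_assoc)
      then show ?thesis unfolding V_Suc using mul[OF v(1)] by blast
    qed
    ultimately show ?case by blast
  qed
  then have V_carr: "\<And>v n. v \<in> V n \<Longrightarrow> v \<in> carrier R" and
      V_add: "\<And>v w n. v \<in> V n \<Longrightarrow> w \<in> V n \<Longrightarrow> v \<oplus> w \<in> V n" and
      V_mul: "\<And>v q n. v \<in> V n \<Longrightarrow> \<phi> q \<otimes> v \<in> V n" by blast+
  \<comment> \<open>The finite set \<open>F\<close> is described by the ideals that contain it, not
    as a spanning set; the case \<open>J = Idl F\<close> gives the claim.\<close>
  have fg: "\<exists>F. finite F \<and> F \<subseteq> I \<and> (\<forall>J. ideal J R \<longrightarrow> F \<subseteq> J \<longrightarrow> I \<inter> V n \<subseteq> J)"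
    if I: "ideal I R" for I n
  proof (induction n)
    case 0
    have "\<forall>J. ideal J R \<longrightarrow> {} \<subseteq> J \<longrightarrow> I \<inter> V 0 \<subseteq> J"
      unfolding V0 using additive_subgroup.zero_closed[OF ideal.axioms(1)] by blast
    then show ?case by blast
  next
    case (Suc n)
    interpret I: ideal I R by (rule I)
    obtain F where F: "finite F" "F \<subseteq> I" "\<And>J. ideal J R \<Longrightarrow> F \<subseteq> J \<Longrightarrow> I \<inter> V n \<subseteq> J"
      using Suc.IH by blast
    define D where "D = {p. \<exists>v\<in>V n. \<phi> p \<otimes> e n \<oplus> v \<in> I}"
    have "\<exists>d\<in>D. \<forall>p\<in>D. d dvd p"
    proof (rule poly_ideal_principal)
      have "\<phi> 0 \<otimes> e n \<oplus> \<zero> \<in> I" using e[of n] by (simp add: phi_zero)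
      moreover have "\<exists>p. \<zero> = (\<Oplus>i\<in>{..<n}. \<phi> (p i) \<otimes> e i)"
        by (rule exI[of _ "\<lambda>_. 0"]) (use e in \<open>simp add: phi_zero\<close>)
      then have "\<zero> \<in> V n" unfolding V_def by blast
      ultimately show "0 \<in> D" unfolding D_def by blast
    next
      fix p q assume "p \<in> D" "q \<in> D"
      then obtain v w where v: "v \<in> V n" "\<phi> p \<otimes> e n \<oplus> v \<in> I" and w: "w \<in> V n" "\<phi> q \<otimes> e n \<oplus> w \<in> I"
        unfolding D_def by blast
      have "\<phi> (p + q) \<otimes> e n \<oplus> (v \<oplus> w) = (\<phi> p \<otimes> e n \<oplus> v) \<oplus> (\<phi> q \<otimes> e n \<oplus> w)"
        unfolding phi_add using V_carr[OF v(1)] V_carr[OF w(1)] e[of n] by (simp add: l_distr a_ac)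
      then show "p + q \<in> D" unfolding D_def mem_Collect_eq
        using I.a_closed[OF v(2) w(2)] V_add[OF v(1) w(1)] by metis
    next
      fix p q assume "p \<in> D"
      then obtain v where v: "v \<in> V n" "\<phi> p \<otimes> e n \<oplus> v \<in> I" unfolding D_def by blast
      have "\<phi> (q * p) \<otimes> e n \<oplus> \<phi> q \<otimes> v = \<phi> q \<otimes> (\<phi> p \<otimes> e n \<oplus> v)"
        unfolding phi_mult using V_carr[OF v(1)] e[of n] by (simp add: r_distr m_assoc)
      then show "q * p \<in> D" unfolding D_def mem_Collect_eq
        using I.I_l_closed[OF v(2) phi_closed] V_mul[OF v(1)] by metis
    qed
    then obtain d v where d: "v \<in> V n" "\<phi> d \<otimes> e n \<oplus> v \<in> I" "\<forall>p\<in>D. d dvd p" unfolding D_def by blast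
    define g where "g = \<phi> d \<otimes> e n \<oplus> v"
    have "I \<inter> V (Suc n) \<subseteq> J" if J: "ideal J R" and FJ: "insert g F \<subseteq> J" for J
    proof
      interpret J: ideal J R by (rule J)
      fix u assume u: "u \<in> I \<inter> V (Suc n)"
      then obtain p w where w: "w \<in> V n" "u = \<phi> p \<otimes> e n \<oplus> w" using V_Suc by blast
      then have "p \<in> D" unfolding D_def using u by blast
      then obtain q where q: "p = q * d" using d(3) by (metis dvdE mult.commute)
      have wc: "w \<in> carrier R" "v \<in> carrier R" using V_carr w d by auto
      have "u = \<phi> q \<otimes> g \<oplus> (w \<oplus> \<phi> (- q) \<otimes> v)"
        unfolding w(2) q g_def phi_mult phi_uminus using wc e[of n]
        by (simp add: r_distr m_assoc l_minus a_ac r_neg2 r_neg1 a_lcomm r_neg)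
      \<comment> \<open>The left form shows that the remainder lies in \<open>V n\<close>, the right
        form that it lies in \<open>I\<close>.\<close>
      moreover have rest: "w \<oplus> \<phi> (- q) \<otimes> v = u \<oplus> \<phi> (- q) \<otimes> g"
        unfolding w(2) q g_def phi_mult phi_uminus using wc e[of n]
        by (simp add: r_distr m_assoc l_minus a_ac r_neg2 r_neg1 a_lcomm r_neg)
      have "u \<oplus> \<phi> (- q) \<otimes> g \<in> I" using u d(2) I.I_l_closed[OF _ phi_closed] by (auto simp: g_def)
      then have "w \<oplus> \<phi> (- q) \<otimes> v \<in> I \<inter> V n" using rest V_add[OF w(1) V_mul[OF d(1)]] by (metis IntI)
      then have "w \<oplus> \<phi> (- q) \<otimes> v \<in> J" using F(3)[OF J] FJ by blast
      moreover have "\<phi> q \<otimes> g \<in> J" using FJ J.I_l_closed by simp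
      ultimately show "u \<in> J" using J.a_closed by metis
    qed
    moreover have "insert g F \<subseteq> I" using d(2) F(2) by (simp add: g_def)
    ultimately show ?case using F(1) by (intro exI[of _ "insert g F"]) blast
  qed
  show ?thesis
  proof (rule noetherian_ringI)
    fix I assume I: "ideal I R"
    interpret I: ideal I R by (rule I)
    obtain F where F: "finite F" "F \<subseteq> I" "\<And>J. ideal J R \<Longrightarrow> F \<subseteq> J \<Longrightarrow> I \<inter> V N \<subseteq> J"
      using fg[OF I, of N] by blast
    have "I \<subseteq> V N" using gen I.Icarr unfolding V_def by blast
    have Fc: "F \<subseteq> carrier R" using F(2) I.Icarr by blast
    have "I \<subseteq> Idl F" using F(3)[OF genideal_ideal[OF Fc] genideal_self[OF Fc]] \<open>I \<subseteq> V N\<close> by blast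
    moreover have "Idl F \<subseteq> I" by (rule genideal_minimal[OF I F(2)])
    ultimately show "\<exists>A\<subseteq>carrier R. finite A \<and> I = Idl A" using F(1) Fc by blast
  qed
qed

theorem cohen_macaulay: "cohen_macaulay R"
  unfolding cohen_macaulay_def
proof (intro conjI allI impI)
  show "cring R" by (rule is_cring)
  show "noetherian_ring R" by (rule noetherian)
  fix P assume P: "maximalideal P R"
  then obtain x where x: "x \<in> P" "\<forall>a\<in>carrier R. x \<otimes> a = \<zero> \<longrightarrow> a = \<zero>"
    using maximal_contains_regular by blast
  interpret P: primeideal P R by (rule maximalideal_prime[OF P])
  show "cohen_macaulay_local (localize_at R P)"
    by (rule P.localize_cohen_macaulay_one_dim[OF x]) (rule no_prime_chain)
qed

end

section \<open>The graded ring on the monomial basis\<close>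

context num_semigroup
begin

text \<open>A model of the associated graded ring on the monomial basis \<open>e s\<close>, \<open>s \<in> S\<close>: the product
  \<open>e s * e u\<close> is \<open>e (s + u)\<close> if the orders add up, and 0 otherwise.\<close>

definition gmult :: "'k::field poly \<Rightarrow> 'k poly \<Rightarrow> 'k poly" where
  "gmult a b = Abs_poly (\<lambda>n. \<Sum>i\<le>n. if ord i + ord (n - i) = ord n then coeff a i * coeff b (n - i) else 0)"

text \<open>The type of polynomials serves here as a type of finitely supported coefficient
  families; exponent \<open>s\<close> stands for the basis element \<open>e s\<close>.\<close>

definition graded_model :: "'k::field poly ring" where
  "graded_model = \<lparr>carrier = {a. \<forall>n. coeff a n \<noteq> 0 \<longrightarrow> n \<in> S},
     mult = gmult, one = 1, zero = 0, add = (+)\<rparr>"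

lemma graded_model_simps [simp]:
  "mult graded_model = gmult" "one graded_model = 1" "zero graded_model = 0"
  "add graded_model = (+)"
  by (simp_all add: graded_model_def)

lemma in_graded_model_iff: "a \<in> carrier graded_model \<longleftrightarrow> (\<forall>n. coeff a n \<noteq> 0 \<longrightarrow> n \<in> S)"
  by (simp add: graded_model_def)

lemma graded_modelD: "a \<in> carrier graded_model \<Longrightarrow> coeff a n \<noteq> 0 \<Longrightarrow> n \<in> S"
  by (simp add: in_graded_model_iff)

lemma coeff_gmult:
  "coeff (gmult a b) n = (\<Sum>i\<le>n. if ord i + ord (n - i) = ord n then coeff a i * coeff b (n - i) else 0)"
proof -
  have "(\<Sum>i\<le>n. if ord i + ord (n - i) = ord n then coeff a i * coeff b (n - i) else 0) = 0"
    if n: "n > degree a + degree b" for n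
  proof (rule sum.neutral, rule ballI)
    fix i
    have "i > degree a \<or> n - i > degree b" using n by linarith
    then have "coeff a i * coeff b (n - i) = 0" by (auto simp: coeff_eq_0)
    then show "(if ord i + ord (n - i) = ord n then coeff a i * coeff b (n - i) else 0) = 0" by simp
  qed
  then show ?thesis unfolding gmult_def by (subst coeff_Abs_poly[of "degree a + degree b"]) auto
qed

lemma gmult_term_nonzero:
  assumes "coeff (gmult a b) n \<noteq> 0"
  obtains i where "i \<le> n" "ord i + ord (n - i) = ord n" "coeff a i \<noteq> 0" "coeff b (n - i) \<noteq> 0"
proof -
  obtain i where i: "i \<le> n" "(if ord i + ord (n - i) = ord n then coeff a i * coeff b (n - i) else 0) \<noteq> 0"
    using assms unfolding coeff_gmult
    by (rule sum.not_neutral_contains_not_neutral) auto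
  then show thesis using that[of i] by (auto split: if_splits)
qed

lemma coeff_gmult_monom:
  "coeff (gmult a (monom c s)) n =
     (if s \<le> n \<and> ord (n - s) + ord s = ord n then coeff a (n - s) * c else 0)"
proof (cases "s \<le> n")
  case True
  have "coeff (gmult a (monom c s)) n = (\<Sum>i\<in>{n - s}.
      if ord i + ord (n - i) = ord n then coeff a i * coeff (monom c s) (n - i) else 0)"
    unfolding coeff_gmult by (rule sum.mono_neutral_right) (use True in auto)
  then show ?thesis using True by simp
next
  case False
  then show ?thesis unfolding coeff_gmult by (auto intro!: sum.neutral)
qed

lemma gmult_comm: "gmult a b = gmult b a"
proof (rule poly_eqI)
  fix n
  show "coeff (gmult a b) n = coeff (gmult b a) n"
    unfolding coeff_gmult
    by (rule sum.reindex_bij_witness[of _ "\<lambda>i. n - i" "\<lambda>i. n - i"]) (auto simp: ac_simps)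
qed

lemma gmult_closed:
  assumes "a \<in> carrier graded_model" "b \<in> carrier graded_model"
  shows "gmult a b \<in> carrier graded_model"
  unfolding in_graded_model_iff
proof (intro allI impI)
  fix n assume "coeff (gmult a b) n \<noteq> 0"
  then obtain i where "i \<le> n" "coeff a i \<noteq> 0" "coeff b (n - i) \<noteq> 0" by (rule gmult_term_nonzero)
  then have "i + (n - i) \<in> S" using assms graded_modelD add_in by blast
  then show "n \<in> S" using \<open>i \<le> n\<close> by simp
qed

text \<open>Superadditivity lets equality for the total force equality at the intermediate sum. The
  right side does not depend on the bracketing, and that makes \<open>gmult\<close>
  associative.\<close>

lemma ord_additive_assoc:
  assumes "i \<in> S" "j \<in> S" "k \<in> S"
  shows "ord i + ord j = ord (i + j) \<and> ord (i + j) + ord k = ord (i + j + k)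
     \<longleftrightarrow> ord i + ord j + ord k = ord (i + j + k)"
  using ord_add[OF assms(1,2)] ord_add[OF add_in[OF assms(1,2)] assms(3)] by linarith

lemma gmult_assoc:
  assumes "a \<in> carrier graded_model" "b \<in> carrier graded_model" "c \<in> carrier graded_model"
  shows "gmult (gmult a b) c = gmult a (gmult b c)"
proof (rule poly_eqI)
  fix n
  define T where "T i j k = (if ord i + ord j + ord k = ord (i + j + k)
      then coeff a i * coeff b j * coeff c k else 0)" for i j k
  \<comment> \<open>Where a coefficient vanishes both sides are 0; elsewhere all three exponents lie
    in \<open>S\<close>, where superadditivity is available.\<close>
  have T: "(if ord (i + j) + ord k = ord (i + j + k)
      then (if ord i + ord j = ord (i + j) then coeff a i * coeff b j else 0) * coeff c k else 0) = T i j k"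
    for i j k
  proof (cases "coeff a i * coeff b j * coeff c k = 0")
    case False
    then have "i \<in> S" "j \<in> S" "k \<in> S" using assms graded_modelD by auto
    then show ?thesis using ord_additive_assoc[of i j k] unfolding T_def by auto
  qed (auto simp: T_def)
  have T': "(if ord i + ord (j + k) = ord (i + j + k)
      then coeff a i * (if ord j + ord k = ord (j + k) then coeff b j * coeff c k else 0) else 0) = T i j k"
    for i j k
  proof (cases "coeff a i * coeff b j * coeff c k = 0")
    case False
    then have "i \<in> S" "j \<in> S" "k \<in> S" using assms graded_modelD by auto
    then show ?thesis using ord_additive_assoc[of j k i] unfolding T_def by (auto simp: ac_simps)
  qed (auto simp: T_def)
  have "coeff (gmult (gmult a b) c) n = (\<Sum>j\<le>n. \<Sum>i\<le>j. T i (j - i) (n - j))"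
    unfolding coeff_gmult[of "gmult a b"]
  proof (rule sum.cong[OF refl])
    fix j assume j: "j \<in> {..n}"
    have "(if ord j + ord (n - j) = ord n then coeff (gmult a b) j * coeff c (n - j) else 0)
        = (\<Sum>i\<le>j. if ord j + ord (n - j) = ord n
            then (if ord i + ord (j - i) = ord j then coeff a i * coeff b (j - i) else 0) * coeff c (n - j) else 0)"
      unfolding coeff_gmult by (simp add: sum_distrib_right)
    also have "\<dots> = (\<Sum>i\<le>j. T i (j - i) (n - j))"
      by (rule sum.cong[OF refl], subst T[symmetric]) (use j in auto)
    finally show "(if ord j + ord (n - j) = ord n then coeff (gmult a b) j * coeff c (n - j) else 0)
        = (\<Sum>i\<le>j. T i (j - i) (n - j))" .
  qed
  also have "\<dots> = (\<Sum>i\<le>n. \<Sum>j\<le>n - i. T i j (n - i - j))"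
    \<comment> \<open>Only the reindexing of a triangular double sum is taken from power
      series.\<close>
    using fps_mult_assoc_lemma[of T n n] by (simp add: atLeast0AtMost)
  also have "\<dots> = coeff (gmult a (gmult b c)) n"
    unfolding coeff_gmult[of a]
  proof (rule sum.cong[OF refl])
    fix i assume i: "i \<in> {..n}"
    have "(if ord i + ord (n - i) = ord n then coeff a i * coeff (gmult b c) (n - i) else 0)
        = (\<Sum>j\<le>n - i. if ord i + ord (n - i) = ord n
            then coeff a i * (if ord j + ord (n - i - j) = ord (n - i) then coeff b j * coeff c (n - i - j) else 0) else 0)"
      unfolding coeff_gmult by (simp add: sum_distrib_left)
    also have "\<dots> = (\<Sum>j\<le>n - i. T i j (n - i - j))"
      by (rule sum.cong[OF refl], subst T'[symmetric]) (use i in auto)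
    finally show "(\<Sum>j\<le>n - i. T i j (n - i - j))
        = (if ord i + ord (n - i) = ord n then coeff a i * coeff (gmult b c) (n - i) else 0)" by simp
  qed
  finally show "coeff (gmult (gmult a b) c) n = coeff (gmult a (gmult b c)) n" .
qed

lemma gmult_add_left: "gmult (a + b) c = gmult a c + gmult b c"
  by (rule poly_eqI) (auto simp: coeff_gmult sum.distrib[symmetric] algebra_simps intro!: sum.cong)

lemma gmult_one: "gmult a 1 = a"
  using coeff_gmult_monom[of a 1 0] by (intro poly_eqI) (simp add: monom_eq_1)

lemma cring_graded_model: "cring (graded_model :: 'k::field poly ring)"
proof (rule cringI)
  show "abelian_group (graded_model :: 'k poly ring)"
  proof (rule abelian_groupI; (unfold graded_model_simps)?)
    show "\<exists>y\<in>carrier graded_model. y + x = 0" if "x \<in> carrier graded_model" for x :: "'k poly"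
      using that by (intro bexI[of _ "- x"]) (auto simp: in_graded_model_iff)
    show "x + y \<in> carrier graded_model"
      if "x \<in> carrier graded_model" "y \<in> carrier graded_model" for x y :: "'k poly"
      using that unfolding in_graded_model_iff by (metis add_0_right coeff_add)
  qed (simp_all add: in_graded_model_iff add.assoc)
  show "comm_monoid (graded_model :: 'k poly ring)"
  proof (rule comm_monoidI; (unfold graded_model_simps)?)
    show "1 \<in> carrier graded_model"
      unfolding in_graded_model_iff using zero_in by (auto simp: coeff_1)
    show "gmult x y = gmult y x" for x y :: "'k poly" by (rule gmult_comm)
  qed (simp_all add: gmult_closed gmult_assoc gmult_one gmult_comm[of 1])
qed (simp add: gmult_add_left)

lemma finsum_graded_model:
  assumes "finite X" "\<And>x. x \<in> X \<Longrightarrow> f x \<in> carrier graded_model"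
  shows "finsum graded_model f X = sum f X"
proof -
  interpret A: cring graded_model by (rule cring_graded_model)
  show ?thesis using assms
  proof (induction X rule: finite_induct)
    case (insert x X)
    then show ?case by (subst A.finsum_insert) auto
  qed simp
qed

lemma minus_graded_model:
  assumes "a \<in> carrier graded_model" "b \<in> carrier graded_model"
  shows "a \<ominus>\<^bsub>graded_model\<^esub> b = a - b"
proof -
  interpret A: cring graded_model by (rule cring_graded_model)
  have "- b \<in> carrier graded_model" using assms by (simp add: in_graded_model_iff)
  then have "\<ominus>\<^bsub>graded_model\<^esub> b = - b" using A.minus_equality[of "- b" b] assms by simp
  then show ?thesis by (simp add: a_minus_def)
qed

text \<open>This is \<open>p\<close> evaluated at \<open>x = e g1\<close>, whose \<open>k\<close>-th
  power is \<open>e (k * g1)\<close>.\<close>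

definition scale :: "'k::field poly \<Rightarrow> 'k poly" where
  "scale p = Abs_poly (\<lambda>n. if g1 dvd n then coeff p (n div g1) else 0)"

lemma coeff_scale: "coeff (scale p) n = (if g1 dvd n then coeff p (n div g1) else 0)"
proof -
  have "(if g1 dvd n then coeff p (n div g1) else 0) = 0" if n: "n > g1 * degree p" for n
  proof (cases "g1 dvd n")
    case True
    then obtain m where "n = g1 * m" by blast
    then have "degree p < n div g1" using n g1_pos by simp
    then show ?thesis by (simp add: coeff_eq_0)
  qed simp
  then show ?thesis unfolding scale_def by (subst coeff_Abs_poly[of "g1 * degree p"]) auto
qed

lemma coeff_scale_mult_g1: "coeff (scale p) (k * g1) = coeff p k"
  using g1_pos by (simp add: coeff_scale)

lemma scale_closed: "scale p \<in> carrier graded_model"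
  unfolding in_graded_model_iff
proof (intro allI impI)
  fix n assume "coeff (scale p) n \<noteq> 0"
  then have "g1 dvd n" by (auto simp: coeff_scale split: if_splits)
  then obtain k where "n = k * g1" by (metis dvdE mult.commute)
  then show "n \<in> S" using mult_in[OF g1_in] by simp
qed

lemma scale_add: "scale (p + q) = scale p + scale q"
  by (rule poly_eqI) (simp add: coeff_scale)

lemma scale_one: "scale 1 = 1"
  using g1_pos by (intro poly_eqI) (auto simp: coeff_scale coeff_1 elim!: dvdE)

lemma scale_mult: "scale (p * q) = gmult (scale p) (scale q)"
proof (rule poly_eqI)
  fix n
  let ?F = "\<lambda>n i. if ord i + ord (n - i) = ord n then coeff (scale p) i * coeff (scale q) (n - i) else 0"
  show "coeff (scale (p * q)) n = coeff (gmult (scale p) (scale q)) n"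
  proof (cases "g1 dvd n")
    case True
    then obtain m where m: "n = m * g1" by (metis dvdE mult.commute)
    have inj: "inj_on (\<lambda>i. i * g1) {..m}" using g1_pos by (auto simp: inj_on_def)
    have "coeff (gmult (scale p) (scale q)) n = sum (?F n) ((\<lambda>i. i * g1) ` {..m})"
      unfolding coeff_gmult
    proof (rule sum.mono_neutral_right)
      show "(\<lambda>i. i * g1) ` {..m} \<subseteq> {..n}" using m by auto
      show "\<forall>i\<in>{..n} - (\<lambda>i. i * g1) ` {..m}. ?F n i = 0"
      proof
        fix i assume i: "i \<in> {..n} - (\<lambda>i. i * g1) ` {..m}"
        have "\<not> g1 dvd i"
        proof
          assume "g1 dvd i"
          then obtain k where k: "i = k * g1" by (metis dvdE mult.commute)
          then have "k \<le> m" using i m g1_pos by simp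
          then show False using i k by blast
        qed
        then show "?F n i = 0" by (simp add: coeff_scale)
      qed
    qed simp
    also have "\<dots> = (\<Sum>i\<le>m. ?F n (i * g1))" by (simp add: sum.reindex[OF inj])
    also have "\<dots> = (\<Sum>i\<le>m. coeff p i * coeff q (m - i))"
    proof (rule sum.cong[OF refl])
      fix i assume i: "i \<in> {..m}"
      have "n - i * g1 = (m - i) * g1" using m by (simp add: diff_mult_distrib)
      then show "?F n (i * g1) = coeff p i * coeff q (m - i)"
        using i m by (simp add: ord_mult_g1 coeff_scale_mult_g1)
    qed
    also have "\<dots> = coeff (scale (p * q)) n" unfolding m coeff_scale_mult_g1 coeff_mult ..
    finally show ?thesis ..
  next
    case False
    have "coeff (gmult (scale p) (scale q)) n = 0"
    proof (rule ccontr)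
      assume "coeff (gmult (scale p) (scale q)) n \<noteq> 0"
      then obtain i where i: "i \<le> n" "coeff (scale p) i \<noteq> 0" "coeff (scale q) (n - i) \<noteq> 0"
        by (rule gmult_term_nonzero)
      then have "g1 dvd i" "g1 dvd n - i" by (auto simp: coeff_scale split: if_splits)
      then have "g1 dvd i + (n - i)" by (rule dvd_add)
      then show False using False i(1) by simp
    qed
    then show ?thesis using False by (simp add: coeff_scale)
  qed
qed

text \<open>Every product of \<open>N\<close> monomials \<open>e s\<close> with \<open>g1\<close> not dividing \<open>s\<close> lies in \<open>s \<ge> g1 * ord s + N\<close>,
  which is empty for large \<open>N\<close>.\<close>

lemma nilpotent_if_no_multiples:
  assumes b: "b \<in> carrier graded_model" and nm: "\<And>k. coeff b (k * g1) = 0"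
  shows "\<exists>N::nat. b [^]\<^bsub>graded_model\<^esub> N = 0"
proof -
  interpret A: cring graded_model by (rule cring_graded_model)
  have big: "g1 * ord s + 1 \<le> s" if "coeff b s \<noteq> 0" for s
  proof -
    have s: "s \<in> S" using b that graded_modelD by blast
    have "s \<noteq> ord s * g1" using nm[of "ord s"] that by metis
    then show ?thesis using ord_ge[OF s] by (simp add: mult.commute)
  qed
  have pow: "g1 * ord s + N \<le> s" if "coeff (b [^]\<^bsub>graded_model\<^esub> N) s \<noteq> 0" for s and N :: nat
    using that
  proof (induction N arbitrary: s)
    case 0
    then have "s = 0" by (simp add: coeff_1 split: if_splits)
    then show ?case by simp
  next
    case (Suc N)
    have "coeff (gmult (b [^]\<^bsub>graded_model\<^esub> N) b) s \<noteq> 0" using Suc.prems by simp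
    then obtain i where i: "i \<le> s" "ord i + ord (s - i) = ord s"
      "coeff (b [^]\<^bsub>graded_model\<^esub> N) i \<noteq> 0" "coeff b (s - i) \<noteq> 0" by (rule gmult_term_nonzero)
    have "g1 * ord i + N \<le> i" "g1 * ord (s - i) + 1 \<le> s - i" using Suc.IH i big by auto
    then have "g1 * (ord i + ord (s - i)) + Suc N \<le> i + (s - i)" by (simp add: distrib_left)
    then show ?case using i(1,2) by simp
  qed
  obtain C where C: "\<And>s. s \<in> S \<Longrightarrow> s < g1 * ord s + C" using ord_lower_bound by blast
  have "coeff (b [^]\<^bsub>graded_model\<^esub> C) s = 0" for s
  proof (rule ccontr)
    assume nz: "coeff (b [^]\<^bsub>graded_model\<^esub> C) s \<noteq> 0"
    then have "s \<in> S" using graded_modelD[OF A.nat_pow_closed[OF b]] by blast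
    then show False using pow[OF nz] C[of s] by simp
  qed
  then have "b [^]\<^bsub>graded_model\<^esub> C = 0" by (intro poly_eqI) simp
  then show ?thesis by blast
qed

lemma ord_add_multiples:
  assumes ord_add_g1: "\<And>s. s \<in> S \<Longrightarrow> ord (s + g1) = ord s + 1" and s: "s \<in> S"
  shows "ord (s + k * g1) = ord s + k"
proof (induction k)
  case (Suc k)
  have "ord (s + Suc k * g1) = ord ((s + k * g1) + g1)" by (simp add: ac_simps)
  also have "\<dots> = ord (s + k * g1) + 1" by (rule ord_add_g1[OF add_in[OF s mult_in[OF g1_in]]])
  finally show ?case using Suc by simp
qed simp

text \<open>Compare lowest exponents \<open>k\<close> of \<open>p\<close> and \<open>s\<close> of
  \<open>a\<close>: only one pair contributes at \<open>k * g1 + s\<close>, and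
  \<open>ord_add_g1\<close> keeps its product from vanishing.\<close>

lemma scale_regular:
  assumes ord_add_g1: "\<And>s. s \<in> S \<Longrightarrow> ord (s + g1) = ord s + 1"
    and p: "p \<noteq> 0" and a: "a \<in> carrier graded_model" and zero: "gmult (scale p) a = 0"
  shows "a = 0"
proof (rule ccontr)
  assume "a \<noteq> 0"
  then obtain s0 where "coeff a s0 \<noteq> 0" using leading_coeff_neq_0 by blast
  then have "coeff a (LEAST s. coeff a s \<noteq> 0) \<noteq> 0" by (rule LeastI)
  then obtain s where s: "coeff a s \<noteq> 0" "\<And>t. coeff a t \<noteq> 0 \<Longrightarrow> s \<le> t"
    using Least_le[of "\<lambda>t. coeff a t \<noteq> 0"] by blast
  obtain k0 where "coeff p k0 \<noteq> 0" using p leading_coeff_neq_0 by blast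
  then have "coeff p (LEAST k. coeff p k \<noteq> 0) \<noteq> 0" by (rule LeastI)
  then obtain k where k: "coeff p k \<noteq> 0" "\<And>t. coeff p t \<noteq> 0 \<Longrightarrow> k \<le> t"
    using Least_le[of "\<lambda>t. coeff p t \<noteq> 0"] by blast
  have sS: "s \<in> S" using a s graded_modelD by blast
  let ?n = "k * g1 + s"
  let ?F = "\<lambda>i. if ord i + ord (?n - i) = ord ?n then coeff (scale p) i * coeff a (?n - i) else 0"
  have "coeff (gmult (scale p) a) ?n = sum ?F {k * g1}"
    unfolding coeff_gmult
  proof (rule sum.mono_neutral_right)
    show "\<forall>i\<in>{..?n} - {k * g1}. ?F i = 0"
    proof (rule ballI, rule ccontr)
      fix i assume i: "i \<in> {..?n} - {k * g1}" and "?F i \<noteq> 0"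
      then have nz: "coeff (scale p) i \<noteq> 0" "coeff a (?n - i) \<noteq> 0" by (auto split: if_splits)
      then obtain j where j: "i = j * g1" "coeff p j \<noteq> 0"
        using g1_pos by (auto simp: coeff_scale mult.commute split: if_splits elim!: dvdE)
      then have "k * g1 \<le> i" using k(2)[of j] by simp
      moreover have "s \<le> ?n - i" using s(2)[OF nz(2)] .
      ultimately show False using i by auto
    qed
  qed auto
  also have "\<dots> = coeff p k * coeff a s"
    using ord_add_multiples[OF ord_add_g1 sS, of k] by (simp add: ord_mult_g1 coeff_scale_mult_g1 add.commute)
  finally show False using zero s(1) k(1) by simp
qed

text \<open>Each \<open>n\<close> in \<open>S\<close> is \<open>w i + k * g1\<close> with
  \<open>i = n mod g1\<close>, and additivity of orders gives \<open>e n = x^k e (w i)\<close>; so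
  \<open>p i\<close> collects the coefficients in the residue class of \<open>i\<close>.\<close>

lemma graded_model_fin_gen:
  assumes ord_add_g1: "\<And>s. s \<in> S \<Longrightarrow> ord (s + g1) = ord s + 1"
    and a: "a \<in> carrier graded_model"
  shows "\<exists>p. a = (\<Sum>i<g1. gmult (scale (p i)) (monom 1 (apery_elem S i)))"
proof -
  define w where "w i = apery_elem S i" for i
  have w: "w i \<in> S" "w i mod g1 = i mod g1" "\<And>s. s \<in> S \<Longrightarrow> s mod g1 = i mod g1 \<Longrightarrow> w i \<le> s" for i
    using apery_elem_spec apery_elem_le by (auto simp: w_def)
  define p where "p i = Abs_poly (\<lambda>k. coeff a (w i + k * g1))" for i
  have p: "coeff (p i) k = coeff a (w i + k * g1)" for i k
  proof -
    have "coeff a (w i + k * g1) = 0" if "k > degree a" for k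
    proof -
      have "k \<le> k * g1" using g1_pos by simp
      then show ?thesis using that by (intro coeff_eq_0) linarith
    qed
    then show ?thesis unfolding p_def by (subst coeff_Abs_poly[of "degree a"]) auto
  qed
  have single: "coeff (gmult (scale (p i)) (monom 1 (w i))) n = (if n mod g1 = i then coeff a n else 0)"
    if i: "i < g1" for i n
  proof (cases "w i \<le> n \<and> g1 dvd n - w i")
    case True
    then obtain k where k: "n = w i + k * g1" by (metis dvdE mult.commute le_add_diff_inverse)
    then have "n mod g1 = i" using w(2)[of i] i by simp
    moreover have "ord (k * g1) + ord (w i) = ord n"
      using ord_add_multiples[OF ord_add_g1 w(1)[of i], of k] k by (simp add: ord_mult_g1 add.commute)
    ultimately show ?thesis using k by (simp add: coeff_gmult_monom coeff_scale_mult_g1 p)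
  next
    case False
    then have "coeff (gmult (scale (p i)) (monom 1 (w i))) n = 0"
      by (auto simp: coeff_gmult_monom coeff_scale)
    moreover have "coeff a n = 0" if "n mod g1 = i"
    proof (rule ccontr)
      assume "coeff a n \<noteq> 0"
      then have "n \<in> S" using a graded_modelD by blast
      then have "w i \<le> n" using w(3)[of n i] that i by simp
      moreover have "n mod g1 = w i mod g1" using w(2)[of i] that i by simp
      ultimately show False using False by (metis mod_eq_dvd_iff_nat)
    qed
    ultimately show ?thesis by simp
  qed
  have "a = (\<Sum>i<g1. gmult (scale (p i)) (monom 1 (w i)))"
  proof (rule poly_eqI)
    fix n
    have "coeff (\<Sum>i<g1. gmult (scale (p i)) (monom 1 (w i))) n
        = (\<Sum>i<g1. if n mod g1 = i then coeff a n else 0)"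
      unfolding coeff_sum by (rule sum.cong) (auto simp: single)
    also have "\<dots> = coeff a n" using g1_pos by (simp add: sum.delta)
    finally show "coeff a n = coeff (\<Sum>i<g1. gmult (scale (p i)) (monom 1 (w i))) n" ..
  qed
  then show ?thesis unfolding w_def by blast
qed

lemma monom_closed: "s \<in> S \<Longrightarrow> monom c s \<in> carrier graded_model"
  by (auto simp: in_graded_model_iff split: if_splits)

lemma polynomial_algebra_graded_model:
  assumes ord_add_g1: "\<And>s. s \<in> S \<Longrightarrow> ord (s + g1) = ord s + 1"
  shows "polynomial_algebra graded_model (scale :: 'k::field poly \<Rightarrow> 'k poly)"
proof (intro polynomial_algebra.intro polynomial_algebra_axioms.intro; (unfold graded_model_simps)?)
  show "cring (graded_model :: 'k poly ring)" by (rule cring_graded_model)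
  fix a :: "'k poly" assume a: "a \<in> carrier graded_model"
  \<comment> \<open>Taking \<open>p\<close> from the multiples of \<open>g1\<close> leaves a
    difference without such exponents, which is nilpotent.\<close>
  define p where "p = Abs_poly (\<lambda>k. coeff a (k * g1))"
  have p: "coeff p k = coeff a (k * g1)" for k
  proof -
    have "coeff a (k * g1) = 0" if "k > degree a" for k
    proof -
      have "k \<le> k * g1" using g1_pos by simp
      then show ?thesis using that by (intro coeff_eq_0) linarith
    qed
    then show ?thesis unfolding p_def by (subst coeff_Abs_poly[of "degree a"]) auto
  qed
  interpret A: cring "graded_model :: 'k poly ring" by (rule cring_graded_model)
  have "a \<ominus>\<^bsub>graded_model\<^esub> scale p \<in> carrier graded_model" using a scale_closed by (rule A.minus_closed)
  then have "\<exists>n::nat. (a \<ominus>\<^bsub>graded_model\<^esub> scale p) [^]\<^bsub>graded_model\<^esub> n = 0"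
    by (rule nilpotent_if_no_multiples)
      (simp add: minus_graded_model[OF a scale_closed] coeff_scale_mult_g1 p)
  then show "\<exists>p (n::nat). (a \<ominus>\<^bsub>graded_model\<^esub> scale p) [^]\<^bsub>graded_model\<^esub> n = 0" by blast
next
  show "\<exists>(e :: nat \<Rightarrow> 'k poly) n. (\<forall>i. e i \<in> carrier graded_model) \<and>
      (\<forall>a\<in>carrier graded_model. \<exists>p. a = (\<Oplus>\<^bsub>graded_model\<^esub>i\<in>{..<n}. gmult (scale (p i)) (e i)))"
  proof (rule exI[of _ "\<lambda>i. monom 1 (apery_elem S i)"], rule exI[of _ g1], intro conjI allI ballI)
    show m: "monom 1 (apery_elem S i) \<in> carrier graded_model" for i
      using monom_closed apery_elem_spec by blast
    fix a :: "'k poly" assume "a \<in> carrier graded_model"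
    then obtain p where "a = (\<Sum>i<g1. gmult (scale (p i)) (monom 1 (apery_elem S i)))"
      using graded_model_fin_gen[OF ord_add_g1] by blast
    also have "\<dots> = (\<Oplus>\<^bsub>graded_model\<^esub>i\<in>{..<g1}. gmult (scale (p i)) (monom 1 (apery_elem S i)))"
      by (rule finsum_graded_model[symmetric]) (auto intro: gmult_closed scale_closed m)
    finally show "\<exists>p. a = (\<Oplus>\<^bsub>graded_model\<^esub>i\<in>{..<g1}. gmult (scale (p i)) (monom 1 (apery_elem S i)))"
      by blast
  qed
qed (use scale_regular[OF ord_add_g1] in \<open>simp_all add: scale_closed scale_add scale_mult scale_one\<close>)

end

section \<open>Powers of the maximal ideal\<close>

context num_semigroup
begin

abbreviation "KS \<equiv> semigroup_ring S"

lemma KS_simps [simp]: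
  "mult KS = (*)" "one KS = 1" "zero KS = 0" "add KS = (+)"
  by (simp_all add: semigroup_ring_def)

text \<open>An explicit form of the \<open>h\<close>-th power of the maximal ideal; see
  \<open>ideal_pow_eq\<close>.\<close>

definition supp_ideal :: "nat \<Rightarrow> 'k::field fps set" where
  "supp_ideal h = {f. \<forall>n. fps_nth f n \<noteq> 0 \<longrightarrow> n \<in> multM S h}"

lemma supp_idealD: "f \<in> supp_ideal h \<Longrightarrow> fps_nth f n \<noteq> 0 \<Longrightarrow> n \<in> multM S h"
  by (simp add: supp_ideal_def)

lemma supp_idealD0: "f \<in> supp_ideal h \<Longrightarrow> n \<notin> multM S h \<Longrightarrow> fps_nth f n = 0"
  using supp_idealD by blast

lemma carrier_KS: "carrier KS = supp_ideal 0"
  by (simp add: semigroup_ring_def supp_ideal_def)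

lemma supp_ideal_zero: "0 \<in> supp_ideal h"
  and supp_ideal_add: "f \<in> supp_ideal h \<Longrightarrow> g \<in> supp_ideal h \<Longrightarrow> f + g \<in> supp_ideal h"
  and supp_ideal_uminus: "f \<in> supp_ideal h \<Longrightarrow> - f \<in> supp_ideal h"
  unfolding supp_ideal_def mem_Collect_eq
  by (simp, metis add_0_right fps_add_nth, simp)

lemma supp_ideal_mult:
  assumes "f \<in> supp_ideal h" "g \<in> supp_ideal k"
  shows "f * g \<in> supp_ideal (h + k)"
  unfolding supp_ideal_def mem_Collect_eq
proof (intro allI impI)
  fix n assume "fps_nth (f * g) n \<noteq> 0"
  then obtain i where i: "i \<in> {0..n}" "fps_nth f i * fps_nth g (n - i) \<noteq> 0"
    unfolding fps_mult_nth by (rule sum.not_neutral_contains_not_neutral)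
  then have "fps_nth f i \<noteq> 0" "fps_nth g (n - i) \<noteq> 0" by auto
  then have "i + (n - i) \<in> multM S (h + k)"
    using assms supp_idealD multM_add by blast
  then show "n \<in> multM S (h + k)" using i(1) by simp
qed

lemma supp_ideal_antimono: "h \<le> k \<Longrightarrow> supp_ideal k \<subseteq> supp_ideal h"
  using multM_antimono by (auto simp: supp_ideal_def)

lemma supp_ideal_sum: "(\<And>x. x \<in> X \<Longrightarrow> f x \<in> supp_ideal h) \<Longrightarrow> sum f X \<in> supp_ideal h"
  by (induction X rule: infinite_finite_induct) (auto intro: supp_ideal_zero supp_ideal_add)

lemma cring_KS: "cring (KS :: 'k::field fps ring)"
proof (rule cringI)
  show "abelian_group (KS :: 'k fps ring)"
  proof (rule abelian_groupI; (unfold KS_simps carrier_KS)?)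
    show "\<exists>y\<in>supp_ideal 0. y + x = 0" if "x \<in> supp_ideal 0" for x :: "'k fps"
      using supp_ideal_uminus[OF that] by (intro bexI[of _ "- x"]) auto
  qed (simp_all add: supp_ideal_zero supp_ideal_add add.assoc)
  show "comm_monoid (KS :: 'k fps ring)"
  proof (rule comm_monoidI; (unfold KS_simps carrier_KS)?)
    show "1 \<in> (supp_ideal 0 :: 'k fps set)"
      using zero_in by (auto simp: supp_ideal_def)
    show "x * y \<in> supp_ideal 0" if "x \<in> supp_ideal 0" "y \<in> supp_ideal 0" for x y :: "'k fps"
      using supp_ideal_mult[OF that] by simp
  qed (simp_all add: mult.assoc mult.commute)
qed (simp add: distrib_right)

lemma ideal_supp_ideal: "ideal (supp_ideal h) (KS :: 'k::field fps ring)"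
proof -
  interpret K: cring "KS :: 'k fps ring" by (rule cring_KS)
  have sub: "supp_ideal h \<subseteq> (carrier KS :: 'k fps set)"
    unfolding carrier_KS by (rule supp_ideal_antimono) simp
  show ?thesis
  proof (rule idealI)
    show "ring (KS :: 'k fps ring)" by (rule K.ring_axioms)
    show "subgroup (supp_ideal h) (add_monoid (KS :: 'k fps ring))"
    proof (rule group.subgroupI)
      show "group (add_monoid (KS :: 'k fps ring))" by (rule K.a_group)
      show "inv\<^bsub>add_monoid KS\<^esub> f \<in> supp_ideal h" if "f \<in> supp_ideal h" for f :: "'k fps"
      proof -
        have "- f \<in> carrier KS" "f \<in> carrier KS" using that sub supp_ideal_uminus by auto
        then have "\<ominus>\<^bsub>KS\<^esub> f = - f" by (intro K.minus_equality) auto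
        then show ?thesis using supp_ideal_uminus[OF that] by (simp add: a_inv_def)
      qed
      show "supp_ideal h \<noteq> ({} :: 'k fps set)" using supp_ideal_zero by blast
    qed (use sub supp_ideal_add in auto)
    show "x \<otimes>\<^bsub>KS\<^esub> a \<in> supp_ideal h" "a \<otimes>\<^bsub>KS\<^esub> x \<in> supp_ideal h"
      if "a \<in> supp_ideal h" "x \<in> carrier KS" for a x :: "'k fps"
      using that supp_ideal_mult[of x 0 a h] supp_ideal_mult[of a h x 0] by (simp_all add: carrier_KS)
  qed
qed

text \<open>Split \<open>f\<close> by residues modulo \<open>g1\<close>; the part in class \<open>i\<close> is a multiple of \<open>t^u\<close> for the least
  \<open>u\<close> of \<open>hM\<close> in that class.\<close>

lemma supp_ideal_minimal:
  assumes I: "ideal I (KS :: 'k::field fps ring)"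
    and gens: "\<And>u. u \<in> multM S h \<Longrightarrow> fps_X ^ u \<in> I"
  shows "supp_ideal h \<subseteq> I"
proof
  interpret I: ideal I "KS :: 'k fps ring" by (rule I)
  fix f :: "'k fps" assume f: "f \<in> supp_ideal h"
  define F where "F i = Abs_fps (\<lambda>n. if n mod g1 = i then fps_nth f n else 0)" for i
  have F_in: "F i \<in> I" for i
  proof (cases "\<exists>u\<in>multM S h. u mod g1 = i")
    case False
    then have "F i = 0" using supp_idealD[OF f] by (intro fps_ext) (auto simp: F_def)
    then show ?thesis using additive_subgroup.zero_closed[OF ideal.axioms(1)[OF I]] by simp
  next
    case True
    define u where "u = (LEAST u. u \<in> multM S h \<and> u mod g1 = i)"
    have u: "u \<in> multM S h" "u mod g1 = i"
      using LeastI_ex[of "\<lambda>u. u \<in> multM S h \<and> u mod g1 = i"] True unfolding u_def by auto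
    have least: "u \<le> n" if "fps_nth (F i) n \<noteq> 0" for n
      unfolding u_def using that supp_idealD[OF f, of n]
      by (intro Least_le) (auto simp: F_def split: if_splits)
    define G where "G = Abs_fps (\<lambda>k. fps_nth (F i) (k + u))"
    have "fps_nth (F i) n = 0" if "n < u" for n using least[of n] that by (meson not_le)
    then have "F i = fps_X ^ u * G"
      by (intro fps_ext) (simp add: fps_X_power_mult_nth G_def)
    \<comment> \<open>Exponents of \<open>G\<close> are differences of congruent numbers modulo
      \<open>g1\<close>, hence multiples of \<open>g1\<close> and thus in \<open>S\<close>.\<close>
    moreover have "G \<in> carrier KS"
      unfolding carrier_KS supp_ideal_def mem_Collect_eq
    proof (intro allI impI)
      fix k assume "fps_nth G k \<noteq> 0"
      then have "(k + u) mod g1 = u mod g1" using u(2) by (auto simp: G_def F_def split: if_splits)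
      then have "g1 dvd k" using mod_eq_dvd_iff_nat[of u "k + u" g1] by simp
      then obtain j where "k = j * g1" by (metis dvdE mult.commute)
      then show "k \<in> multM S 0" using mult_in[OF g1_in] by simp
    qed
    ultimately show ?thesis using I.I_r_closed[OF gens[OF u(1)], of G] by simp
  qed
  have "sum F X \<in> I" if "finite X" for X
    using that
  proof (induction X rule: finite_induct)
    case (insert x X)
    then show ?case using additive_subgroup.a_closed[OF ideal.axioms(1)[OF I] F_in[of x]] by simp
  qed (use additive_subgroup.zero_closed[OF ideal.axioms(1)[OF I]] in simp)
  moreover have "f = sum F {..<g1}"
    using g1_pos by (intro fps_ext) (simp add: fps_sum_nth F_def sum.delta)
  ultimately show "f \<in> I" by (metis finite_lessThan)
qed

lemma fps_X_power_in: "u \<in> multM S h \<Longrightarrow> (fps_X ^ u :: 'k::field fps) \<in> supp_ideal h"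
  by (auto simp: supp_ideal_def fps_X_power_nth)

lemma min_gens_multM: "min_gens S \<subseteq> multM S 1"
proof
  fix x assume "x \<in> min_gens S"
  then have "x \<in> S" "x \<noteq> 0" using gens_subset by auto
  then show "x \<in> multM S 1" using mem_multM_iff ord_pos[of x] by auto
qed

lemma max_ideal_eq: "semigroup_max_ideal S = (supp_ideal 1 :: 'k::field fps set)"
proof -
  interpret K: cring "KS :: 'k fps ring" by (rule cring_KS)
  let ?X = "(\<lambda>g. fps_X ^ g :: 'k fps) ` min_gens S"
  have X: "?X \<subseteq> supp_ideal 1" using fps_X_power_in min_gens_multM by blast
  then have Xc: "?X \<subseteq> carrier KS" using ideal.Icarr[OF ideal_supp_ideal] by blast
  have I: "ideal (semigroup_max_ideal S) (KS :: 'k fps ring)"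
    unfolding semigroup_max_ideal_def by (rule K.genideal_ideal[OF Xc])
  show ?thesis
  proof
    show "semigroup_max_ideal S \<subseteq> (supp_ideal 1 :: 'k fps set)"
      unfolding semigroup_max_ideal_def by (rule K.genideal_minimal[OF ideal_supp_ideal X])
    show "supp_ideal 1 \<subseteq> (semigroup_max_ideal S :: 'k fps set)"
    proof (rule supp_ideal_minimal[OF I])
      fix u assume "u \<in> multM S 1"
      then have "u \<in> S" "1 \<le> ord u" using mem_multM_iff[of u 1] by auto
      then have "u \<noteq> 0" by (cases "u = 0") auto
      with \<open>u \<in> S\<close> obtain a b where ab: "a \<in> min_gens S" "b \<in> S" "u = a + b" using min_gen_summand by blast
      have "fps_X ^ a \<in> (semigroup_max_ideal S :: 'k fps set)"
        unfolding semigroup_max_ideal_def using K.genideal_self[OF Xc] ab(1) by blast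
      moreover have "(fps_X ^ b :: 'k fps) \<in> carrier KS"
        unfolding carrier_KS using fps_X_power_in[of b 0] ab(2) by simp
      ultimately show "fps_X ^ u \<in> (semigroup_max_ideal S :: 'k fps set)"
        using ideal.I_r_closed[OF I] unfolding ab(3) power_add by fastforce
    qed
  qed
qed

text \<open>Supports give one inclusion. For the other, splitting \<open>u = a + b\<close> factors
  the monomial \<open>t^u\<close>, and \<open>supp_ideal_minimal\<close> passes from monomials to
  all series.\<close>

lemma ideal_pow_eq: "ideal_pow KS (semigroup_max_ideal S) h = (supp_ideal h :: 'k::field fps set)"
proof (induction h)
  case 0
  then show ?case by (simp add: carrier_KS)
next
  case (Suc h)
  interpret K: cring "KS :: 'k fps ring" by (rule cring_KS)
  let ?P = "ideal_prod KS (supp_ideal h) (supp_ideal 1) :: 'k fps set"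
  have I: "ideal ?P KS" by (rule K.ideal_prod_is_ideal[OF ideal_supp_ideal ideal_supp_ideal])
  have "?P = supp_ideal (Suc h)"
  proof
    show "?P \<subseteq> supp_ideal (Suc h)"
    proof
      fix f assume "f \<in> ?P"
      then show "f \<in> supp_ideal (Suc h)"
      proof induction
        case (prod i j)
        then show ?case using supp_ideal_mult[of i h j 1] by simp
      next
        case (sum s1 s2)
        then show ?case using supp_ideal_add by simp
      qed
    qed
    show "supp_ideal (Suc h) \<subseteq> ?P"
    proof (rule supp_ideal_minimal[OF I])
      fix u assume "u \<in> multM S (Suc h)"
      then obtain a b where ab: "a \<in> multM S h" "b \<in> S" "b \<noteq> 0" "u = a + b" by (rule multM_SucE)
      then have "b \<in> multM S 1" using mem_multM_iff ord_pos[of b] by auto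
      then have "fps_X ^ a \<otimes>\<^bsub>KS\<^esub> fps_X ^ b \<in> ?P"
        by (intro ideal_prod.prod fps_X_power_in ab(1))
      then show "fps_X ^ u \<in> ?P" using ab(4) by (simp add: power_add)
    qed
  qed
  then show ?case unfolding ideal_pow.simps Suc unfolding max_ideal_eq .
qed

text \<open>The coset of \<open>f\<close> modulo \<open>supp_ideal h\<close>, expressed by the
  coefficients that survive in the quotient.\<close>

definition agree :: "nat \<Rightarrow> 'k::field fps \<Rightarrow> 'k fps set" where
  "agree h f = {f'. \<forall>n. n \<notin> multM S h \<longrightarrow> fps_nth f' n = fps_nth f n}"

lemma agree_iff: "f' \<in> agree h f \<longleftrightarrow> f' - f \<in> supp_ideal h"
  unfolding agree_def supp_ideal_def by auto

lemma agree_self: "f \<in> agree h f"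
  by (simp add: agree_def)

lemma agree_eq_iff: "agree h f = agree h g \<longleftrightarrow> (\<forall>n. n \<notin> multM S h \<longrightarrow> fps_nth f n = fps_nth g n)"
proof
  assume "agree h f = agree h g"
  then have "f \<in> agree h g" using agree_self by blast
  then show "\<forall>n. n \<notin> multM S h \<longrightarrow> fps_nth f n = fps_nth g n" by (simp add: agree_def)
qed (auto simp: agree_def)

lemma agree_zero: "agree h 0 = supp_ideal h"
  unfolding agree_def supp_ideal_def by auto

lemma coset_eq: "supp_ideal h +>\<^bsub>KS\<^esub> f = agree h f"
proof -
  have "supp_ideal h +>\<^bsub>KS\<^esub> f = {i + f | i. i \<in> supp_ideal h}"
    unfolding a_r_coset_def r_coset_def by auto
  also have "\<dots> = agree h f"
  proof (intro equalityI subsetI)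
    fix x assume "x \<in> agree h f"
    then have "x - f \<in> supp_ideal h" by (simp add: agree_iff)
    moreover have "x = (x - f) + f" by simp
    ultimately show "x \<in> {i + f | i. i \<in> supp_ideal h}" by blast
  qed (auto simp: agree_iff)
  finally show ?thesis .
qed

lemma agree_add:
  assumes "f \<in> carrier KS" "g \<in> carrier KS"
  shows "agree h f <+>\<^bsub>KS\<^esub> agree h g = agree h (f + g)"
  using ideal.a_rcos_sum[OF ideal_supp_ideal assms, of h]
  by (simp add: coset_eq)

end

section \<open>The isomorphism with the associated graded ring\<close>

context num_semigroup
begin

abbreviation "GG \<equiv> assoc_graded KS (semigroup_max_ideal S)"

lemma carrier_GG:
  "F \<in> carrier GG \<longleftrightarrow> (\<forall>i. F i \<in> agree (Suc i) ` supp_ideal i) \<and> finite {i. F i \<noteq> supp_ideal (Suc i)}"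
  unfolding assoc_graded_def ideal_pow_eq coset_eq by simp

lemma zero_GG: "\<zero>\<^bsub>GG\<^esub> = (\<lambda>n. supp_ideal (Suc n))"
  unfolding assoc_graded_def ideal_pow_eq by simp

lemma one_GG: "\<one>\<^bsub>GG\<^esub> = (\<lambda>n. if n = 0 then agree 1 1 else supp_ideal (Suc n))"
  unfolding assoc_graded_def ideal_pow_eq coset_eq KS_simps by simp

lemma add_GG: "F \<oplus>\<^bsub>GG\<^esub> F' = (\<lambda>n. F n <+>\<^bsub>KS\<^esub> F' n)"
  unfolding assoc_graded_def by simp

lemma mult_GG: "F \<otimes>\<^bsub>GG\<^esub> F' = (\<lambda>n. finsum (KS Quot supp_ideal (Suc n))
    (\<lambda>i. rcoset_mult KS (supp_ideal (Suc n)) (F i) (F' (n - i))) {..n})"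
  unfolding assoc_graded_def ideal_pow_eq by simp

lemma agree_eq_iff_diff: "agree h f = agree h g \<longleftrightarrow> f - g \<in> supp_ideal h"
  unfolding agree_eq_iff supp_ideal_def by auto

lemma supp_ideal_subset_carrier: "f \<in> supp_ideal h \<Longrightarrow> f \<in> carrier KS"
  unfolding carrier_KS using supp_ideal_antimono[of 0 h] by auto

text \<open>The factors are cosets of other ideals than the one given to \<open>rcoset_mult\<close>.
  The product is still well defined modulo level \<open>Suc n\<close>: in
  \<open>(a' - a) * b' + a * (b' - b)\<close> the levels add up to \<open>Suc i + (n - i)\<close>
  and \<open>i + Suc (n - i)\<close>.\<close>

lemma rcoset_mult_agree:
  assumes a: "a \<in> supp_ideal i" and b: "b \<in> supp_ideal (n - i)" and i: "i \<le> n"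
  shows "rcoset_mult KS (supp_ideal (Suc n)) (agree (Suc i) a) (agree (Suc (n - i)) b) = agree (Suc n) (a * b)"
proof -
  have const: "agree (Suc n) (a' * b') = agree (Suc n) (a * b)"
    if a': "a' \<in> agree (Suc i) a" and b': "b' \<in> agree (Suc (n - i)) b" for a' b'
  proof -
    have da: "a' - a \<in> supp_ideal (Suc i)" and db: "b' - b \<in> supp_ideal (Suc (n - i))"
      using a' b' by (auto simp: agree_iff)
    have "b' = b + (b' - b)" by simp
    then have "b' \<in> supp_ideal (n - i)"
      using supp_ideal_add[OF b] db supp_ideal_antimono[of "n - i" "Suc (n - i)"] by (metis le_add2 plus_1_eq_Suc subsetD)
    then have "(a' - a) * b' \<in> supp_ideal (Suc n)"
      using supp_ideal_mult[OF da, of b' "n - i"] i by simp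
    moreover have "a * (b' - b) \<in> supp_ideal (Suc n)"
      using supp_ideal_mult[OF a db] i by simp
    moreover have "a' * b' - a * b = (a' - a) * b' + a * (b' - b)" by (simp add: algebra_simps)
    ultimately show ?thesis unfolding agree_eq_iff_diff using supp_ideal_add by metis
  qed
  have "rcoset_mult KS (supp_ideal (Suc n)) (agree (Suc i) a) (agree (Suc (n - i)) b)
      = (\<Union>a'\<in>agree (Suc i) a. \<Union>b'\<in>agree (Suc (n - i)) b. agree (Suc n) (a' * b'))"
    unfolding rcoset_mult_def coset_eq KS_simps ..
  also have "\<dots> = (\<Union>a'\<in>agree (Suc i) a. \<Union>b'\<in>agree (Suc (n - i)) b. agree (Suc n) (a * b))"
    using const by (intro SUP_cong refl)
  also have "\<dots> = agree (Suc n) (a * b)"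
    using agree_self[of a "Suc i"] agree_self[of b "Suc (n - i)"] by auto
  finally show ?thesis .
qed

lemma agree_in_Quot: "f \<in> carrier KS \<Longrightarrow> agree h f \<in> carrier (KS Quot supp_ideal h)"
  unfolding FactRing_def A_RCOSETS_def' by (auto simp: coset_eq)

lemma finsum_agree:
  assumes "finite X" "\<And>x. x \<in> X \<Longrightarrow> c x \<in> carrier KS"
  shows "finsum (KS Quot supp_ideal h) (\<lambda>x. agree h (c x)) X = agree h (sum c X)"
proof -
  interpret Q: ring "KS Quot supp_ideal h" by (rule ideal.quotient_is_ring[OF ideal_supp_ideal])
  have zero: "\<zero>\<^bsub>KS Quot supp_ideal h\<^esub> = supp_ideal h" by (simp add: FactRing_def)
  have add: "A \<oplus>\<^bsub>KS Quot supp_ideal h\<^esub> B = A <+>\<^bsub>KS\<^esub> B" for A B by (simp add: FactRing_def)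
  show ?thesis using assms
  proof (induction X rule: finite_induct)
    case empty
    then show ?case by (simp add: zero agree_zero)
  next
    case (insert x X)
    have "sum c X \<in> carrier KS"
      unfolding carrier_KS using insert.prems by (intro supp_ideal_sum) (auto simp: carrier_KS)
    then show ?case
      using insert agree_in_Quot by (subst Q.finsum_insert) (auto simp: add agree_add)
  qed
qed

definition part :: "nat \<Rightarrow> 'k::field poly \<Rightarrow> 'k fps" where
  "part n a = Abs_fps (\<lambda>s. if s \<in> S \<and> ord s = n then coeff a s else 0)"

lemma part_nth: "fps_nth (part n a) s = (if s \<in> S \<and> ord s = n then coeff a s else 0)"
  by (simp add: part_def)

lemma part_in: "part n a \<in> supp_ideal n"
  by (auto simp: supp_ideal_def part_nth mem_multM_iff split: if_splits)

lemma part_add: "part n (a + b) = part n a + part n b"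
  by (rule fps_ext) (simp add: part_nth)

text \<open>Sends \<open>e s\<close> to the initial form of \<open>t^s\<close>, which sits in degree
  \<open>ord s\<close>.\<close>

definition psi :: "'k::field poly \<Rightarrow> nat \<Rightarrow> 'k fps set" where
  "psi a n = agree (Suc n) (part n a)"

lemma psi_eq_zero_iff: "psi a n = supp_ideal (Suc n) \<longleftrightarrow> (\<forall>s\<in>S. ord s = n \<longrightarrow> coeff a s = 0)"
proof -
  have "psi a n = supp_ideal (Suc n) \<longleftrightarrow> (\<forall>s. s \<notin> multM S (Suc n) \<longrightarrow> fps_nth (part n a) s = fps_nth 0 s)"
    unfolding psi_def agree_zero[symmetric] agree_eq_iff ..
  also have "\<dots> \<longleftrightarrow> (\<forall>s\<in>S. ord s = n \<longrightarrow> coeff a s = 0)"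
    by (auto simp: part_nth mem_multM_iff)
  finally show ?thesis .
qed

lemma psi_closed: "psi a \<in> carrier GG"
  unfolding carrier_GG
proof
  show "\<forall>i. psi a i \<in> agree (Suc i) ` supp_ideal i" using part_in by (auto simp: psi_def)
  have "{i. psi a i \<noteq> supp_ideal (Suc i)} \<subseteq> ord ` {s. coeff a s \<noteq> 0}"
    by (auto simp: psi_eq_zero_iff)
  moreover have "finite {s. coeff a s \<noteq> 0}"
    by (rule finite_subset[of _ "{..degree a}"]) (auto intro: le_degree)
  ultimately show "finite {i. psi a i \<noteq> supp_ideal (Suc i)}" by (meson finite_imageI finite_subset)
qed

lemma psi_add: "psi (a + b) = psi a \<oplus>\<^bsub>GG\<^esub> psi b"
  unfolding add_GG
  by (rule ext) (simp add: psi_def part_add agree_add supp_ideal_subset_carrier[OF part_in])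

lemma psi_zero: "psi 0 = \<zero>\<^bsub>GG\<^esub>"
  unfolding zero_GG by (rule ext) (simp add: psi_eq_zero_iff)

lemma psi_one: "psi (1 :: 'k::field poly) = \<one>\<^bsub>GG\<^esub>"
  unfolding one_GG
proof (rule ext)
  fix n
  show "psi (1 :: 'k poly) n = (if n = 0 then agree 1 1 else supp_ideal (Suc n))"
  proof (cases "n = 0")
    case True
    have "part 0 (1 :: 'k poly) = 1"
      using zero_in ord_eq_0_iff by (intro fps_ext) (auto simp: part_nth coeff_1)
    then show ?thesis using True by (simp add: psi_def)
  next
    case False
    then have "coeff (1 :: 'k poly) s = 0" if "ord s = n" for s
      using that by (cases "s = 0") (auto simp: coeff_1)
    then have "psi (1 :: 'k poly) n = supp_ideal (Suc n)" unfolding psi_eq_zero_iff by blast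
    then show ?thesis using False by simp
  qed
qed

text \<open>The power series product also contains terms whose order jumps above \<open>n\<close>;
  their exponents lie in \<open>multM S (Suc n)\<close>, which \<open>k\<close> avoids.\<close>

lemma part_gmult:
  assumes a: "a \<in> carrier graded_model" and b: "b \<in> carrier graded_model"
    and k: "k \<notin> multM S (Suc n)"
  shows "fps_nth (\<Sum>i\<le>n. part i a * part (n - i) b) k = fps_nth (part n (gmult a b)) k"
proof -
  define T where "T j = (if ord j + ord (k - j) = n then coeff a j * coeff b (k - j) else 0)" for j
  have "fps_nth (\<Sum>i\<le>n. part i a * part (n - i) b) k
      = (\<Sum>i\<le>n. \<Sum>j\<le>k. fps_nth (part i a) j * fps_nth (part (n - i) b) (k - j))"
    by (simp add: fps_sum_nth fps_mult_nth atLeast0AtMost)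
  also have "\<dots> = (\<Sum>j\<le>k. \<Sum>i\<le>n. fps_nth (part i a) j * fps_nth (part (n - i) b) (k - j))"
    by (rule sum.swap)
  also have "\<dots> = (\<Sum>j\<le>k. T j)"
  proof (rule sum.cong[OF refl])
    fix j
    show "(\<Sum>i\<le>n. fps_nth (part i a) j * fps_nth (part (n - i) b) (k - j)) = T j"
    proof (cases "coeff a j * coeff b (k - j) = 0")
      case True
      then have "fps_nth (part i a) j * fps_nth (part (n - i) b) (k - j) = 0" for i
        by (auto simp: part_nth)
      then have "(\<Sum>i\<le>n. fps_nth (part i a) j * fps_nth (part (n - i) b) (k - j)) = 0" by (intro sum.neutral ballI)
      then show ?thesis using True by (auto simp: T_def)
    next
      case False
      then have S: "j \<in> S" "k - j \<in> S" using graded_modelD[OF a] graded_modelD[OF b] by auto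
      \<comment> \<open>For fixed \<open>j\<close> only the degree \<open>i = ord j\<close>
        contributes.\<close>
      then have "fps_nth (part i a) j * fps_nth (part (n - i) b) (k - j)
          = (if i = ord j then (if ord (k - j) = n - ord j then coeff a j * coeff b (k - j) else 0) else 0)" for i
        by (auto simp: part_nth)
      then have "(\<Sum>i\<le>n. fps_nth (part i a) j * fps_nth (part (n - i) b) (k - j))
          = (if ord j \<le> n then (if ord (k - j) = n - ord j then coeff a j * coeff b (k - j) else 0) else 0)"
        by simp
      also have "\<dots> = T j" unfolding T_def by auto
      finally show ?thesis .
    qed
  qed
  also have "\<dots> = fps_nth (part n (gmult a b)) k"
  proof (cases "k \<in> S \<and> ord k = n")
    case True
    then show ?thesis by (auto simp: part_nth coeff_gmult T_def)
  next
    case False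
    \<comment> \<open>A nonzero term would put \<open>k\<close> into \<open>S\<close> with order at
      least \<open>n\<close>; as \<open>k\<close> avoids the next level, its order would be exactly
      \<open>n\<close>.\<close>
    have "T j = 0" if j: "j \<le> k" for j
    proof (rule ccontr)
      assume T: "T j \<noteq> 0"
      then have "coeff a j \<noteq> 0" "coeff b (k - j) \<noteq> 0" and o: "ord j + ord (k - j) = n"
        by (auto simp: T_def split: if_splits)
      then have S: "j \<in> S" "k - j \<in> S" using graded_modelD[OF a] graded_modelD[OF b] by auto
      then have "k \<in> S" "n \<le> ord k" using add_in[OF S] ord_add[OF S] o j by auto
      then show False using False k by (auto simp: mem_multM_iff)
    qed
    then show ?thesis using False by (auto simp: part_nth intro!: sum.neutral)
  qed
  finally show ?thesis .
qed

lemma psi_mult: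
  assumes a: "a \<in> carrier graded_model" and b: "b \<in> carrier graded_model"
  shows "psi (gmult a b) = psi a \<otimes>\<^bsub>GG\<^esub> psi b"
proof (rule ext)
  fix n
  interpret Q: ring "KS Quot supp_ideal (Suc n) :: 'a fps set ring"
    by (rule ideal.quotient_is_ring[OF ideal_supp_ideal])
  have "(psi a \<otimes>\<^bsub>GG\<^esub> psi b) n = finsum (KS Quot supp_ideal (Suc n))
      (\<lambda>i. rcoset_mult KS (supp_ideal (Suc n)) (psi a i) (psi b (n - i))) {..n}"
    unfolding mult_GG ..
  also have "\<dots> = finsum (KS Quot supp_ideal (Suc n)) (\<lambda>i. agree (Suc n) (part i a * part (n - i) b)) {..n}"
  proof (rule Q.finsum_cong'[OF refl])
    show "(\<lambda>i. agree (Suc n) (part i a * part (n - i) b)) \<in> {..n} \<rightarrow> carrier (KS Quot supp_ideal (Suc n))"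
      using agree_in_Quot supp_ideal_subset_carrier[OF supp_ideal_mult[OF part_in part_in]] by blast
  next
    fix i assume "i \<in> {..n}"
    then show "rcoset_mult KS (supp_ideal (Suc n)) (psi a i) (psi b (n - i))
        = agree (Suc n) (part i a * part (n - i) b)"
      unfolding psi_def by (intro rcoset_mult_agree part_in) auto
  qed
  also have "\<dots> = agree (Suc n) (\<Sum>i\<le>n. part i a * part (n - i) b)"
    by (rule finsum_agree) (use supp_ideal_subset_carrier[OF supp_ideal_mult[OF part_in part_in]] in auto)
  also have "\<dots> = psi (gmult a b) n"
    unfolding psi_def agree_eq_iff using part_gmult[OF a b] by blast
  finally show "psi (gmult a b) n = (psi a \<otimes>\<^bsub>GG\<^esub> psi b) n" ..
qed

lemma psi_inj:
  assumes a: "a \<in> carrier graded_model" and b: "b \<in> carrier graded_model" and eq: "psi a = psi b"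
  shows "a = b"
proof (rule poly_eqI)
  fix s
  show "coeff a s = coeff b s"
  proof (cases "s \<in> S")
    case True
    have "agree (Suc (ord s)) (part (ord s) a) = agree (Suc (ord s)) (part (ord s) b)"
      using fun_cong[OF eq, of "ord s"] by (simp add: psi_def)
    then have "fps_nth (part (ord s) a) s = fps_nth (part (ord s) b) s"
      unfolding agree_eq_iff using True by (simp add: mem_multM_iff)
    then show ?thesis using True by (simp add: part_nth)
  next
    case False
    then show ?thesis using a b graded_modelD by metis
  qed
qed

lemma psi_surj:
  assumes F: "F \<in> carrier GG"
  obtains a where "a \<in> carrier graded_model" "F = psi a"
proof -
  have "\<forall>i. \<exists>r. r \<in> supp_ideal i \<and> F i = agree (Suc i) r" using F unfolding carrier_GG by blast
  then obtain r where r: "\<And>i. r i \<in> supp_ideal i" "\<And>i. F i = agree (Suc i) (r i)" by metis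
  let ?D = "{i. F i \<noteq> supp_ideal (Suc i)}"
  have finD: "finite ?D" using F unfolding carrier_GG by blast
  \<comment> \<open>The coefficient of \<open>e s\<close> is read off in degree
    \<open>ord s\<close>. Only finitely many degrees are nonzero, and each order is attained
    finitely often.\<close>
  define f where "f s = (if s \<in> S then fps_nth (r (ord s)) s else 0)" for s
  have f_zero: "f s = 0" if "s \<in> S" "ord s \<notin> ?D" for s
  proof -
    have "F (ord s) = supp_ideal (Suc (ord s))" using that(2) by blast
    then have "agree (Suc (ord s)) (r (ord s)) = agree (Suc (ord s)) 0" unfolding r(2) agree_zero .
    then show ?thesis unfolding agree_eq_iff using that by (simp add: f_def mem_multM_iff)
  qed
  obtain h where h: "\<And>i. i \<in> ?D \<Longrightarrow> i \<le> h" using finD finite_nat_set_iff_bounded_le by auto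
  have "{s. f s \<noteq> 0} \<subseteq> {s \<in> S. ord s \<le> h}"
    using f_zero h unfolding f_def by (auto split: if_splits)
  then have fin: "finite {s. f s \<noteq> 0}" using finite_ord_le finite_subset by blast
  then obtain N where "\<And>s. f s \<noteq> 0 \<Longrightarrow> s \<le> N" using finite_nat_set_iff_bounded_le by auto
  then have N: "f s = 0" if "s > N" for s using that by (meson not_le)
  define a where "a = Abs_poly f"
  have ca: "coeff a s = f s" for s unfolding a_def by (subst coeff_Abs_poly[OF N]) auto
  have "a \<in> carrier graded_model" unfolding in_graded_model_iff ca by (auto simp: f_def)
  moreover have "F = psi a"
  proof (rule ext)
    fix n
    show "F n = psi a n"
      unfolding r(2) psi_def agree_eq_iff
    proof (intro allI impI)
      fix s assume s: "s \<notin> multM S (Suc n)"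
      show "fps_nth (r n) s = fps_nth (part n a) s"
      proof (cases "s \<in> multM S n")
        case True
        then have "s \<in> S" "ord s = n" using s by (auto simp: mem_multM_iff)
        then show ?thesis by (simp add: part_nth ca f_def)
      next
        case False
        then show ?thesis using supp_idealD0[OF r(1) False] supp_idealD0[OF part_in False] by simp
      qed
    qed
  qed
  ultimately show thesis by (rule that)
qed

lemma psi_iso: "psi \<in> ring_iso (graded_model :: 'k::field poly ring) GG"
proof (rule ring_iso_memI; (unfold graded_model_simps)?)
  show "bij_betw psi (carrier graded_model) (carrier (GG :: (nat \<Rightarrow> 'k fps set) ring))"
    unfolding bij_betw_def
  proof
    show "inj_on psi (carrier (graded_model :: 'k poly ring))" using psi_inj by (auto simp: inj_on_def)
    show "psi ` carrier (graded_model :: 'k poly ring) = carrier GG"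
      using psi_closed psi_surj by blast
  qed
qed (simp_all add: psi_closed psi_mult psi_add psi_one)

end

section \<open>Transfer to the associated graded ring\<close>

text \<open>This also yields the ring axioms of the associated graded ring, which are nowhere
  checked on cosets.\<close>

lemma (in polynomial_algebra) transfer_ring_iso:
  fixes T :: "'c ring"
  assumes h: "h \<in> ring_iso R T" and zero: "h \<zero> = \<zero>\<^bsub>T\<^esub>"
  shows "polynomial_algebra T (\<lambda>p. h (\<phi> p))"
proof -
  \<comment> \<open>Ring isomorphisms are defined without reference to zero, so
    \<open>ring_iso_imp_img_cring\<close> replaces the zero of the target by the image of
    zero.\<close>
  have "T\<lparr>zero := h \<zero>\<rparr> = T" unfolding zero by simp
  then have T: "cring T" using ring_iso_imp_img_cring[OF h] by simp
  have hom: "h \<in> ring_hom R T" and bij: "bij_betw h (carrier R) (carrier T)"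
    using h by (auto simp: ring_iso_def)
  have surj: "\<exists>a\<in>carrier R. b = h a" if "b \<in> carrier T" for b
    using bij that unfolding bij_betw_def by blast
  have inj: "a = b" if "a \<in> carrier R" "b \<in> carrier R" "h a = h b" for a b
    using bij that unfolding bij_betw_def inj_on_def by blast
  interpret T: cring T by (rule T)
  interpret H: ring_hom_cring R T h
    by (intro ring_hom_cring.intro ring_hom_cring_axioms.intro is_cring T hom)
  show ?thesis
  proof (intro polynomial_algebra.intro polynomial_algebra_axioms.intro T)
    fix b assume "b \<in> carrier T"
    then obtain a where a: "a \<in> carrier R" "b = h a" using surj by blast
    obtain p n where pn: "(a \<ominus> \<phi> p) [^] (n::nat) = \<zero>" using nilpotent[OF a(1)] by blast
    have "(b \<ominus>\<^bsub>T\<^esub> h (\<phi> p)) [^]\<^bsub>T\<^esub> n = h ((a \<ominus> \<phi> p) [^] n)"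
      using a(1) by (simp add: a(2) a_minus_def H.ring.hom_nat_pow)
    then show "\<exists>p (n::nat). (b \<ominus>\<^bsub>T\<^esub> h (\<phi> p)) [^]\<^bsub>T\<^esub> n = \<zero>\<^bsub>T\<^esub>" using pn by auto
  next
    fix p :: "'k poly" and b
    assume p: "p \<noteq> 0" and b: "b \<in> carrier T" "h (\<phi> p) \<otimes>\<^bsub>T\<^esub> b = \<zero>\<^bsub>T\<^esub>"
    obtain a where a: "a \<in> carrier R" "b = h a" using surj b by blast
    have "h (\<phi> p \<otimes> a) = h \<zero>" using b(2) a by simp
    then have "\<phi> p \<otimes> a = \<zero>" using inj a(1) by simp
    then show "b = \<zero>\<^bsub>T\<^esub>" using phi_regular[OF p a(1)] a(2) by simp
  next
    obtain e :: "nat \<Rightarrow> 'a" and n where e: "\<And>i. e i \<in> carrier R"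
      and gen: "\<And>a. a \<in> carrier R \<Longrightarrow> \<exists>p. a = (\<Oplus>i\<in>{..<n}. \<phi> (p i) \<otimes> e i)"
      using fin_gen by blast
    have "\<exists>p. b = (\<Oplus>\<^bsub>T\<^esub>i\<in>{..<n}. h (\<phi> (p i)) \<otimes>\<^bsub>T\<^esub> h (e i))" if b: "b \<in> carrier T" for b
    proof -
      obtain a where a: "a \<in> carrier R" "b = h a" using surj[OF b] by blast
      obtain p where p: "a = (\<Oplus>i\<in>{..<n}. \<phi> (p i) \<otimes> e i)" using gen[OF a(1)] by blast
      have "b = (\<Oplus>\<^bsub>T\<^esub>i\<in>{..<n}. (h \<circ> (\<lambda>i. \<phi> (p i) \<otimes> e i)) i)"
        unfolding a(2) p using e by (subst H.hom_finsum) (auto simp: comp_def)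
      also have "\<dots> = (\<Oplus>\<^bsub>T\<^esub>i\<in>{..<n}. h (\<phi> (p i)) \<otimes>\<^bsub>T\<^esub> h (e i))"
        by (rule T.finsum_cong') (use e in auto)
      finally show ?thesis by blast
    qed
    then show "\<exists>(e :: nat \<Rightarrow> 'c) n. (\<forall>i. e i \<in> carrier T) \<and>
        (\<forall>b\<in>carrier T. \<exists>p. b = (\<Oplus>\<^bsub>T\<^esub>i\<in>{..<n}. h (\<phi> (p i)) \<otimes>\<^bsub>T\<^esub> e i))"
      using e by (intro exI[of _ "\<lambda>i. h (e i)"] exI[of _ n]) auto
  qed (simp_all add: phi_add phi_mult phi_one)
qed

context num_semigroup
begin

abbreviation "JJ \<equiv> graded_irrelevant KS (semigroup_max_ideal S)"

lemma psi_in_irrelevant_iff: "psi a \<in> JJ \<longleftrightarrow> coeff a 0 = 0"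
proof -
  have "psi a \<in> JJ \<longleftrightarrow> psi a 0 = supp_ideal (Suc 0)"
    unfolding graded_irrelevant_def zero_GG using psi_closed by blast
  also have "\<dots> \<longleftrightarrow> coeff a 0 = 0"
    unfolding psi_eq_zero_iff using ord_eq_0_iff zero_in by auto
  finally show ?thesis .
qed

text \<open>Each factor from the irrelevant ideal has no constant term, so it raises every order by
  at least 1.\<close>

lemma irrelevant_pow_subset:
  assumes "F \<in> ideal_pow GG JJ k"
  shows "\<exists>a\<in>carrier graded_model. F = psi a \<and> (\<forall>n. coeff a n \<noteq> 0 \<longrightarrow> k \<le> ord n)"
  using assms
proof (induction k arbitrary: F)
  case 0
  then show ?case using psi_surj[of F] by auto
next
  case (Suc k)
  from Suc.prems have "F \<in> ideal_prod GG (ideal_pow GG JJ k) JJ" by simp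
  then show ?case
  proof induction
    case (prod F G)
    obtain a where a: "a \<in> carrier graded_model" "F = psi a" "\<And>n. coeff a n \<noteq> 0 \<Longrightarrow> k \<le> ord n"
      using Suc.IH[OF prod(1)] by blast
    have "G \<in> carrier GG" using prod(2) by (simp add: graded_irrelevant_def)
    then obtain b where b: "b \<in> carrier graded_model" "G = psi b" by (rule psi_surj)
    have b0: "coeff b 0 = 0" using prod(2) psi_in_irrelevant_iff b by blast
    have "Suc k \<le> ord n" if nz: "coeff (gmult a b) n \<noteq> 0" for n
    proof -
      obtain i where i: "ord i + ord (n - i) = ord n" "coeff a i \<noteq> 0" "coeff b (n - i) \<noteq> 0"
        using gmult_term_nonzero[OF nz] by blast
      then have "n - i \<in> S" "n - i \<noteq> 0" using graded_modelD[OF b(1)] b0 by metis+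
      then show ?thesis using ord_pos[of "n - i"] a(3)[OF i(2)] i(1) by linarith
    qed
    moreover have "F \<otimes>\<^bsub>GG\<^esub> G = psi (gmult a b)" unfolding a(2) b(2) psi_mult[OF a(1) b(1)] ..
    ultimately show ?case by (intro bexI[OF _ gmult_closed[OF a(1) b(1)]] conjI allI impI)
  next
    case (sum F G)
    obtain a where a: "a \<in> carrier graded_model" "F = psi a" "\<And>n. coeff a n \<noteq> 0 \<Longrightarrow> Suc k \<le> ord n"
      using sum.IH(1) by blast
    obtain b where b: "b \<in> carrier graded_model" "G = psi b" "\<And>n. coeff b n \<noteq> 0 \<Longrightarrow> Suc k \<le> ord n"
      using sum.IH(2) by blast
    have "coeff a n \<noteq> 0 \<or> coeff b n \<noteq> 0" if "coeff (a + b) n \<noteq> 0" for n using that by auto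
    then have "a + b \<in> carrier graded_model" "\<forall>n. coeff (a + b) n \<noteq> 0 \<longrightarrow> Suc k \<le> ord n"
      using a(1,3) b(1,3) unfolding in_graded_model_iff by blast+
    moreover have "F \<oplus>\<^bsub>GG\<^esub> G = psi (a + b)" unfolding a(2) b(2) psi_add ..
    ultimately show ?case by blast
  qed
qed

text \<open>The assumption on \<open>j\<close> says that \<open>x^j\<close> kills
  \<open>e s\<close>. Basis elements of high order are multiples of \<open>x^j\<close>, so
  \<open>e s\<close> lies in the local cohomology, and Buchsbaumness makes every \<open>e u\<close>
  with \<open>u\<close> nonzero kill it.\<close>

lemma buchsbaum_ord:
  assumes B: "buchsbaum (GG :: (nat \<Rightarrow> 'k::field fps set) ring) JJ"
    and s: "s \<in> S" and j: "ord (s + j * g1) \<noteq> ord s + j" and u: "u \<in> S" "u \<noteq> 0"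
  shows "ord (s + u) \<noteq> ord s + ord u"
proof -
  let ?s = "monom 1 s :: 'k poly" and ?u = "monom 1 u :: 'k poly"
  obtain k where k: "\<And>x. x \<in> S \<Longrightarrow> k \<le> ord x \<Longrightarrow> \<exists>v\<in>S. x = v + j * g1 \<and> ord x = ord v + j"
    using reduction_number_iterate by blast
  \<comment> \<open>The power is \<open>Suc k\<close>, since \<open>local_cohomology_0\<close>
    ranges over positive exponents.\<close>
  have "psi ?s \<otimes>\<^bsub>GG\<^esub> F = \<zero>\<^bsub>GG\<^esub>" if F: "F \<in> ideal_pow GG JJ (Suc k)" for F :: "nat \<Rightarrow> 'k fps set"
  proof -
    obtain a where a: "a \<in> carrier graded_model" "F = psi a" "\<And>n. coeff a n \<noteq> 0 \<Longrightarrow> Suc k \<le> ord n"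
      using irrelevant_pow_subset[OF F] by blast
    have "coeff (gmult a ?s) n = 0" for n
    proof (rule ccontr)
      assume "coeff (gmult a ?s) n \<noteq> 0"
      then have n: "s \<le> n" "ord (n - s) + ord s = ord n" "coeff a (n - s) \<noteq> 0"
        by (auto simp: coeff_gmult_monom split: if_splits)
      then obtain v where v: "v \<in> S" "n - s = v + j * g1" "ord (n - s) = ord v + j"
        using k[of "n - s"] graded_modelD[OF a(1)] a(3) Suc_leD by blast
      \<comment> \<open>Regrouping \<open>n\<close> as \<open>(s + j * g1) + v\<close> shows that
        its order exceeds \<open>ord s + j + ord v\<close>, the value required by
        \<open>n(2)\<close>.\<close>
      have "s + j * g1 \<in> S" using add_in[OF s mult_in[OF g1_in]] .
      then have "ord (s + j * g1) + ord v \<le> ord (s + j * g1 + v)" using v(1) by (rule ord_add)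
      moreover have "s + j * g1 + v = n" using n(1) v(2) by simp
      moreover have "ord s + j < ord (s + j * g1)" using j ord_add_mult_g1[OF s, of j] by simp
      ultimately show False using n(2) v(3) by simp
    qed
    then have "gmult ?s a = 0" unfolding gmult_comm[of ?s] by (intro poly_eqI) simp
    then show ?thesis using psi_mult[OF monom_closed[OF s, of 1] a(1)] a(2) psi_zero by metis
  qed
  then have "psi ?s \<in> annihilator_in GG (ideal_pow GG JJ (Suc k))"
    unfolding annihilator_in_def using psi_closed by blast
  then have "psi ?s \<in> local_cohomology_0 GG JJ"
    unfolding local_cohomology_0_def by (intro UN_I[of "Suc k"]) auto
  moreover have "psi ?u \<in> JJ" unfolding psi_in_irrelevant_iff using u(2) by simp
  ultimately have "psi ?u \<otimes>\<^bsub>GG\<^esub> psi ?s \<in> ideal_prod GG JJ (local_cohomology_0 GG JJ)"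
    by (intro ideal_prod.prod)
  then have "psi ?u \<otimes>\<^bsub>GG\<^esub> psi ?s = \<zero>\<^bsub>GG\<^esub>"
    using B unfolding buchsbaum_def by blast
  then have "psi (gmult ?u ?s) = psi 0"
    unfolding psi_zero psi_mult[OF monom_closed[OF u(1)] monom_closed[OF s]] .
  then have "gmult ?u ?s = 0"
    by (rule psi_inj[OF gmult_closed[OF monom_closed[OF u(1)] monom_closed[OF s]], rotated])
      (simp add: in_graded_model_iff)
  then have "coeff (gmult ?u ?s) (u + s) = 0" by simp
  then show ?thesis by (auto simp: coeff_gmult_monom add.commute split: if_splits)
qed

end

theorem proposition5p5:
  fixes S :: "nat set"
    and R :: "'k::field fps ring"
    and m :: "'k fps set"
  assumes K_infinite: "infinite (UNIV :: 'k set)"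
    and semigroup: "numerical_semigroup S"
    and pure: "M_pure S"
    and sym: "symmetric_sg S"
    and R_eq: "R = semigroup_ring S"
    and m_eq: "m = semigroup_max_ideal S"
    and buchs: "buchsbaum (assoc_graded R m) (graded_irrelevant R m)"
  shows "cohen_macaulay (assoc_graded R m)"
proof -
  interpret pure_symmetric_semigroup S
    using semigroup pure sym
    by (intro pure_symmetric_semigroup.intro num_semigroup.intro pure_symmetric_semigroup_axioms.intro)
  have "ord (s + g1) = ord s + 1" if "s \<in> S" for s
    using ord_add_g1[OF buchsbaum_ord[OF buchs[unfolded R_eq m_eq]] that] .
  then interpret A: polynomial_algebra "graded_model :: 'k poly ring" scale
    by (rule polynomial_algebra_graded_model)
  have "psi \<zero>\<^bsub>graded_model\<^esub> = \<zero>\<^bsub>GG\<^esub>" using psi_zero by simp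
  from polynomial_algebra.cohen_macaulay[OF A.transfer_ring_iso[OF psi_iso this]]
  show ?thesis unfolding R_eq m_eq .
qed

end
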